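(* If $H$ is a torsion-free conjugacy separable hyperbolic group, then the outer automorphism group $\mathrm{Out}(H)=\mathrm{Aut}(H)/\mathrm{Inn}(H)$ is residually finite.
   Context: A group $G$ is conjugacy separable if any two non-conjugate elements of $G$ have non-conjugate images in some finite quotient of $G$. Hyperbolic groups are understood as finitely generated Gromov-hyperbolic groups. *)

theory Defs
  imports "HOL-Algebra.Algebra" Complex_Main
begin

definition torsion_free :: "('a, 'b) monoid_scheme \<Rightarrow> bool" where
  "torsion_free G \<longleftrightarrow>
     (\<forall>x \<in> carrier G. \<forall>n::nat. n > 0 \<longrightarrow> x [^]\<^bsub>G\<^esub> n = \<one>\<^bsub>G\<^esub> \<longrightarrow> x = \<one>\<^bsub>G\<^esub>)"

definition conjugate_in :: "('a, 'b) monoid_scheme \<Rightarrow> 'a \<Rightarrow> 'a \<Rightarrow> bool" where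
  "conjugate_in G x y \<longleftrightarrow>
     (\<exists>g \<in> carrier G. y = g \<otimes>\<^bsub>G\<^esub> x \<otimes>\<^bsub>G\<^esub> inv\<^bsub>G\<^esub> g)"

text \<open>Finite quotients of \<open>G\<close> are taken up to isomorphism, as \<open>G Mod N\<close>; the image of
  \<open>x\<close> under the quotient map is the coset \<open>N #>\<^bsub>G\<^esub> x\<close>.\<close>

definition finite_quotient_kernel :: "'a set \<Rightarrow> ('a, 'b) monoid_scheme \<Rightarrow> bool" where
  "finite_quotient_kernel N G \<longleftrightarrow> N \<lhd> G \<and> finite (carrier (G Mod N))"

definition conjugacy_separable :: "('a, 'b) monoid_scheme \<Rightarrow> bool" where
  "conjugacy_separable G \<longleftrightarrow>
     (\<forall>x \<in> carrier G. \<forall>y \<in> carrier G. \<not> conjugate_in G x y \<longrightarrow>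
        (\<exists>N. finite_quotient_kernel N G \<and>
             \<not> conjugate_in (G Mod N) (N #>\<^bsub>G\<^esub> x) (N #>\<^bsub>G\<^esub> y)))"

definition residually_finite :: "('a, 'b) monoid_scheme \<Rightarrow> bool" where
  "residually_finite G \<longleftrightarrow>
     (\<forall>x \<in> carrier G. x \<noteq> \<one>\<^bsub>G\<^esub> \<longrightarrow>
        (\<exists>N. finite_quotient_kernel N G \<and> N #>\<^bsub>G\<^esub> x \<noteq> \<one>\<^bsub>G Mod N\<^esub>))"

text \<open>The least length of a word over \<open>S\<close> and its inverses representing \<open>g\<close>; only meaningful
  when \<open>S\<close> generates \<open>G\<close>, since the \<open>LEAST\<close> is otherwise unspecified at some \<open>g\<close>.\<close>

definition word_length :: "('a, 'b) monoid_scheme \<Rightarrow> 'a set \<Rightarrow> 'a \<Rightarrow> nat" where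
  "word_length G S g =
     (LEAST n. \<exists>ws. length ws = n \<and> set ws \<subseteq> S \<union> (\<lambda>s. inv\<^bsub>G\<^esub> s) ` S \<and>
                    foldr (\<lambda>a b. a \<otimes>\<^bsub>G\<^esub> b) ws \<one>\<^bsub>G\<^esub> = g)"

definition word_dist :: "('a, 'b) monoid_scheme \<Rightarrow> 'a set \<Rightarrow> 'a \<Rightarrow> 'a \<Rightarrow> real" where
  "word_dist G S x y = real (word_length G S (inv\<^bsub>G\<^esub> x \<otimes>\<^bsub>G\<^esub> y))"

definition gromov_product :: "('a \<Rightarrow> 'a \<Rightarrow> real) \<Rightarrow> 'a \<Rightarrow> 'a \<Rightarrow> 'a \<Rightarrow> real" where
  "gromov_product d w x y = (d x w + d y w - d x y) / 2"

definition gromov_hyperbolic_on :: "'a set \<Rightarrow> ('a \<Rightarrow> 'a \<Rightarrow> real) \<Rightarrow> bool" where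
  "gromov_hyperbolic_on M d \<longleftrightarrow>
     (\<exists>\<delta>. \<forall>w \<in> M. \<forall>x \<in> M. \<forall>y \<in> M. \<forall>z \<in> M.
        gromov_product d w x z \<ge> min (gromov_product d w x y) (gromov_product d w y z) - \<delta>)"

text \<open>Gromov's inequality is imposed on the group with its word metric, that is, on the vertex
  set of the Cayley graph. As every point of the Cayley graph is within distance \<open>1/2\<close> of a
  vertex, this agrees with hyperbolicity of the Cayley graph up to the value of the constant.
  Whether it holds does not depend on the choice of the finite generating set.\<close>

definition hyperbolic_group :: "('a, 'b) monoid_scheme \<Rightarrow> bool" where
  "hyperbolic_group G \<longleftrightarrow> group G \<and>
     (\<exists>S. finite S \<and> S \<subseteq> carrier G \<and> generate G S = carrier G \<and>
          gromov_hyperbolic_on (carrier G) (word_dist G S))"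

definition conj_aut :: "('a, 'b) monoid_scheme \<Rightarrow> 'a \<Rightarrow> 'a \<Rightarrow> 'a" where
  "conj_aut G g = (\<lambda>x \<in> carrier G. g \<otimes>\<^bsub>G\<^esub> x \<otimes>\<^bsub>G\<^esub> inv\<^bsub>G\<^esub> g)"

definition inner_auts :: "('a, 'b) monoid_scheme \<Rightarrow> ('a \<Rightarrow> 'a) set" where
  "inner_auts G = conj_aut G ` carrier G"

definition OutGroup :: "('a, 'b) monoid_scheme \<Rightarrow> ('a \<Rightarrow> 'a) set monoid" where
  "OutGroup G = AutoGroup G Mod inner_auts G"

lemma (in group) conj_aut_hom: "conj_aut G \<in> hom G (AutoGroup G)"
proof -
  have B: "conj_aut G \<in> hom G (BijGroup (carrier G))"
    using conjugation_is_hom unfolding conj_aut_def .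
  have "conj_aut G g \<in> auto G" if g: "g \<in> carrier G" for g
  proof -
    have "conj_aut G g \<in> Bij (carrier G)"
      using B g by (auto simp: hom_def BijGroup_def)
    moreover have "conj_aut G g \<in> hom G G"
      using g by (auto intro!: homI simp: conj_aut_def m_assoc inv_solve_left)
    ultimately show ?thesis by (simp add: auto_def)
  qed
  then show ?thesis
    using B by (auto simp: hom_def AutoGroup_def)
qed

lemma (in group) inner_auts_normal: "inner_auts G \<lhd> AutoGroup G"
proof -
  interpret A: group "AutoGroup G" by (rule AutoGroup)
  interpret h: group_hom G "AutoGroup G" "conj_aut G"
    by unfold_locales (rule conj_aut_hom)
  show ?thesis
    unfolding A.normal_inv_iff
  proof (intro conjI ballI)
    show "subgroup (inner_auts G) (AutoGroup G)"
      unfolding inner_auts_def by (rule h.img_is_subgroup)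
  next
    fix f k
    assume f: "f \<in> carrier (AutoGroup G)" and "k \<in> inner_auts G"
    then obtain g where g: "g \<in> carrier G" "k = conj_aut G g"
      by (auto simp: inner_auts_def)
    have fa: "f \<in> auto G" "f \<in> hom G G" "f \<in> Bij (carrier G)"
      using f by (auto simp: AutoGroup_def auto_def)
    interpret f: group_hom G G f by unfold_locales (rule fa(2))
    have k: "k \<in> auto G" using h.hom_closed[OF g(1)] g by (simp add: AutoGroup_def)
    have c: "conj_aut G (f g) \<in> auto G" using h.hom_closed[of "f g"] g by (simp add: AutoGroup_def)
    have B: "k \<in> Bij (carrier G)" "conj_aut G (f g) \<in> Bij (carrier G)"
      using k c by (auto simp: auto_def)
    have "compose (carrier G) f k = compose (carrier G) (conj_aut G (f g)) f"
      using g by (auto simp: compose_def conj_aut_def fun_eq_iff)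
    then have "f \<otimes>\<^bsub>AutoGroup G\<^esub> k = conj_aut G (f g) \<otimes>\<^bsub>AutoGroup G\<^esub> f"
      using fa B by (simp add: AutoGroup_def BijGroup_def)
    then have "f \<otimes>\<^bsub>AutoGroup G\<^esub> k \<otimes>\<^bsub>AutoGroup G\<^esub> inv\<^bsub>AutoGroup G\<^esub> f = conj_aut G (f g)"
      using f g h.hom_closed[of "f g"] by (simp add: A.m_assoc)
    then show "f \<otimes>\<^bsub>AutoGroup G\<^esub> k \<otimes>\<^bsub>AutoGroup G\<^esub> inv\<^bsub>AutoGroup G\<^esub> f \<in> inner_auts G"
      using g by (auto simp: inner_auts_def)
  qed
qed

end

theory Submission
  imports Defs
begin

text \<open>Grossman: if \<open>\<phi>\<close> maps some \<open>x\<close> to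
  a non-conjugate of \<open>x\<close>, choose a finite quotient \<open>F\<close> that separates the two conjugacy classes. \<open>Out H\<close>
  acts on the finite set of homomorphisms \<open>H \<rightarrow> F\<close> up to conjugacy in \<open>F\<close>, and \<open>\<phi>\<close> acts nontrivially.

  An automorphism \<open>\<phi>\<close> of a torsion-free hyperbolic group that maps every element to a
  conjugate is inner. One may assume that \<open>\<phi>\<close> fixes some \<open>a \<noteq> 1\<close>. For \<open>c\<close> outside the centralizer \<open>A\<close>
  of \<open>a\<close>, the elements \<open>a\<^sup>n c\<close> and \<open>a\<^sup>n \<phi>(c)\<close> are conjugate for all \<open>n\<close>. For large \<open>n\<close> the conjugating
  element carries a long segment of the axis of \<open>a\<close> close to a segment of a translate of that axis,
  and pigeonholing yields \<open>h \<in> A\<close> with \<open>\<phi>(c) = h c h\<^sup>-\<^sup>1\<close>. Comparing the conjugators of \<open>c\<close>, \<open>e\<close> and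
  \<open>c a\<^sup>k e\<close> and using that \<open>A\<close> is malnormal shows that \<open>h\<close> does not depend on \<open>c\<close>.\<close>

section \<open>Collisions and almost linear sequences\<close>

text \<open>The powers of an element of infinite order form only a quasi-geodesic, and the usual
  remedy is stability of quasi-geodesics. Here the defect is removed at the source:
  \<open>len (a [^] n)\<close> stays within a constant of a multiple of \<open>n\<close>. Gromov
  products of points on an axis are then explicit up to a bounded error, and the four-point
  inequality carries all later geometry.

  The order of the algebra is shaped by a circularity: unique roots would be easy if centralizers
  were known to be abelian, but that is itself deduced from unique roots. A transfer homomorphism to
  the integers breaks the circle.

  A conjugator from \<open>a\<^sup>n c\<close> to \<open>g = a\<^sup>n c'\<close> can be altered by
  any power of \<open>g\<close>, so it need not lie anywhere near the centralizer of
  \<open>a\<close>. The power that has to be divided out is read off from the translate of the axis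
  that the conjugator meets. This is why the axis of \<open>g\<close>, and not only that of
  \<open>a\<close>, has to be controlled uniformly in \<open>n\<close>.\<close>

lemma finite_collision:
  fixes f :: "nat \<Rightarrow> 'a"
  assumes "finite B" "\<And>i. i \<le> n \<Longrightarrow> f i \<in> B" "card B \<le> n"
  obtains i j where "i < j" "j \<le> n" "f i = f j"
proof -
  have "f ` {..n} \<subseteq> B" using assms(2) by auto
  then have "card (f ` {..n}) \<le> n" using card_mono[OF assms(1)] assms(3) order_trans by blast
  then have "\<not> inj_on f {..n}" by (auto dest: card_image)
  then obtain i j where "i \<le> n" "j \<le> n" "f i = f j" "i \<noteq> j" by (auto simp: inj_on_def)
  then show ?thesis using that[of i j] that[of j i] by (cases "i < j") auto
qed

lemma finite_range_imp_collision:
  fixes f :: "nat \<Rightarrow> 'a"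
  assumes "finite (range f)"
  obtains i j where "f i = f j" "i < j"
proof -
  have "\<not> inj f" using assms finite_imageD infinite_UNIV_nat by blast
  then show ?thesis using that linorder_injI[of f] by metis
qed

lemma finite_image_if_determined:
  assumes "finite (k ` A)" and "\<And>x y. \<lbrakk>x \<in> A; y \<in> A; k x = k y\<rbrakk> \<Longrightarrow> f x = f y"
  shows "finite (f ` A)"
proof (rule finite_subset)
  show "finite ((\<lambda>z. f (SOME x. x \<in> A \<and> k x = z)) ` k ` A)" using assms(1) by simp
  show "f ` A \<subseteq> (\<lambda>z. f (SOME x. x \<in> A \<and> k x = z)) ` k ` A"
  proof clarify
    fix x assume x: "x \<in> A"
    have "f x = f (SOME y. y \<in> A \<and> k y = k x)"
      using assms(2) someI[of "\<lambda>y. y \<in> A \<and> k y = k x" x] x by metis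
    then show "f x \<in> (\<lambda>z. f (SOME x. x \<in> A \<and> k x = z)) ` k ` A" using x by blast
  qed
qed

text \<open>Division with remainder by \<open>k\<close>: the quotient part grows with slope at most
  \<open>s\<close>, and the \<open>k\<close> possible remainders contribute a bounded error. A
  single index below a line through the origin thus bounds the whole sequence by a parallel
  line.\<close>

lemma subadditive_slope:
  fixes l :: "nat \<Rightarrow> real" and s :: real
  assumes sub: "\<And>m n. l (m + n) \<le> l m + l n" and k: "k \<ge> 1" and s: "s \<ge> 0" "l k \<le> s * k"
  shows "\<exists>C\<ge>0. \<forall>n. l n \<le> s * n + C"
proof -
  define C where "C = (\<Sum>r<k. \<bar>l r\<bar>)"
  have mult: "l (q * k + r) \<le> q * l k + l r" for q r
  proof (induction q)
    case (Suc q)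
    have "l (Suc q * k + r) \<le> l k + l (q * k + r)"
      using sub[of k "q * k + r"] by (simp add: add.assoc)
    with Suc show ?case by (simp add: algebra_simps)
  qed simp
  have "l n \<le> s * n + C" for n
  proof -
    have "l n \<le> (n div k) * l k + l (n mod k)"
      using mult[of "n div k" "n mod k"] by simp
    moreover have "l (n mod k) \<le> C"
    proof -
      have "\<bar>l (n mod k)\<bar> \<le> C"
        unfolding C_def by (rule member_le_sum) (use k in auto)
      then show ?thesis by linarith
    qed
    moreover have "(n div k) * l k \<le> (n div k) * (s * k)"
      using s by (intro mult_left_mono) auto
    moreover have "(n div k) * (s * k) \<le> s * n"
    proof -
      have "real (n div k * k) \<le> real n" by (subst of_nat_le_iff) simp
      then have "s * real (n div k * k) \<le> s * real n" using s by (intro mult_left_mono) auto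
      then show ?thesis by (simp add: algebra_simps)
    qed
    ultimately show ?thesis by linarith
  qed
  moreover have "C \<ge> 0" unfolding C_def by (simp add: sum_nonneg)
  ultimately show ?thesis by blast
qed

text \<open>The excess \<open>l n - \<tau> n\<close> is sublinear. At an index where it attains a new maximum, the
  four-point inequality bounds it by half its maximum on twice the range, so it is bounded.\<close>

lemma almost_linear:
  fixes l :: "nat \<Rightarrow> real" and \<epsilon> \<delta> :: real
  assumes sub: "\<And>m n. l (m + n) \<le> l m + l n" and eps: "\<epsilon> > 0" "\<And>n. \<epsilon> * n \<le> l n"
    and \<delta>: "\<delta> \<ge> 0"
    and hyp: "\<And>m n. 2 * l (n + m) \<le> max (2 * l n) (l (2 * n + m) + l m) + 2 * \<delta>"
  shows "\<exists>\<tau>>0. \<exists>C\<ge>0. \<forall>n. \<tau> * n \<le> l n \<and> l n \<le> \<tau> * n + C"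
proof -
  define \<tau> where "\<tau> = (INF n\<in>{1::nat..}. l n / n)"
  have bdd: "bdd_below ((\<lambda>n. l n / n) ` {1::nat..})"
    using eps by (intro bdd_belowI[where m=\<epsilon>]) (auto simp: field_simps)
  have "\<epsilon> \<le> \<tau>" unfolding \<tau>_def
    using eps by (intro cINF_greatest) (auto simp: field_simps)
  then have tau: "\<tau> > 0" using eps by linarith
  have low: "\<tau> * n \<le> l n" for n
  proof (cases "n = 0")
    case True then show ?thesis using eps(2)[of 0] by simp
  next
    case False
    have "\<tau> \<le> l n / n" unfolding \<tau>_def by (rule cINF_lower) (use False bdd in auto)
    then show ?thesis using False by (simp add: field_simps)
  qed
  define e where "e = (\<lambda>n. l n - \<tau> * n)"
  have e0: "e n \<ge> 0" for n using low by (simp add: e_def)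
  \<comment> \<open>At a record index \<open>M' = n + m0\<close> this gives
    \<open>l M' > l n + \<delta>\<close>, which excludes the first term of the maximum in
    \<open>hyp\<close>.\<close>
  obtain m0 :: nat where m0: "\<tau> * m0 > \<delta>"
    using reals_Archimedean3[OF tau] by (auto simp: mult.commute)
  define A where "A = (\<Sum>n\<le>m0. e n)"
  define c where "c = A + \<delta>"
  have A: "e n \<le> A" if "n \<le> m0" for n
    unfolding A_def by (rule member_le_sum) (use that e0 in auto)
  have A0: "A \<ge> 0" unfolding A_def by (simp add: sum_nonneg e0)
  then have c0: "c \<ge> 0" using \<delta> by (simp add: c_def)
  have step: "e M \<le> r * M + (C / 2 + c)"
    if r: "r \<ge> 0" and C: "C \<ge> 0" and H: "\<And>n. e n \<le> r * n + C" for r C M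
  proof -
    obtain M' where M': "M' \<le> M" "\<And>n. n \<le> M \<Longrightarrow> e n \<le> e M'"
    proof -
      have "Max (e ` {..M}) \<in> e ` {..M}" by (rule Max_in) auto
      then obtain M' where "M' \<le> M" "e M' = Max (e ` {..M})" by (metis imageE atMost_iff)
      then show ?thesis using that by simp
    qed
    have rM: "r * M' \<le> r * M" using r M' by (intro mult_left_mono) auto
    show ?thesis
    proof (cases "M' < m0")
      case True
      then have "e M \<le> A" using A[of M'] M'(2)[of M] by simp
      then show ?thesis using r C \<delta> by (simp add: c_def add_increasing)
    next
      case False
      define n where "n = M' - m0"
      have M'n: "M' = n + m0" using False by (simp add: n_def)
      have "e n \<le> e M'" using M' M'n by simp
      then have "l M' > l n + \<delta>" using m0 by (simp add: e_def M'n algebra_simps)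
      then have "2 * l M' \<le> l (2 * n + m0) + l m0 + 2 * \<delta>"
        using hyp[of n m0] by (simp add: M'n)
      then have "2 * e M' \<le> e (2 * n + m0) + e m0 + 2 * \<delta>"
        by (simp add: e_def M'n algebra_simps)
      moreover have "e (2 * n + m0) \<le> r * (2 * n + m0) + C" using H[of "2 * n + m0"] by simp
      moreover have "r * (2 * n + m0) \<le> 2 * (r * M')" using r by (simp add: M'n algebra_simps)
      moreover have "e m0 \<le> A" using A by simp
      moreover have "e M \<le> e M'" using M' by simp
      ultimately show ?thesis using rM A0 by (simp add: c_def)
    qed
  qed
  \<comment> \<open>Each step halves the constant and adds \<open>c\<close>, so it tends to the
    fixed point \<open>2 * c\<close>, which does not depend on the slope \<open>r\<close>.\<close>
  have iter: "e n \<le> r * n + (C / 2 ^ j + 2 * c)"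
    if r: "r \<ge> 0" and C: "C \<ge> 0" and H: "\<And>n. e n \<le> r * n + C" for r C n j
  proof (induction j arbitrary: n)
    case 0 then show ?case using H[of n] c0 by simp
  next
    case (Suc j)
    have "e n \<le> r * n + ((C / 2 ^ j + 2 * c) / 2 + c)"
      by (rule step) (use r C c0 Suc in \<open>auto\<close>)
    then show ?case by (simp add: field_simps)
  qed
  have "e n \<le> 2 * c + 2" for n
  proof -
    \<comment> \<open>The slope is adapted to \<open>n\<close> so that \<open>r * n\<close> stays
      below 1. The constant belonging to this slope may be huge, but the iteration removes
      it.\<close>
    define r where "r = 1 / (real n + 1)"
    have r: "r > 0" "r * n \<le> 1" by (auto simp: r_def field_simps)
    have "(INF n\<in>{1::nat..}. l n / n) < \<tau> + r" using r by (simp add: \<tau>_def)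
    then obtain k where k: "k \<ge> 1" "l k / k < \<tau> + r"
      using cINF_less_iff[OF _ bdd] by auto
    then have "l k \<le> (\<tau> + r) * k" by (simp add: field_simps)
    then obtain C where C: "C \<ge> 0" "\<And>n. l n \<le> (\<tau> + r) * n + C"
      using subadditive_slope[OF sub k(1), of "\<tau> + r"] tau r by auto
    have H: "e n \<le> r * n + C" for n using C(2)[of n] by (simp add: e_def algebra_simps)
    obtain j where "C < 2 ^ j" using real_arch_pow[of 2 C] by auto
    then have "C / 2 ^ j \<le> 1" by (simp add: field_simps)
    then show ?thesis using iter[OF _ C(1) H, of n j] r by linarith
  qed
  then have "l n \<le> \<tau> * n + (2 * c + 2)" for n by (simp add: e_def algebra_simps)
  then show ?thesis using tau low c0 by (intro exI[of _ \<tau>] conjI exI[of _ "2 * c + 2"]) auto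
qed

section \<open>Roots, centralizers and transfer in groups\<close>

context group
begin

lemma inv_cancel_left:
  "\<lbrakk>x \<in> carrier G; y \<in> carrier G\<rbrakk> \<Longrightarrow> inv x \<otimes> (x \<otimes> y) = y"
  "\<lbrakk>x \<in> carrier G; y \<in> carrier G\<rbrakk> \<Longrightarrow> x \<otimes> (inv x \<otimes> y) = y"
  by (simp_all flip: m_assoc)

lemmas group_normalize = m_assoc inv_mult_group inv_cancel_left

lemma int_pow_conj:
  assumes "x \<in> carrier G" "a \<in> carrier G"
  shows "(x \<otimes> a \<otimes> inv x) [^] (i::int) = x \<otimes> a [^] i \<otimes> inv x"
proof -
  have "(\<lambda>y. x \<otimes> y \<otimes> inv x) \<in> hom G G"
    using assms by (intro homI) (simp_all add: group_normalize)
  from hom_int_pow[OF this assms(2) is_group is_group, of i] show ?thesis by simp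
qed

lemma nat_pow_conj:
  assumes "x \<in> carrier G" "a \<in> carrier G"
  shows "(x \<otimes> a \<otimes> inv x) [^] (i::nat) = x \<otimes> a [^] i \<otimes> inv x"
  using int_pow_conj[OF assms, of "int i"] by (simp add: int_pow_int)

lemma nat_pow_diff: "\<lbrakk>a \<in> carrier G; j \<le> n\<rbrakk> \<Longrightarrow> inv (a [^] j) \<otimes> a [^] (n::nat) = a [^] (n - j)"
  using nat_pow_mult[of a j "n - j"] inv_cancel_left(1)[of "a [^] j" "a [^] (n - j)"] by simp

definition cent :: "'a \<Rightarrow> 'a set" where
  "cent a = {x \<in> carrier G. x \<otimes> a = a \<otimes> x}"

lemma cent_carrier: "x \<in> cent a \<Longrightarrow> x \<in> carrier G"
  by (simp add: cent_def)

lemma cent_iff: "\<lbrakk>a \<in> carrier G; x \<in> carrier G\<rbrakk> \<Longrightarrow> x \<in> cent a \<longleftrightarrow> x \<otimes> a \<otimes> inv x = a"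
  by (auto simp: cent_def group_normalize inv_solve_right) 
     (metis inv_solve_right' m_assoc m_closed inv_closed)+

lemma cent_self: "a \<in> carrier G \<Longrightarrow> a \<in> cent a"
  by (simp add: cent_def)

lemma subgroup_cent:
  assumes a: "a \<in> carrier G"
  shows "subgroup (cent a) G"
proof (rule subgroupI)
  show "cent a \<noteq> {}" using cent_self[OF a] by blast
next
  fix x assume x: "x \<in> cent a"
  then have xc: "x \<in> carrier G" "x \<otimes> a = a \<otimes> x" by (auto simp: cent_def)
  have "inv x \<otimes> a = inv x \<otimes> (a \<otimes> x) \<otimes> inv x" using xc a by (simp add: group_normalize)
  also have "\<dots> = a \<otimes> inv x" unfolding xc(2)[symmetric] using xc(1) a by (simp add: group_normalize)
  finally show "inv x \<in> cent a" using xc by (simp add: cent_def)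
next
  fix x y assume "x \<in> cent a" "y \<in> cent a"
  then have xy: "x \<in> carrier G" "y \<in> carrier G" "x \<otimes> a = a \<otimes> x" "y \<otimes> a = a \<otimes> y" by (auto simp: cent_def)
  have "x \<otimes> y \<otimes> a = x \<otimes> (y \<otimes> a)" using xy(1,2) a by (simp add: m_assoc)
  also have "\<dots> = x \<otimes> a \<otimes> y" unfolding xy(4) using xy(1,2) a by (simp add: m_assoc)
  also have "\<dots> = a \<otimes> (x \<otimes> y)" unfolding xy(3) using xy(1,2) a by (simp add: m_assoc)
  finally show "x \<otimes> y \<in> cent a" using xy a by (simp add: cent_def)
qed (auto simp: cent_def)

lemma cent_pow:
  assumes a: "a \<in> carrier G" and x: "x \<in> cent a"
  shows "x \<in> cent (a [^] (i::int))"
proof -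
  have xc: "x \<in> carrier G" using x by (rule cent_carrier)
  have "x \<otimes> a [^] i \<otimes> inv x = a [^] i"
    using int_pow_conj[OF xc a, of i] x xc a by (simp add: cent_iff)
  then show ?thesis using xc a by (simp add: cent_iff)
qed

lemma cent_sym: "\<lbrakk>x \<in> cent a; a \<in> carrier G\<rbrakk> \<Longrightarrow> a \<in> cent x"
  by (simp add: cent_def)

lemma pow_in_cent: "\<lbrakk>a \<in> carrier G; x \<in> cent a\<rbrakk> \<Longrightarrow> x [^] (i::int) \<in> cent a"
  using cent_pow[of x a i] cent_sym[of x a] cent_carrier[of x a] by (auto simp: cent_def)

text \<open>The transfer homomorphism of \<open>A\<close> into the central subgroup generated by \<open>z\<close>.\<close>

lemma transfer_hom:
  assumes A: "subgroup A G" and z: "z \<in> A" "A \<subseteq> cent z"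
    and inf: "\<And>i::int. z [^] i = \<one> \<Longrightarrow> i = 0"
    and F: "finite F" "F \<subseteq> A" "\<And>h. h \<in> A \<Longrightarrow> \<exists>i::int. h \<otimes> z [^] i \<in> F"
  shows "\<exists>T::'a \<Rightarrow> int. \<exists>k\<noteq>0. (\<forall>g\<in>A. \<forall>h\<in>A. T (g \<otimes> h) = T g + T h) \<and> (\<forall>i::int. T (z [^] i) = k * i)"
proof -
  interpret A: subgroup A G by (rule A)
  have zc: "z \<in> carrier G" using z by auto
  have AG: "x \<in> carrier G" if "x \<in> A" for x using that by auto
  have zA: "z [^] i \<in> A" for i :: int by (rule subgroup_int_pow_closed[OF A z(1)])
  have comm: "z [^] i \<otimes> x = x \<otimes> z [^] i" if "x \<in> A" for x and i :: int
  proof -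
    have "x \<in> cent (z [^] i)" using cent_pow[OF zc] z that by blast
    then show ?thesis by (simp add: cent_def)
  qed
  define orb where "orb = (\<lambda>h. {h \<otimes> z [^] (i::int) |i. True})"
  have orb_shift: "orb (h \<otimes> z [^] k) = orb h" if h: "h \<in> A" for h and k :: int
  proof -
    have "h \<otimes> z [^] k \<otimes> z [^] i = h \<otimes> z [^] (k + i)" for i :: int
      using h zc by (simp add: m_assoc int_pow_mult)
    moreover have "h \<otimes> z [^] i = h \<otimes> z [^] k \<otimes> z [^] (i - k)" for i :: int
      using h zc by (simp add: m_assoc flip: int_pow_mult)
    ultimately show ?thesis unfolding orb_def by blast
  qed
  \<comment> \<open>\<open>rep\<close> depends only on the coset of \<open>h\<close> modulo the
    powers of \<open>z\<close>, and \<open>e h\<close> will record the position of \<open>h\<close>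
    within that coset.\<close>
  define rep where "rep = (\<lambda>h. SOME f. f \<in> orb h \<and> f \<in> F)"
  have rep: "rep h \<in> orb h" "rep h \<in> F" if "h \<in> A" for h
    using someI_ex[of "\<lambda>f. f \<in> orb h \<and> f \<in> F"] F(3)[OF that] unfolding rep_def orb_def by blast+
  have repA: "rep h \<in> A" if "h \<in> A" for h using rep(2)[OF that] F(2) by blast
  have rep_shift: "rep (h \<otimes> z [^] k) = rep h" if "h \<in> A" for h and k :: int
    unfolding rep_def orb_shift[OF that] ..
  define e where "e = (\<lambda>h. THE i::int. h = rep h \<otimes> z [^] i)"
  have zinj: "i = j" if "z [^] i = z [^] j" for i j :: int
    using inf[of "i - j"] that zc by (simp add: int_pow_diff)
  have ex1: "\<exists>!i::int. h = rep h \<otimes> z [^] i" if h: "h \<in> A" for h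
  proof -
    obtain i :: int where "rep h = h \<otimes> z [^] i" using rep(1)[OF h] by (auto simp: orb_def)
    then have "h = rep h \<otimes> z [^] (- i)" using h zc by (simp add: m_assoc int_pow_neg)
    moreover have "i = j" if "h = rep h \<otimes> z [^] i" "h = rep h \<otimes> z [^] j" for i j :: int
      using that zinj repA[OF h] zc by (metis AG int_pow_closed l_cancel)
    ultimately show ?thesis by blast
  qed
  have e: "h = rep h \<otimes> z [^] e h" if "h \<in> A" for h
    unfolding e_def by (rule theI'[OF ex1[OF that]])
  have e_eq: "e h = i" if "h \<in> A" "h = rep h \<otimes> z [^] i" for h i
    unfolding e_def using ex1[OF that(1)] that(2) by (metis (mono_tags, lifting) the_equality)
  have e_shift: "e (h \<otimes> z [^] k) = e h + k" if h: "h \<in> A" for h and k :: int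
  proof (rule e_eq)
    show "h \<otimes> z [^] k \<in> A" using h zA by simp
    have "h \<otimes> z [^] k = rep h \<otimes> z [^] e h \<otimes> z [^] k" using e[OF h] by simp
    also have "\<dots> = rep h \<otimes> z [^] (e h + k)"
      using repA[OF h] zc by (simp add: m_assoc int_pow_mult)
    finally show "h \<otimes> z [^] k = rep (h \<otimes> z [^] k) \<otimes> z [^] (e h + k)"
      unfolding rep_shift[OF h] .
  qed
  define R where "R = rep ` A"
  have finR: "finite R" unfolding R_def by (rule finite_subset[OF _ F(1)]) (use rep in auto)
  have RA: "R \<subseteq> A" unfolding R_def using repA by auto
  have rep_rep: "rep r = r" if "r \<in> R" for r
  proof -
    obtain h where h: "h \<in> A" "r = rep h" using \<open>r \<in> R\<close> by (auto simp: R_def)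
    then obtain i :: int where "r = h \<otimes> z [^] i" using rep(1) by (auto simp: orb_def)
    then show ?thesis using rep_shift h by simp
  qed
  have e0: "e r = 0" if "r \<in> R" for r
    using that RA rep_rep by (intro e_eq) auto
  \<comment> \<open>Left translation by \<open>g\<close> permutes the cosets; \<open>T g\<close>
    adds up the exponents by which it misses the chosen representatives.\<close>
  define T where "T = (\<lambda>g. \<Sum>r\<in>R. e (g \<otimes> r))"
  have bij: "bij_betw (\<lambda>r. rep (h \<otimes> r)) R R" if h: "h \<in> A" for h
  proof -
    have inj: "inj_on (\<lambda>r. rep (h \<otimes> r)) R"
    proof (rule inj_onI)
      fix r r' assume r: "r \<in> R" "r' \<in> R" and eq: "rep (h \<otimes> r) = rep (h \<otimes> r')"
      have rA: "r \<in> A" "r' \<in> A" using r RA by auto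
      have "h \<otimes> r = rep (h \<otimes> r) \<otimes> z [^] e (h \<otimes> r)" using e h rA by simp
      also have "rep (h \<otimes> r) = h \<otimes> r' \<otimes> z [^] (- e (h \<otimes> r'))"
        using e[of "h \<otimes> r'"] repA[of "h \<otimes> r'"] h rA zc unfolding eq
        by (metis AG A.m_closed int_pow_neg int_pow_closed inv_solve_right')
      also have "h \<otimes> r' \<otimes> z [^] (- e (h \<otimes> r')) \<otimes> z [^] e (h \<otimes> r)
        = h \<otimes> (r' \<otimes> z [^] (- e (h \<otimes> r') + e (h \<otimes> r)))"
        using h rA zc unfolding int_pow_mult[OF zc] by (simp add: m_assoc)
      finally have "r = r' \<otimes> z [^] (- e (h \<otimes> r') + e (h \<otimes> r))"
        using h rA zc by (simp only: AG l_cancel m_closed int_pow_closed)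
      then have "rep r = rep r'" using rep_shift[OF rA(2)] by metis
      then show "r = r'" using rep_rep r by simp
    qed
    moreover have "(\<lambda>r. rep (h \<otimes> r)) ` R \<subseteq> R" using RA h unfolding R_def by auto
    ultimately show ?thesis
      unfolding bij_betw_def using finR by (simp add: endo_inj_surj)
  qed
  have "T (g \<otimes> h) = T g + T h" if g: "g \<in> A" and h: "h \<in> A" for g h
  proof -
    have "e (g \<otimes> h \<otimes> r) = e (g \<otimes> rep (h \<otimes> r)) + e (h \<otimes> r)" if r: "r \<in> R" for r
    proof -
      have rA: "r \<in> A" using r RA by auto
      have "g \<otimes> h \<otimes> r = g \<otimes> (h \<otimes> r)" using g h rA by (simp add: m_assoc)
      also have "\<dots> = g \<otimes> (rep (h \<otimes> r) \<otimes> z [^] e (h \<otimes> r))" using e[of "h \<otimes> r"] h rA by simp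
      also have "\<dots> = g \<otimes> rep (h \<otimes> r) \<otimes> z [^] e (h \<otimes> r)"
        using g h rA repA zc by (simp add: m_assoc)
      finally show ?thesis using e_shift[of "g \<otimes> rep (h \<otimes> r)"] g h rA repA by simp
    qed
    then have "T (g \<otimes> h) = (\<Sum>r\<in>R. e (g \<otimes> rep (h \<otimes> r))) + T h"
      unfolding T_def by (simp add: sum.distrib)
    also have "(\<Sum>r\<in>R. e (g \<otimes> rep (h \<otimes> r))) = T g"
      unfolding T_def using sum.reindex_bij_betw[OF bij[OF h], of "\<lambda>r. e (g \<otimes> r)"] by simp
    finally show ?thesis .
  qed
  moreover have "T (z [^] i) = int (card R) * i" for i :: int
  proof -
    have "e (z [^] i \<otimes> r) = i" if r: "r \<in> R" for r
      using e_shift[of r i] e0[OF r] comm[of r i] r RA by auto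
    then show ?thesis by (simp add: T_def)
  qed
  moreover have "int (card R) \<noteq> 0" using finR z(1) by (auto simp: R_def)
  ultimately show ?thesis by blast
qed

end

section \<open>Hyperbolic length functions\<close>

text \<open>These properties are all that is used of a word length: finite balls serve pigeonholing,
  discrete geodesics supply midpoints, and hyperbolicity is put in the symmetric four-point form,
  which singles out no base point.\<close>

locale hyperbolic_length = group G for G (structure) +
  fixes len :: "'a \<Rightarrow> nat" and \<delta> :: real
  assumes len_one [simp]: "len \<one> = 0"
    and len_inv [simp]: "x \<in> carrier G \<Longrightarrow> len (inv x) = len x"
    and len_mult: "\<lbrakk>x \<in> carrier G; y \<in> carrier G\<rbrakk> \<Longrightarrow> len (x \<otimes> y) \<le> len x + len y"
    and finite_ball: "finite {x \<in> carrier G. len x \<le> r}"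
    and geodesic: "\<lbrakk>x \<in> carrier G; k \<le> len x\<rbrakk>
      \<Longrightarrow> \<exists>y\<in>carrier G. len y = k \<and> len (inv y \<otimes> x) = len x - k"
    and hyperbolic: "\<lbrakk>w \<in> carrier G; x \<in> carrier G; y \<in> carrier G; z \<in> carrier G\<rbrakk>
      \<Longrightarrow> real (len (inv w \<otimes> y)) + len (inv x \<otimes> z)
        \<le> max (real (len (inv w \<otimes> x)) + len (inv y \<otimes> z)) (real (len (inv w \<otimes> z)) + len (inv x \<otimes> y)) + 2 * \<delta>"
begin

section \<open>The left-invariant metric and its Gromov products\<close>

definition d :: "'a \<Rightarrow> 'a \<Rightarrow> real" where
  "d x y = len (inv x \<otimes> y)"

definition gp :: "'a \<Rightarrow> 'a \<Rightarrow> 'a \<Rightarrow> real" where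
  "gp w x y = (d w x + d w y - d x y) / 2"

lemma d_nonneg [simp]: "d x y \<ge> 0"
  by (simp add: d_def)

lemma d_refl [simp]: "x \<in> carrier G \<Longrightarrow> d x x = 0"
  by (simp add: d_def)

lemma d_commute: "\<lbrakk>x \<in> carrier G; y \<in> carrier G\<rbrakk> \<Longrightarrow> d x y = d y x"
  using len_inv[of "inv x \<otimes> y"] by (simp add: d_def group_normalize)

lemma d_triangle:
  "\<lbrakk>x \<in> carrier G; y \<in> carrier G; z \<in> carrier G\<rbrakk> \<Longrightarrow> d x z \<le> d x y + d y z"
  using len_mult[of "inv x \<otimes> y" "inv y \<otimes> z"] by (simp add: d_def group_normalize)

lemma d_translate [simp]:
  "\<lbrakk>g \<in> carrier G; x \<in> carrier G; y \<in> carrier G\<rbrakk> \<Longrightarrow> d (g \<otimes> x) (g \<otimes> y) = d x y"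
  by (simp add: d_def group_normalize)

lemma d_one [simp]: "x \<in> carrier G \<Longrightarrow> d \<one> x = len x"
  by (simp add: d_def)

lemma four_point:
  "\<lbrakk>w \<in> carrier G; x \<in> carrier G; y \<in> carrier G; z \<in> carrier G\<rbrakk>
    \<Longrightarrow> d w y + d x z \<le> max (d w x + d y z) (d w z + d x y) + 2 * \<delta>"
  unfolding d_def by (rule hyperbolic)

lemma \<delta>_nonneg: "\<delta> \<ge> 0"
  using four_point[of \<one> \<one> \<one> \<one>] by simp

lemma gp_commute: "\<lbrakk>x \<in> carrier G; y \<in> carrier G\<rbrakk> \<Longrightarrow> gp w x y = gp w y x"
  by (simp add: gp_def d_commute[of x y])

lemma gp_min:
  assumes "w \<in> carrier G" "x \<in> carrier G" "y \<in> carrier G" "z \<in> carrier G"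
  shows "min (gp w x y) (gp w y z) \<le> gp w x z + \<delta>"
proof -
  have "d w y + d x z \<le> max (d w x + d y z) (d w z + d x y) + 2 * \<delta>"
    using four_point[of w x y z] assms by simp
  then show ?thesis
    by (auto simp: gp_def field_simps max_def min_def split: if_splits)
qed

text \<open>The quasi-centre argument: for suitable \<open>K\<close> the finite orbit segment \<open>{g\<^sup>i | i \<le> K}\<close> and its
  first \<open>N\<close> translates lie in a ball whose radius is the minimal radius of the segment itself.
  Any two centres of such balls are close, so \<open>N + 1\<close> translates of a centre lie in a ball with
  at most \<open>N\<close> elements.\<close>

lemma sublinear_imp_torsion:
  assumes g: "g \<in> carrier G"
    and sub: "\<And>\<epsilon>::real. \<epsilon> > 0 \<Longrightarrow> \<exists>C. \<forall>n::nat. real (len (g [^] n)) \<le> \<epsilon> * real n + C"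
  shows "\<exists>m::nat\<ge>1. g [^] m = \<one>"
proof -
  \<comment> \<open>The radius is the bound that \<open>close\<close> will give for the distance
    between two centres.\<close>
  define B where "B = {x \<in> carrier G. len x \<le> nat \<lfloor>4 * \<delta> + 1\<rfloor>}"
  define N where "N = card B"
  have finB: "finite B" unfolding B_def by (rule finite_ball)
  define R where "R = (\<lambda>K r. \<exists>c\<in>carrier G. \<forall>i\<le>K. d c (g [^] (i::nat)) \<le> real r)"
  define r where "r = (\<lambda>K. LEAST r. R K r)"
  have ex: "R K (\<Sum>i\<le>K. len (g [^] i))" for K
    unfolding R_def
  proof (intro bexI[of _ \<one>] allI impI)
    fix i assume "i \<le> K"
    then have "len (g [^] i) \<le> (\<Sum>i\<le>K. len (g [^] i))" by (intro member_le_sum) auto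
    then show "d \<one> (g [^] i) \<le> real (\<Sum>i\<le>K. len (g [^] i))" using g by (simp only: d_one nat_pow_closed of_nat_le_iff)
  qed simp
  have rR: "R K (r K)" for K unfolding r_def using ex by (rule LeastI)
  have rmin: "R K s \<Longrightarrow> r K \<le> s" for K s unfolding r_def by (rule Least_le)
  have "\<exists>K. r (K + N) \<le> r K"
  proof (rule ccontr)
    assume "\<not> ?thesis"
    then have inc: "r K + 1 \<le> r (K + N)" for K by (simp add: not_le Suc_le_eq)
    have lower: "j \<le> r (j * N)" for j
    proof (induction j)
      case (Suc j)
      then show ?case using inc[of "j * N"] by (simp add: add.commute)
    qed simp
    \<comment> \<open>With this slope the radius at \<open>j * N\<close> is at most
      \<open>j / 2\<close> plus a constant, whereas a radius that increases every \<open>N\<close>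
      steps is at least \<open>j\<close> there.\<close>
    have "1 / (2 * (real N + 1)) > 0" by simp
    from sub[OF this] obtain C where C: "\<And>n::nat. real (len (g [^] n)) \<le> 1 / (2 * (real N + 1)) * real n + C"
      by blast
    have C0: "C \<ge> 0" using C[of 0] by simp
    have upper: "r K \<le> 1 / (2 * (real N + 1)) * K + C + 1" for K
    proof -
      define s where "s = nat \<lceil>1 / (2 * (real N + 1)) * K + C\<rceil>"
      have s: "1 / (2 * (real N + 1)) * K + C \<le> s" "s \<le> 1 / (2 * (real N + 1)) * K + C + 1"
        unfolding s_def using add_nonneg_nonneg[OF _ C0, of "1 / (2 * (real N + 1)) * K"] by simp_all
      have "R K s" unfolding R_def
      proof (intro bexI[of _ \<one>] allI impI)
        fix i assume "i \<le> K"
        then have "1 / (2 * (real N + 1)) * i \<le> 1 / (2 * (real N + 1)) * K"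
          by (intro mult_left_mono) auto
        then show "d \<one> (g [^] i) \<le> real s" using C[of i] s(1) g by (simp only: d_one nat_pow_closed)
      qed simp
      then have "r K \<le> s" by (rule rmin)
      with s show ?thesis by linarith
    qed
    define j where "j = nat \<lceil>2 * C + 4\<rceil>"
    have j: "real j \<ge> 2 * C + 4" unfolding j_def by linarith
    have "real j \<le> 1 / (2 * (real N + 1)) * (j * N) + C + 1"
      using lower[of j] upper[of "j * N"] by (meson of_nat_mono order_trans)
    moreover have "1 / (2 * (real N + 1)) * (j * N) \<le> j / 2"
      by (simp add: field_simps)
    ultimately show False using j by linarith
  qed
  then obtain K where K: "r (K + N) \<le> r K" by blast
  obtain c where c: "c \<in> carrier G" "\<And>i. i \<le> K + N \<Longrightarrow> d c (g [^] i) \<le> r (K + N)"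
    using rR[of "K + N"] unfolding R_def by blast
  have close: "d c c' \<le> 4 * \<delta> + 1"
    if c': "c' \<in> carrier G" "\<And>i. i \<le> K \<Longrightarrow> d c' (g [^] i) \<le> r K" for c'
  proof -
    define l where "l = len (inv c \<otimes> c')"
    obtain m0 where m0: "m0 \<in> carrier G" "len m0 = l div 2" "len (inv m0 \<otimes> (inv c \<otimes> c')) = l - l div 2"
      using geodesic[of "inv c \<otimes> c'" "l div 2"] c c' by (auto simp: l_def)
    \<comment> \<open>If \<open>c\<close> and \<open>c'\<close> were far apart, their midpoint would
      be a centre of the short segment with radius below \<open>r K\<close>. Rounding the halves of
      \<open>l\<close> costs the summand 1 in \<open>4 * \<delta> + 1\<close>.\<close>
    define m where "m = c \<otimes> m0"
    have m: "m \<in> carrier G" "d c m = l div 2" "d m c' = l - l div 2"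
      using m0 c c' by (simp_all add: m_def d_def group_normalize)
    have l: "d c c' = l" by (simp add: l_def d_def)
    have mid: "d c m \<le> (real l + 1) / 2" "d m c' \<le> (real l + 1) / 2"
    proof -
      have "2 * (l div 2) \<le> l + 1" "2 * (l - l div 2) \<le> l + 1" by presburger+
      from this[THEN of_nat_mono[where 'a=real]] m(2,3)
      show "d c m \<le> (real l + 1) / 2" "d m c' \<le> (real l + 1) / 2"
        by (simp_all only: of_nat_mult of_nat_add of_nat_numeral of_nat_1 field_simps)
    qed
    show ?thesis
    proof (rule ccontr)
      assume "\<not> ?thesis"
      then have big: "real l > 4 * \<delta> + 1" using l by simp
      have b: "d m (g [^] i) \<le> real (r K) - l / 2 + 1 / 2 + 2 * \<delta>" if i: "i \<le> K" for i
      proof -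
        have "d m (g [^] i) + d c c' \<le> max (d m c + d (g [^] i) c') (d m c' + d c (g [^] i)) + 2 * \<delta>"
          using four_point[of m c "g [^] i" c'] m(1) c c' g by simp
        moreover have "d (g [^] i) c' \<le> r K" using c'(2)[OF i] c' g by (simp add: d_commute)
        moreover have "d c (g [^] i) \<le> r K" using c(2)[of i] i K by simp
        ultimately show ?thesis using mid m(1) c(1) l by (simp add: d_commute[of m c])
      qed
      then have b': "d m (g [^] i) < r K" if "i \<le> K" for i using b[OF that] big by linarith
      have "real (r K) > 0" using b'[of 0] d_nonneg[of m "g [^] (0::nat)"] by linarith
      then have pos: "r K > 0" by simp
      have "R K (r K - 1)" unfolding R_def
      proof (intro bexI[of _ m] allI impI)
        fix i assume "i \<le> K"
        from b'[OF this] show "d m (g [^] i) \<le> real (r K - 1)" using pos by (simp add: d_def)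
      qed (rule m)
      from rmin[OF this] pos show False by linarith
    qed
  qed
  \<comment> \<open>For \<open>i \<le> K\<close> and \<open>j \<le> N\<close> the point
    \<open>g [^] (j + i)\<close> is still in the long segment, so each translate of \<open>c\<close>
    by \<open>inv (g [^] j)\<close> is again a centre of the short one.\<close>
  define f where "f = (\<lambda>j::nat. inv c \<otimes> (inv (g [^] j) \<otimes> c))"
  have fB: "f j \<in> B" if j: "j \<le> N" for j
  proof -
    have "d c (inv (g [^] j) \<otimes> c) \<le> 4 * \<delta> + 1"
    proof (rule close)
      fix i assume i: "i \<le> K"
      have "d (inv (g [^] j) \<otimes> c) (g [^] i) = d c (g [^] (j + i))"
        using d_translate[of "g [^] j" "inv (g [^] j) \<otimes> c" "g [^] i"] g c
        by (simp add: inv_cancel_left nat_pow_mult)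
      then show "d (inv (g [^] j) \<otimes> c) (g [^] i) \<le> r K" using c(2)[of "j + i"] i j K by simp
    qed (use c g in auto)
    then have "len (f j) \<le> nat \<lfloor>4 * \<delta> + 1\<rfloor>" unfolding d_def f_def by (rule le_nat_floor)
    then show "f j \<in> B" using c g by (simp add: B_def f_def)
  qed
  obtain i j where ij: "i < j" "f i = f j"
    by (rule finite_collision[OF finB fB]) (auto simp: N_def)
  then have "inv (inv (g [^] i)) = inv (inv (g [^] j))" using c g by (simp add: f_def)
  then have "g [^] i = g [^] j" using g by simp
  moreover have "g [^] j = g [^] i \<otimes> g [^] (j - i)" using ij(1) g by (simp add: nat_pow_mult)
  ultimately have "g [^] i = g [^] i \<otimes> g [^] (j - i)" by simp
  then have "g [^] (j - i) = \<one>" using g by (simp add: r_cancel_one)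
  with ij(1) show ?thesis by (intro exI[of _ "j - i"]) auto
qed

text \<open>\<open>\<tau>\<close> is the stable translation length of \<open>a\<close>. Both bounds
  have the same slope, so the error is purely additive and enters Gromov products as a constant,
  unlike for a general quasi-geodesic.\<close>

definition rough_axis :: "'a \<Rightarrow> real \<Rightarrow> real \<Rightarrow> bool" where
  "rough_axis a \<tau> C \<longleftrightarrow> a \<in> carrier G \<and> \<tau> > 0 \<and> C \<ge> 0 \<and>
     (\<forall>i j::int. \<tau> * real_of_int \<bar>j - i\<bar> \<le> d (a [^] i) (a [^] j) \<and>
        d (a [^] i) (a [^] j) \<le> \<tau> * real_of_int \<bar>j - i\<bar> + C)"

lemma rough_axisD:
  assumes "rough_axis a \<tau> C"
  shows "a \<in> carrier G" "\<tau> > 0" "C \<ge> 0"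
    "\<tau> * real_of_int \<bar>i - j\<bar> \<le> d (a [^] (i::int)) (a [^] (j::int))"
    "d (a [^] i) (a [^] j) \<le> \<tau> * real_of_int \<bar>i - j\<bar> + C"
  using assms unfolding rough_axis_def by (auto simp: abs_minus_commute[of i])

lemma len_nat_pow_diff:
  assumes "a \<in> carrier G"
  shows "d (a [^] (i::int)) (a [^] (j::int)) = len (a [^] nat \<bar>j - i\<bar>)"
proof -
  have "d (a [^] i) (a [^] j) = len (a [^] (j - i))" for i j :: int
    using assms by (simp add: d_def add.commute[of j] flip: int_pow_neg int_pow_mult)
  then show ?thesis
    using assms d_commute[of "a [^] i" "a [^] j"]
    by (cases "i \<le> j") (simp_all add: pow_nat)
qed

text \<open>Torsion-freeness excludes sublinear growth of the powers of \<open>a\<close>, and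
  \<open>almost_linear\<close> sharpens linear growth to a bounded deviation from one slope.\<close>

lemma ex_rough_axis:
  assumes tf: "torsion_free G" and a: "a \<in> carrier G" "a \<noteq> \<one>"
  shows "\<exists>\<tau> C. rough_axis a \<tau> C"
proof -
  define l where "l = (\<lambda>n::nat. real (len (a [^] n)))"
  have sub: "l (m + n) \<le> l m + l n" for m n
    using len_mult[of "a [^] m" "a [^] n"] a by (simp add: l_def nat_pow_mult)
  have "\<not> (\<forall>\<epsilon>>0::real. \<exists>C. \<forall>n. l n \<le> \<epsilon> * real n + C)"
    using sublinear_imp_torsion[OF a(1)] tf a unfolding torsion_free_def l_def
    by (metis less_eq_Suc_le One_nat_def)
  then obtain \<epsilon> :: real where eps: "\<epsilon> > 0" "\<And>C. \<exists>n. \<not> l n \<le> \<epsilon> * real n + C" by blast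
  \<comment> \<open>By \<open>subadditive_slope\<close> a single violation would bound the whole
    sequence with slope \<open>\<epsilon>\<close>, against the choice of
    \<open>\<epsilon>\<close>.\<close>
  have low: "\<epsilon> * n \<le> l n" for n
  proof (rule ccontr)
    assume neg: "\<not> ?thesis"
    then have n: "n \<ge> 1" by (cases "n = 0") (auto simp: l_def)
    have "\<epsilon> \<ge> 0" "l n \<le> \<epsilon> * real n" using neg eps(1) by linarith+
    from subadditive_slope[OF sub n this] obtain C where "\<And>n. l n \<le> \<epsilon> * real n + C" by blast
    with eps(2)[of C] show False by blast
  qed
  have hyp: "2 * l (n + m) \<le> max (2 * l n) (l (2 * n + m) + l m) + 2 * \<delta>" for m n
  proof -
    have dl: "d (a [^] i) (a [^] j) = l (j - i)" if "i \<le> j" for i j :: nat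
      using len_nat_pow_diff[OF a(1), of "int i" "int j"] that by (simp add: int_pow_int l_def nat_diff_distrib')
    have "d (a [^] (0::nat)) (a [^] (n + m)) + d (a [^] n) (a [^] (2 * n + m))
      \<le> max (d (a [^] (0::nat)) (a [^] n) + d (a [^] (n + m)) (a [^] (2 * n + m)))
          (d (a [^] (0::nat)) (a [^] (2 * n + m)) + d (a [^] n) (a [^] (n + m))) + 2 * \<delta>"
      by (rule four_point) (use a in auto)
    then show ?thesis
      using dl[of 0 n] dl[of 0 "n + m"] dl[of 0 "2 * n + m"] dl[of n "n + m"]
        dl[of n "2 * n + m"] dl[of "n + m" "2 * n + m"] by simp
  qed
  obtain \<tau> C where "\<tau> > 0" "C \<ge> 0" "\<And>n. \<tau> * n \<le> l n \<and> l n \<le> \<tau> * n + C"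
    using almost_linear[OF sub eps(1) low \<delta>_nonneg hyp] by blast
  note lC = this
  have "\<tau> * real_of_int \<bar>j - i\<bar> \<le> d (a [^] i) (a [^] j)"
    "d (a [^] i) (a [^] j) \<le> \<tau> * real_of_int \<bar>j - i\<bar> + C" for i j :: int
    using lC(3)[of "nat \<bar>j - i\<bar>"] unfolding len_nat_pow_diff[OF a(1)] l_def
    by (simp_all only: of_nat_nat abs_ge_zero)
  with lC(1,2) a(1) have "rough_axis a \<tau> C" unfolding rough_axis_def by blast
  then show ?thesis by blast
qed

end

section \<open>Centralizers in torsion-free hyperbolic groups\<close>

locale torsion_free_hyperbolic = hyperbolic_length +
  assumes torsion_free: "torsion_free G"
begin

lemma pow_eq_one:
  assumes "x \<in> carrier G" "x [^] (n::nat) = \<one>" "n \<noteq> 0"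
  shows "x = \<one>"
  using torsion_free assms unfolding torsion_free_def by auto

lemma int_pow_eq_one:
  assumes "x \<in> carrier G" "x \<noteq> \<one>" "x [^] (i::int) = \<one>"
  shows "i = 0"
proof (rule ccontr)
  assume "i \<noteq> 0"
  moreover have "x [^] (int (nat \<bar>i\<bar>)) = \<one>"
    using assms int_pow_neg[OF assms(1), of i] by (cases "i \<ge> 0") auto
  ultimately show False using pow_eq_one[OF assms(1), of "nat \<bar>i\<bar>"] assms(2)
    by (metis int_pow_int nat_0_iff not_le zero_less_abs_iff)
qed

lemma int_pow_inj:
  assumes "x \<in> carrier G" "x \<noteq> \<one>" "x [^] (i::int) = x [^] j"
  shows "i = j"
  using int_pow_eq_one[of x "i - j"] assms by (simp add: int_pow_diff)

text \<open>As \<open>h\<close> commutes with \<open>a\<close>, it moves every power of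
  \<open>a\<close> by exactly \<open>len h\<close>. Far out on both sides the translated axis, which
  passes through \<open>h\<close>, is therefore hard to tell from the axis itself, and
  \<open>h\<close> has to be near the axis with a bound independent of \<open>len h\<close>.\<close>

lemma centralizer_cobounded:
  assumes ax: "rough_axis a \<tau> C"
  shows "\<exists>D. \<forall>h\<in>cent a. \<exists>i::int. d h (a [^] i) \<le> D"
proof (intro exI[of _ "2 * \<delta> + 2 * (C + 2 * \<delta>) + C + \<tau>"] ballI)
  have a: "a \<in> carrier G" and \<tau>: "\<tau> > 0" and C: "C \<ge> 0"
    and low: "\<tau> * real_of_int \<bar>i - j\<bar> \<le> d (a [^] i) (a [^] j)"
    and up: "d (a [^] i) (a [^] j) \<le> \<tau> * real_of_int \<bar>i - j\<bar> + C" for i j :: int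
    using rough_axisD[OF ax] by blast+
  fix h assume hc: "h \<in> cent a"
  then have h: "h \<in> carrier G" by (rule cent_carrier)
  have comm: "h \<otimes> a [^] i = a [^] i \<otimes> h" for i :: int
    using cent_pow[OF a hc, of i] by (simp add: cent_def)
  define L where "L = real (len h)"
  obtain n :: nat where n: "\<tau> * n > L + 2 * C + 2 * \<delta>"
    using reals_Archimedean3[OF \<tau>] by (auto simp: mult.commute)
  define p q where "p = a [^] (- int n)" and "q = a [^] (int n)"
  have pq: "p \<in> carrier G" "q \<in> carrier G" using a by (auto simp: p_def q_def)
  have dpq: "\<tau> * (2 * n) \<le> d p q" "d p q \<le> \<tau> * (2 * n) + C"
    using low[of "- int n" "int n"] up[of "- int n" "int n"] by (auto simp: p_def q_def)
  have d1: "d \<one> p \<le> \<tau> * n + C" "d \<one> q \<le> \<tau> * n + C" "\<tau> * n \<le> d \<one> p" "\<tau> * n \<le> d \<one> q"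
    using low[of 0 "- int n"] up[of 0 "- int n"] low[of 0 "int n"] up[of 0 "int n"]
    by (auto simp: p_def q_def)
  have dh: "d h (h \<otimes> p) = d \<one> p" "d h (h \<otimes> q) = d \<one> q" "d (h \<otimes> p) (h \<otimes> q) = d p q"
    using d_translate[OF h one_closed pq(1)] d_translate[OF h one_closed pq(2)] h pq by simp_all
  have move: "d (h \<otimes> p) p = L" "d q (h \<otimes> q) = L"
  proof -
    have "d (h \<otimes> p) p = d (p \<otimes> h) (p \<otimes> \<one>)" using comm[of "- int n"] pq by (simp add: p_def)
    also have "\<dots> = L" using h pq unfolding d_translate[OF pq(1) h one_closed] by (simp add: L_def d_commute[of h \<one>])
    finally show "d (h \<otimes> p) p = L" .
    have "d q (h \<otimes> q) = d (q \<otimes> \<one>) (q \<otimes> h)" using comm[of "int n"] pq by (simp add: q_def)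
    also have "\<dots> = L" using h pq unfolding d_translate[OF pq(2) one_closed h] by (simp add: L_def)
    finally show "d q (h \<otimes> q) = L" .
  qed
  have g1: "gp h (h \<otimes> p) (h \<otimes> q) \<le> C"
    using dpq d1 dh by (simp add: gp_def)
  have dhp: "d h p \<ge> \<tau> * n - L" "d h q \<ge> \<tau> * n - L" "d h p \<le> \<tau> * n + C + L"
    using d_triangle[of "h" "p" "h \<otimes> p"] d_triangle[of h q "h \<otimes> q"] d_triangle[of h "h \<otimes> p" p]
      dh d1 move h pq by (simp_all add: d_commute[of "h \<otimes> p" p])
  have g2: "gp h (h \<otimes> p) p \<ge> \<tau> * n - L" "gp h q (h \<otimes> q) \<ge> \<tau> * n - L"
    using dhp dh d1 move by (simp_all add: gp_def)
  define K where "K = C + 2 * \<delta>"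
  \<comment> \<open>The product of \<open>h \<otimes> p\<close> and \<open>h \<otimes> q\<close> is
    at most \<open>C\<close>; the large products in \<open>g2\<close> allow
    \<open>h \<otimes> q\<close> and then \<open>h \<otimes> p\<close> to be replaced by
    \<open>q\<close> and \<open>p\<close>, at a cost of \<open>\<delta>\<close> each.\<close>
  have g3: "gp h p q \<le> K"
    using gp_min[of h "h \<otimes> p" p q] gp_min[of h "h \<otimes> p" q "h \<otimes> q"] h pq g1 g2 n C \<delta>_nonneg
    by (auto simp: K_def)
  \<comment> \<open>Selects the point of the axis whose distance from \<open>p\<close> matches that
    of \<open>h\<close>.\<close>
  define m where "m = nat \<lfloor>d h p / \<tau>\<rfloor>"
  have m: "\<tau> * m \<le> d h p" "d h p \<le> \<tau> * m + \<tau>"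
  proof -
    have "real m = real_of_int \<lfloor>d h p / \<tau>\<rfloor>" unfolding m_def using \<tau> by simp
    then have "real m \<le> d h p / \<tau>" "d h p / \<tau> \<le> real m + 1" by linarith+
    then show "\<tau> * m \<le> d h p" "d h p \<le> \<tau> * m + \<tau>" using \<tau> by (simp_all add: field_simps)
  qed
  have m2n: "m \<le> 2 * n"
  proof (rule ccontr)
    assume "\<not> ?thesis"
    then have "\<tau> * (2 * n) \<le> \<tau> * m" using \<tau> by (intro mult_left_mono) auto
    then show False using m dhp(3) n C \<delta>_nonneg by simp
  qed
  define y where "y = a [^] (int m - int n)"
  have y: "y \<in> carrier G" using a by (simp add: y_def)
  have dy: "d p y \<le> \<tau> * m + C" "d y q \<le> \<tau> * (2 * real n - m) + C"
    using up[of "- int n" "int m - int n"] up[of "int m - int n" "int n"] m2n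
    by (auto simp: p_def q_def y_def)
  have "d h y + d p q \<le> max (d h p + d y q) (d h q + d p y) + 2 * \<delta>"
    using four_point[of h p y q] h pq y by simp
  moreover have "d h p + d y q \<le> d p q + \<tau> + C"
    using m dy dpq by (simp add: algebra_simps)
  moreover have "d h q + d p y \<le> d p q + 2 * K + C"
    using g3 dy m by (simp add: gp_def)
  ultimately have "d h y \<le> 2 * \<delta> + 2 * K + C + \<tau>"
    using C \<tau> \<delta>_nonneg by (auto simp: K_def)
  then show "\<exists>i::int. d h (a [^] i) \<le> 2 * \<delta> + 2 * (C + 2 * \<delta>) + C + \<tau>" unfolding y_def K_def by blast
qed

lemma centralizer_finite_index:
  assumes a: "a \<in> carrier G" "a \<noteq> \<one>"
  obtains F where "finite F" "F \<subseteq> cent a" "\<And>h. h \<in> cent a \<Longrightarrow> \<exists>i::int. h \<otimes> a [^] i \<in> F"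
proof -
  obtain \<tau> C where "rough_axis a \<tau> C" using ex_rough_axis[OF torsion_free a] by blast
  then obtain D where D: "\<And>h. h \<in> cent a \<Longrightarrow> \<exists>i::int. d h (a [^] i) \<le> D"
    using centralizer_cobounded by meson
  define F where "F = {x \<in> carrier G. len x \<le> nat \<lfloor>D\<rfloor>} \<inter> cent a"
  show ?thesis
  proof (rule that[of F])
    show "finite F" unfolding F_def using finite_ball by blast
  next
    fix h assume hc: "h \<in> cent a"
    then have h: "h \<in> carrier G" by (rule cent_carrier)
    obtain i :: int where i: "d h (a [^] i) \<le> D" using D[OF hc] by blast
    have ai: "a [^] i \<in> carrier G" using a by simp
    have "d h (a [^] i) = d (a [^] i) h" using h ai by (rule d_commute)
    also have "inv (a [^] i) \<otimes> h = h \<otimes> a [^] (- i)"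
      using cent_pow[OF a(1) hc, of "- i"] a(1) by (simp add: cent_def int_pow_neg)
    then have "d (a [^] i) h = len (h \<otimes> a [^] (- i))" by (simp add: d_def)
    finally have "len (h \<otimes> a [^] (- i)) \<le> nat \<lfloor>D\<rfloor>" using i by (intro le_nat_floor) simp
    moreover have "h \<otimes> a [^] (- i) \<in> cent a"
      using subgroup.m_closed[OF subgroup_cent[OF a(1)] hc] pow_in_cent[OF a(1) cent_self[OF a(1)]] by blast
    ultimately show "\<exists>i::int. h \<otimes> a [^] i \<in> F" unfolding F_def using cent_carrier by blast
  qed (simp add: F_def)
qed

lemma cent_power_in_powers:
  assumes a: "a \<in> carrier G" "a \<noteq> \<one>" and h: "h \<in> cent a"
  obtains p :: nat and q :: int where "p \<noteq> 0" "h [^] p = a [^] q"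
proof -
  obtain F where F: "finite F" "F \<subseteq> cent a" "\<And>h. h \<in> cent a \<Longrightarrow> \<exists>i::int. h \<otimes> a [^] i \<in> F"
    using centralizer_finite_index[OF a] by blast
  have hc: "h \<in> carrier G" using h by (rule cent_carrier)
  have hi: "h [^] i \<in> cent a" for i :: nat using pow_in_cent[OF a(1) h, of "int i"] by (simp add: int_pow_int)
  obtain e :: "nat \<Rightarrow> int" where e: "\<And>i. h [^] i \<otimes> a [^] e i \<in> F" using F(3)[OF hi] by metis
  have "finite (range (\<lambda>i. h [^] i \<otimes> a [^] e i))"
    by (rule finite_subset[OF _ F(1)]) (use e in auto)
  then obtain i j where eq: "h [^] i \<otimes> a [^] e i = h [^] j \<otimes> a [^] e j" and "i < j"
    by (rule finite_range_imp_collision)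
  have "h [^] j = h [^] i \<otimes> h [^] (j - i)" using \<open>i < j\<close> hc by (simp add: nat_pow_mult)
  then have "a [^] e i = h [^] (j - i) \<otimes> a [^] e j" using eq hc a by (simp add: m_assoc)
  then have "h [^] (j - i) = a [^] (e i - e j)"
    using hc a by (simp add: int_pow_diff inv_solve_right)
  then show ?thesis using that[of "j - i"] \<open>i < j\<close> by simp
qed

text \<open>Both roots centralize their common power \<open>z\<close>, and the transfer on the
  centralizer of \<open>z\<close> takes the same value on them. An element on which the transfer
  vanishes is torsion, because one of its powers is a power of \<open>z\<close>; so the quotient of
  the two roots is trivial.\<close>

lemma unique_roots:
  assumes x: "x \<in> carrier G" and y: "y \<in> carrier G" and eq: "x [^] (m::nat) = y [^] m" and m: "m \<noteq> 0"
  shows "x = y"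
proof (cases "x [^] m = \<one>")
  case True
  then show ?thesis using pow_eq_one[OF x _ m] pow_eq_one[OF y _ m] eq by simp
next
  case False
  define z where "z = x [^] m"
  have z: "z \<in> carrier G" "z \<noteq> \<one>" using x False by (auto simp: z_def)
  have "g \<otimes> g [^] m = g [^] m \<otimes> g" if "g \<in> carrier G" for g
    using nat_pow_Suc2[OF that, of m] by simp
  from this[OF x] this[OF y] have "x \<in> cent z" "y \<in> cent z"
    using x y by (simp_all add: z_def cent_def eq)
  define A where "A = cent z"
  have A: "subgroup A G" unfolding A_def using z(1) by (rule subgroup_cent)
  interpret A: subgroup A G by (rule A)
  have xA: "x \<in> A" and yA: "y \<in> A" using \<open>x \<in> cent z\<close> \<open>y \<in> cent z\<close> by (auto simp: A_def)
  obtain F where F: "finite F" "F \<subseteq> A" "\<And>h. h \<in> A \<Longrightarrow> \<exists>i::int. h \<otimes> z [^] i \<in> F"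
    using centralizer_finite_index[OF z] unfolding A_def by blast
  have "\<exists>T::'a \<Rightarrow> int. \<exists>k\<noteq>0. (\<forall>g\<in>A. \<forall>h\<in>A. T (g \<otimes> h) = T g + T h) \<and> (\<forall>i::int. T (z [^] i) = k * i)"
    by (rule transfer_hom[OF A _ _ _ F]) (use z cent_self int_pow_eq_one in \<open>auto simp: A_def\<close>)
  then obtain T :: "'a \<Rightarrow> int" and k where k: "k \<noteq> 0"
    and T: "\<And>g h. g \<in> A \<Longrightarrow> h \<in> A \<Longrightarrow> T (g \<otimes> h) = T g + T h" and Tz: "\<And>i::int. T (z [^] i) = k * i"
    by blast
  have T1: "T \<one> = 0" using Tz[of 0] by simp
  have Tpow: "T (g [^] (n::nat)) = n * T g" if g: "g \<in> A" for g n
  proof (induction n)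
    case (Suc n)
    have "g [^] n \<in> A" using subgroup_int_pow_closed[OF A g, of "int n"] by (simp add: int_pow_int)
    then show ?case using Suc T g by (simp add: algebra_simps)
  qed (simp add: T1)
  have "m * T x = m * T y" unfolding Tpow[OF xA, symmetric] Tpow[OF yA, symmetric] eq ..
  then have Txy: "T x = T y" using m by simp
  define w where "w = x \<otimes> inv y"
  have wA: "w \<in> A" and wc: "w \<in> carrier G" using xA yA by (auto simp: w_def)
  have "x = w \<otimes> y" using x y by (simp add: w_def m_assoc)
  then have "T w = 0" using T[OF wA yA] Txy by simp
  obtain p :: nat and q :: int where pq: "p \<noteq> 0" "w [^] p = z [^] q"
    using cent_power_in_powers[OF z] wA unfolding A_def by blast
  have "k * q = 0" using Tpow[OF wA, of p] Tz[of q] pq \<open>T w = 0\<close> by simp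
  then have "w [^] p = \<one>" using k pq by simp
  then have "w = \<one>" using pow_eq_one[OF wc] pq by simp
  then show ?thesis using x y by (simp add: w_def inv_solve_right')
qed

lemma unique_int_roots:
  assumes x: "x \<in> carrier G" and y: "y \<in> carrier G" and eq: "x [^] (i::int) = y [^] i" and i: "i \<noteq> 0"
  shows "x = y"
proof (rule unique_roots[OF x y])
  have "g [^] nat \<bar>i\<bar> = (if i \<ge> 0 then g [^] i else inv (g [^] i))" if "g \<in> carrier G" for g
    using int_pow_neg[OF that, of i] by (simp flip: int_pow_int)
  from this[OF x] this[OF y] eq show "x [^] nat \<bar>i\<bar> = y [^] nat \<bar>i\<bar>" by simp
qed (use i in simp)

text \<open>The conjugate of \<open>a\<close> by \<open>x\<close> is a second \<open>i\<close>-th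
  root of \<open>a [^] i\<close>.\<close>

lemma cent_of_pow:
  assumes a: "a \<in> carrier G" and x: "x \<in> cent (a [^] (i::int))" and i: "i \<noteq> 0"
  shows "x \<in> cent a"
proof -
  have xc: "x \<in> carrier G" using x by (rule cent_carrier)
  have "(x \<otimes> a \<otimes> inv x) [^] i = a [^] i"
    using int_pow_conj[OF xc a, of i] x a xc by (simp add: cent_iff)
  then have "x \<otimes> a \<otimes> inv x = a" using unique_int_roots[of "x \<otimes> a \<otimes> inv x" a i] xc a i by simp
  then show ?thesis using xc a by (simp add: cent_iff)
qed

lemma cent_abelian:
  assumes a: "a \<in> carrier G" "a \<noteq> \<one>" and x: "x \<in> cent a" and y: "y \<in> cent a"
  shows "x \<otimes> y = y \<otimes> x"
proof -
  obtain p :: nat and q :: int where pq: "p \<noteq> 0" "x [^] p = a [^] q"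
    using cent_power_in_powers[OF a x] by blast
  have "y \<in> cent (x [^] (int p))" using cent_pow[OF a(1) y, of q] pq by (simp add: int_pow_int)
  then have "y \<in> cent x" using cent_of_pow cent_carrier[OF x] pq by simp
  then show ?thesis by (simp add: cent_def)
qed

text \<open>Conjugation by \<open>x\<close> changes lengths by at most \<open>2 * len x\<close>, so
  it preserves the growth rate of powers, which is \<open>\<tau> * \<bar>i\<bar>\<close> for
  \<open>a [^] i\<close>.\<close>

lemma conj_power_le:
  assumes a: "a \<in> carrier G" "a \<noteq> \<one>" and x: "x \<in> carrier G"
    and eq: "x \<otimes> a [^] (i::int) \<otimes> inv x = a [^] (j::int)"
  shows "\<bar>j\<bar> \<le> \<bar>i\<bar>"
proof (rule ccontr)
  assume neg: "\<not> ?thesis"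
  obtain \<tau> C where ax: "rough_axis a \<tau> C" using ex_rough_axis[OF torsion_free a] by blast
  have \<tau>: "\<tau> > 0"
    and low: "\<tau> * real_of_int \<bar>i\<bar> \<le> len (a [^] i)" and up: "len (a [^] i) \<le> \<tau> * real_of_int \<bar>i\<bar> + C" for i :: int
  proof -
    show "\<tau> > 0" using ax by (simp add: rough_axis_def)
    note rough_axisD(4,5)[OF ax, of 0 i]
    then show "\<tau> * real_of_int \<bar>i\<bar> \<le> len (a [^] i)" "len (a [^] i) \<le> \<tau> * real_of_int \<bar>i\<bar> + C"
      using a by simp_all
  qed
  obtain k :: nat where k: "\<tau> * k > 2 * real (len x) + C"
    using reals_Archimedean3[OF \<tau>] by (auto simp: mult.commute)
  have "a [^] (j * k) = x \<otimes> a [^] (i * k) \<otimes> inv x"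
    using arg_cong[OF eq, of "\<lambda>y. y [^] int k"] a x by (simp add: int_pow_conj int_pow_pow)
  then have "len (a [^] (j * k)) \<le> len x + len (a [^] (i * k)) + len x"
    using len_mult[of "x \<otimes> a [^] (i * k)" "inv x"] len_mult[of x "a [^] (i * k)"] a x by simp
  then have "real (len (a [^] (j * k))) \<le> 2 * real (len x) + len (a [^] (i * k))" by linarith
  then have "\<tau> * real_of_int \<bar>j * k\<bar> \<le> 2 * real (len x) + \<tau> * real_of_int \<bar>i * k\<bar> + C"
    using low[of "j * k"] up[of "i * k"] by linarith
  moreover have "\<tau> * real_of_int \<bar>i * k\<bar> + \<tau> * k \<le> \<tau> * real_of_int \<bar>j * k\<bar>"
  proof -
    have "\<bar>i\<bar> + 1 \<le> \<bar>j\<bar>" using neg by simp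
    then have "(\<bar>i\<bar> + 1) * int k \<le> \<bar>j\<bar> * int k" by (rule mult_right_mono) simp
    then have "\<bar>i * k\<bar> + int k \<le> \<bar>j * k\<bar>" by (simp add: abs_mult algebra_simps)
    then have "real_of_int \<bar>i * k\<bar> + real k \<le> real_of_int \<bar>j * k\<bar>" by linarith
    then have "\<tau> * (real_of_int \<bar>i * k\<bar> + real k) \<le> \<tau> * real_of_int \<bar>j * k\<bar>"
      using \<tau> by (intro mult_left_mono) auto
    then show ?thesis by (simp add: algebra_simps)
  qed
  ultimately show False using k by linarith
qed

text \<open>Comparing growth rates leaves \<open>j = i\<close>, where uniqueness of roots applies,
  and \<open>j = - i\<close>, where \<open>x\<close> turns out to be torsion.\<close>

lemma conj_power_imp_cent:
  assumes a: "a \<in> carrier G" "a \<noteq> \<one>" and x: "x \<in> carrier G"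
    and eq: "x \<otimes> a [^] (i::int) \<otimes> inv x = a [^] (j::int)" and i: "i \<noteq> 0"
  shows "x \<in> cent a"
proof -
  have eq': "inv x \<otimes> a [^] j \<otimes> inv (inv x) = a [^] i"
    unfolding eq[symmetric] using a x by (simp add: group_normalize)
  have "\<bar>i\<bar> = \<bar>j\<bar>"
    using conj_power_le[OF a x eq] conj_power_le[OF a _ eq'] x by simp
  then consider "j = i" | "j = - i" by linarith
  then show ?thesis
  proof cases
    case 1
    then have "x \<in> cent (a [^] i)" using eq x a by (simp add: cent_iff)
    then show ?thesis using cent_of_pow a i by blast
  next
    case 2
    text \<open>If \<open>x\<close> inverts \<open>a\<^sup>i\<close>, then \<open>x\<^sup>2\<close> centralizes \<open>a\<close>, so a power of \<open>x\<close> is a power of \<open>a\<close> that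
      \<open>x\<close> both centralizes and inverts.\<close>
    have inv_i: "x \<otimes> a [^] (i * k) \<otimes> inv x = a [^] (- (i * k))" for k :: int
      using arg_cong[OF eq, of "\<lambda>y. y [^] k"] a x 2 by (simp add: int_pow_conj int_pow_pow)
    have "x \<otimes> x \<otimes> a [^] i \<otimes> inv (x \<otimes> x) = x \<otimes> (x \<otimes> a [^] i \<otimes> inv x) \<otimes> inv x"
      using a x by (simp add: group_normalize)
    also have "\<dots> = x \<otimes> a [^] (i * (- 1)) \<otimes> inv x" unfolding eq 2 by simp
    also have "\<dots> = a [^] i" unfolding inv_i by simp
    finally have "x \<otimes> x \<in> cent (a [^] i)" using a x by (simp add: cent_iff)
    then have "x \<otimes> x \<in> cent a" using cent_of_pow a i by blast
    then obtain p :: nat and q :: int where pq: "p \<noteq> 0" "(x \<otimes> x) [^] p = a [^] q"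
      using cent_power_in_powers[OF a] by blast
    have x2: "(x \<otimes> x) [^] p = x [^] (2 * p)"
      using nat_pow_pow[OF x, of 2 p] x by (simp add: numeral_2_eq_2)
    have "x \<in> cent (x [^] (int (2 * p)))" using x by (intro cent_pow cent_self)
    then have "x \<in> cent (a [^] q)" using pq x2 by (simp only: int_pow_int)
    then have "x \<in> cent (a [^] (i * q))"
      using cent_pow[of "a [^] q" x i] a by (simp add: int_pow_pow mult.commute)
    then have "a [^] (i * q) = a [^] (- (i * q))" using inv_i[of q] a x by (simp add: cent_iff)
    then have "i * q = - (i * q)" by (rule int_pow_inj[OF a])
    then have "q = 0" using i by simp
    then have "x [^] (2 * p) = \<one>" using pq x2 by simp
    then have "x = \<one>" using pow_eq_one[OF x] pq by simp
    then show ?thesis using a by (simp add: cent_def)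
  qed
qed

text \<open>Suitable powers of \<open>x\<close> and of its conjugate are powers of \<open>a\<close>,
  so passing to a common exponent reduces the claim to \<open>conj_power_imp_cent\<close>.\<close>

lemma cent_malnormal:
  assumes a: "a \<in> carrier G" "a \<noteq> \<one>" and c: "c \<in> carrier G"
    and x: "x \<in> cent a" "x \<noteq> \<one>" and y: "c \<otimes> x \<otimes> inv c \<in> cent a"
  shows "c \<in> cent a"
proof -
  define y where "y = c \<otimes> x \<otimes> inv c"
  have xc: "x \<in> carrier G" using x cent_carrier by blast
  obtain p :: nat and q :: int where pq: "p \<noteq> 0" "x [^] p = a [^] q"
    using cent_power_in_powers[OF a x(1)] by blast
  obtain r :: nat and s :: int where rs: "r \<noteq> 0" "y [^] r = a [^] s"
    using cent_power_in_powers[OF a y] unfolding y_def by blast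
  have "q \<noteq> 0" using pq pow_eq_one[OF xc, of p] x(2) by auto
  have "a [^] (s * p) = (y [^] r) [^] p" unfolding rs using a by (simp add: int_pow_pow flip: int_pow_int)
  also have "\<dots> = c \<otimes> (x [^] p) [^] r \<otimes> inv c"
    unfolding y_def using c xc by (simp add: nat_pow_conj nat_pow_pow mult.commute)
  also have "(x [^] p) [^] r = a [^] (q * r)" unfolding pq using a by (simp add: int_pow_pow flip: int_pow_int)
  finally have "c \<otimes> a [^] (q * r) \<otimes> inv c = a [^] (s * p)" by simp
  then show ?thesis by (rule conj_power_imp_cent[OF a c]) (use \<open>q \<noteq> 0\<close> rs in simp)
qed

end

section \<open>Axes\<close>

context hyperbolic_length
begin

lemma gp_le: "\<lbrakk>w \<in> carrier G; x \<in> carrier G; y \<in> carrier G\<rbrakk> \<Longrightarrow> gp w x y \<le> d w x"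
  "\<lbrakk>w \<in> carrier G; x \<in> carrier G; y \<in> carrier G\<rbrakk> \<Longrightarrow> gp w x y \<le> d w y"
  using d_triangle[of w x y] d_triangle[of w y x] by (simp_all add: gp_def d_commute[of y x])

lemma gp_nonneg: "\<lbrakk>w \<in> carrier G; x \<in> carrier G; y \<in> carrier G\<rbrakk> \<Longrightarrow> gp w x y \<ge> 0"
  using d_triangle[of x w y] by (simp add: gp_def d_commute[of x w])

lemma gp_lower:
  assumes "w \<in> carrier G" "x \<in> carrier G" "y \<in> carrier G" "z \<in> carrier G"
    and "s \<le> gp w x y" "s \<le> gp w y z"
  shows "s - \<delta> \<le> gp w x z"
  using gp_min[OF assms(1-4)] assms(5,6) by linarith

text \<open>A condition on \<open>x \<otimes> x\<close> alone propagates to all powers: in the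
  four-point inequality for \<open>\<one>\<close>, \<open>x\<close>, \<open>x [^] 2\<close> and
  \<open>x [^] (i + 2)\<close>, the first term of the maximum would contradict the increase already
  known from \<open>i\<close> to \<open>i + 1\<close>.\<close>

lemma linear_growth:
  fixes \<eta> :: real
  assumes x: "x \<in> carrier G" and \<eta>: "\<eta> > 0" and two: "len (x \<otimes> x) \<ge> len x + 2 * \<delta> + \<eta>"
  shows "len (x [^] (i::nat)) \<ge> \<eta> * i"
proof -
  define l where "l = (\<lambda>i::nat. real (len (x [^] i)))"
  have dl: "d (x [^] i) (x [^] j) = l (j - i)" if "i \<le> j" for i j
    using x that by (simp add: d_def l_def nat_pow_diff)
  have l1: "l 1 = len x" and l2: "l 2 = len (x \<otimes> x)" using x by (simp_all add: l_def numeral_2_eq_2)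
  have "l 1 \<ge> \<eta>" using len_mult[OF x x] two \<delta>_nonneg unfolding l1 by linarith
  have step: "l i + \<eta> \<le> l (Suc i)" for i
  proof (induction i)
    case 0 show ?case using \<open>l 1 \<ge> \<eta>\<close> by (simp add: l_def)
  next
    case (Suc i)
    have "d (x [^] (0::nat)) (x [^] (2::nat)) + d (x [^] (1::nat)) (x [^] (i + 2))
      \<le> max (d (x [^] (0::nat)) (x [^] (1::nat)) + d (x [^] (2::nat)) (x [^] (i + 2)))
          (d (x [^] (0::nat)) (x [^] (i + 2)) + d (x [^] (1::nat)) (x [^] (2::nat))) + 2 * \<delta>"
      by (rule four_point) (use x in auto)
    then have "l 2 + l (Suc i) \<le> max (l 1 + l i) (l (i + 2) + l 1) + 2 * \<delta>"
      using dl[of 0 2] dl[of 1 "i + 2"] dl[of 0 1] dl[of 2 "i + 2"] dl[of 0 "i + 2"] dl[of 1 2] by simp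
    then show ?case using Suc two \<eta> unfolding l2[symmetric] l1[symmetric] by (auto simp: max_def split: if_splits)
  qed
  have "\<eta> * i \<le> l i"
  proof (induction i)
    case (Suc i)
    then show ?case using step[of i] by (simp add: algebra_simps)
  qed (simp add: l_def)
  then show ?thesis by (simp add: l_def)
qed

text \<open>If \<open>p\<close> is a point of the rough geodesic \<open>Q\<close> nearest to \<open>y\<close>, then \<open>y\<close> and the far end of
  \<open>Q\<close> diverge at \<open>p\<close>: otherwise moving along \<open>Q\<close> would approach \<open>y\<close>.\<close>

lemma nearest_point_gp:
  fixes \<tau> K :: real and n :: nat
  assumes p: "p \<in> carrier G" "p' \<in> carrier G" "y \<in> carrier G" and \<tau>: "\<tau> > 0"
    and Q: "\<And>m. m \<le> n \<Longrightarrow> Q m \<in> carrier G"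
      "\<And>m. m \<le> n \<Longrightarrow> \<bar>d p (Q m) - \<tau> * m\<bar> \<le> K"
      "\<And>m. m \<le> n \<Longrightarrow> \<bar>d (Q m) p' - \<tau> * (real n - m)\<bar> \<le> K"
    and pp: "\<bar>d p p' - \<tau> * n\<bar> \<le> K"
    and near: "\<And>m. m \<le> n \<Longrightarrow> d y p \<le> d y (Q m)"
    and large: "\<tau> * n > 4 * K + 2 * \<delta>"
  shows "gp p y p' \<le> 4 * K + 2 * \<delta> + \<tau>"
proof -
  define s where "s = gp p y p'"
  have s0: "s \<ge> 0" unfolding s_def using p by (intro gp_nonneg)
  \<comment> \<open>The point of \<open>Q\<close> at distance about \<open>s\<close> from
    \<open>p\<close>, or the end of \<open>Q\<close> if \<open>s\<close> is too large;
    \<open>large\<close> will exclude the end.\<close>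
  define m where "m = min n (nat \<lfloor>s / \<tau>\<rfloor>)"
  have fl: "real (nat \<lfloor>s / \<tau>\<rfloor>) \<le> s / \<tau>" "s / \<tau> \<le> real (nat \<lfloor>s / \<tau>\<rfloor>) + 1"
  proof -
    have "real (nat \<lfloor>s / \<tau>\<rfloor>) = real_of_int \<lfloor>s / \<tau>\<rfloor>" using \<tau> s0 by simp
    then show "real (nat \<lfloor>s / \<tau>\<rfloor>) \<le> s / \<tau>" "s / \<tau> \<le> real (nat \<lfloor>s / \<tau>\<rfloor>) + 1" by linarith+
  qed
  have m: "m \<le> n" by (simp add: m_def)
  have ms: "\<tau> * m \<le> s"
  proof -
    have "real m \<le> s / \<tau>" using fl(1) by (simp add: m_def min_def)
    then show ?thesis using \<tau> by (simp add: field_simps)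
  qed
  have K0: "K \<ge> 0" using pp by linarith
  note Qm = Q[OF m]
  have "gp p (Q m) p' \<ge> \<tau> * m - 3 / 2 * K"
    using Qm(2,3) pp unfolding gp_def by (simp add: algebra_simps abs_le_iff)
  then have "gp p y (Q m) \<ge> \<tau> * m - 3 / 2 * K - \<delta>"
    using gp_lower[of p y p' "Q m" "\<tau> * m - 3 / 2 * K"] p Qm(1) ms K0
    by (simp add: s_def gp_commute[of p' "Q m"])
  then have "d p y + d p (Q m) - d y (Q m) \<ge> 2 * (\<tau> * m) - 3 * K - 2 * \<delta>"
    unfolding gp_def by (simp add: algebra_simps)
  then have tm: "\<tau> * m \<le> 4 * K + 2 * \<delta>"
    using near[OF m] Qm(2) p by (simp add: d_commute[of p y] abs_le_iff)
  then have "m \<noteq> n" using large by auto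
  then have "s / \<tau> \<le> real m + 1" using fl(2) by (auto simp: m_def min_def)
  then have "s \<le> \<tau> * m + \<tau>" using \<tau> by (simp add: field_simps)
  then show ?thesis using tm by (simp add: s_def)
qed

end

section \<open>The axis of \<open>a\<close> and the axes of the products
  \<open>a [^] n \<otimes> c\<close>\<close>

locale axis = torsion_free_hyperbolic +
  fixes a :: 'a and \<tau> C :: real
  assumes ax: "rough_axis a \<tau> C" and a1: "a \<noteq> \<one>"
begin

lemma a: "a \<in> carrier G" and \<tau>: "\<tau> > 0" and C: "C \<ge> 0"
  using rough_axisD[OF ax] by auto

lemma dist_pow:
  assumes "i \<le> j"
  shows "\<tau> * (real j - real i) \<le> d (a [^] i) (a [^] j)" "d (a [^] i) (a [^] j) \<le> \<tau> * (real j - real i) + C"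
    "d (a [^] j) (a [^] i) = d (a [^] i) (a [^] j)"
proof -
  have "\<bar>int i - int j\<bar> = int (j - i)" using assms by simp
  then show "\<tau> * (real j - real i) \<le> d (a [^] i) (a [^] j)" "d (a [^] i) (a [^] j) \<le> \<tau> * (real j - real i) + C"
    using rough_axisD(4,5)[OF ax, of "int i" "int j"] assms by (simp_all add: int_pow_int of_nat_diff)
qed (use a d_commute in simp)

lemma len_pow: "\<tau> * real n \<le> len (a [^] n)" "len (a [^] n) \<le> \<tau> * real n + C"
  using dist_pow[of 0 n] a by simp_all

lemma dist_pow_le: "\<lbrakk>i \<le> n; j \<le> n\<rbrakk> \<Longrightarrow> d (a [^] i) (a [^] j) \<le> \<tau> * real n + C"
proof (induction i j rule: linorder_wlog)
  case (le i j)
  have "\<tau> * (real j - real i) \<le> \<tau> * real n" using le \<tau> by (intro mult_left_mono) auto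
  then show ?case using dist_pow[OF le(1)] by linarith
next
  case (sym i j) then show ?case using a by (simp add: d_commute[of "a [^] i"])
qed

text \<open>A large product would make the paths \<open>inv (a [^] k)\<close> and
  \<open>c \<otimes> a [^] k\<close> run side by side for all \<open>k \<le> N\<close>. Then the
  elements \<open>a [^] k \<otimes> c \<otimes> a [^] k\<close> lie in a ball of \<open>N\<close>
  elements, two of them agree, and \<open>c\<close> conjugates a nontrivial power of
  \<open>a\<close> to its inverse.\<close>

lemma corner_bound:
  assumes c: "c \<in> carrier G" "c \<notin> cent a"
  shows "\<exists>K. \<forall>(i::nat) (j::nat). gp \<one> (inv (a [^] i)) (c \<otimes> a [^] j) \<le> K"
proof (intro exI allI)
  define L where "L = real (len c)"
  define D0 where "D0 = 3 * C + 3 * L + 4 * \<delta>"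
  define B where "B = {x \<in> carrier G. len x \<le> nat \<lfloor>D0\<rfloor>}"
  define N where "N = card B"
  fix i j :: nat
  have dc: "d \<one> (c \<otimes> a [^] k) \<le> L + len (a [^] k)" "L + d \<one> (c \<otimes> a [^] k) \<ge> len (a [^] k)" for k :: nat
  proof -
    show "d \<one> (c \<otimes> a [^] k) \<le> L + len (a [^] k)"
      using len_mult[of c "a [^] k"] c a by (simp add: L_def)
    have "len (inv c \<otimes> (c \<otimes> a [^] k)) \<le> len c + len (c \<otimes> a [^] k)"
      using len_mult[of "inv c" "c \<otimes> a [^] k"] c a by simp
    then show "L + d \<one> (c \<otimes> a [^] k) \<ge> len (a [^] k)" using c a by (simp add: L_def inv_cancel_left)
  qed
  have di: "d \<one> (inv (a [^] k)) = len (a [^] k)" for k :: nat using a by simp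
  show "gp \<one> (inv (a [^] i)) (c \<otimes> a [^] j) \<le> \<tau> * N + C + L"
  proof (rule ccontr)
    assume "\<not> ?thesis"
    then have big: "gp \<one> (inv (a [^] i)) (c \<otimes> a [^] j) > \<tau> * N + C + L" by simp
    have L0: "L \<ge> 0" by (simp add: L_def)
    have "\<tau> * N < \<tau> * i"
      using gp_le(1)[of \<one> "inv (a [^] i)" "c \<otimes> a [^] j"] big len_pow(2)[of i] a c di[of i] L0 by simp
    then have Ni: "N < i" using \<tau> by simp
    have "\<tau> * N < \<tau> * j"
      using gp_le(2)[of \<one> "inv (a [^] i)" "c \<otimes> a [^] j"] big len_pow(2)[of j] a c dc(1)[of j] by simp
    then have Nj: "N < j" using \<tau> by simp
    have inB: "a [^] k \<otimes> c \<otimes> a [^] k \<in> B" if k: "k \<le> N" for k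
    proof -
      \<comment> \<open>A common lower bound for three products. Chaining them costs
        \<open>2 * \<delta>\<close>, and the terms in \<open>\<tau> * k\<close> cancel in the
        resulting distance bound \<open>D0\<close>.\<close>
      define s where "s = \<tau> * k - L - C / 2"
      have g1: "gp \<one> (inv (a [^] k)) (inv (a [^] i)) \<ge> s"
      proof -
        have "d (inv (a [^] k)) (inv (a [^] i)) = len (a [^] (i - k))"
        proof -
          have "a [^] i = a [^] (i - k) \<otimes> a [^] k" using a k Ni by (simp add: nat_pow_mult)
          then have "a [^] k \<otimes> inv (a [^] i) = inv (a [^] (i - k))" using a by (simp add: group_normalize)
          then show ?thesis using a by (simp add: d_def)
        qed
        moreover have "len (a [^] (i - k)) \<le> \<tau> * (real i - real k) + C"
          using len_pow(2)[of "i - k"] k Ni by (simp add: of_nat_diff)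
        ultimately show ?thesis
          using len_pow(1)[of k] len_pow(1)[of i] L0 unfolding gp_def di s_def by (simp add: algebra_simps)
      qed
      have g2: "gp \<one> (inv (a [^] i)) (c \<otimes> a [^] j) \<ge> s"
      proof -
        have "\<tau> * k \<le> \<tau> * N" using \<tau> k by simp
        then show ?thesis using big C L0 by (simp add: s_def)
      qed
      have g3: "gp \<one> (c \<otimes> a [^] j) (c \<otimes> a [^] k) \<ge> s"
      proof -
        have "d (c \<otimes> a [^] j) (c \<otimes> a [^] k) \<le> \<tau> * (real j - real k) + C"
          using dist_pow[of k j] k Nj c a by simp
        then show ?thesis
          using dc(2)[of k] dc(2)[of j] len_pow(1)[of k] len_pow(1)[of j]
          unfolding gp_def s_def by (simp add: algebra_simps)
      qed
      have "gp \<one> (inv (a [^] k)) (c \<otimes> a [^] j) \<ge> s - \<delta>"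
        by (rule gp_lower[OF _ _ _ _ g1 g2]) (use a c in auto)
      moreover have "gp \<one> (c \<otimes> a [^] j) (c \<otimes> a [^] k) \<ge> s - \<delta>"
        using g3 \<delta>_nonneg by linarith
      ultimately have "gp \<one> (inv (a [^] k)) (c \<otimes> a [^] k) \<ge> s - \<delta> - \<delta>"
        by (rule gp_lower[rotated 4]) (use a c in auto)
      then have "d (inv (a [^] k)) (c \<otimes> a [^] k) \<le> D0"
        using dc(1)[of k] len_pow(2)[of k] unfolding gp_def di s_def D0_def by (simp add: algebra_simps)
      moreover have "d (inv (a [^] k)) (c \<otimes> a [^] k) = len (a [^] k \<otimes> c \<otimes> a [^] k)"
        using a c by (simp add: d_def m_assoc)
      ultimately have "len (a [^] k \<otimes> c \<otimes> a [^] k) \<le> nat \<lfloor>D0\<rfloor>" by (intro le_nat_floor) simp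
      then show ?thesis using a c by (simp add: B_def)
    qed
    have "finite B" unfolding B_def by (rule finite_ball)
    then obtain k l :: nat where kl: "k < l" "a [^] k \<otimes> c \<otimes> a [^] k = a [^] l \<otimes> c \<otimes> a [^] l"
      by (rule finite_collision[where n = N, OF _ inB]) (auto simp: N_def)
    define r where "r = l - k"
    have "a [^] l = a [^] k \<otimes> a [^] r" "a [^] l = a [^] r \<otimes> a [^] k"
      using kl(1) a by (simp_all add: r_def nat_pow_mult)
    then have "a [^] k \<otimes> (c \<otimes> a [^] k) = a [^] k \<otimes> (a [^] r \<otimes> c \<otimes> a [^] r \<otimes> a [^] k)"
      using kl(2) a c by (metis m_assoc m_closed nat_pow_closed)
    then have "c = a [^] r \<otimes> c \<otimes> a [^] r" using a c by simp
    then have "c \<otimes> inv (a [^] r) \<otimes> inv c = a [^] r \<otimes> c \<otimes> a [^] r \<otimes> inv (a [^] r) \<otimes> inv c" by simp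
    also have "\<dots> = a [^] r" using a c by (simp add: group_normalize)
    finally have "c \<otimes> a [^] (- int r) \<otimes> inv c = a [^] int r" using a by (simp add: int_pow_neg int_pow_int)
    then have "c \<in> cent a" by (rule conj_power_imp_cent[OF a a1 c(1)]) (use kl in \<open>simp add: r_def\<close>)
    with c(2) show False ..
  qed
qed

text \<open>The two arms backtrack only by the bounded product of \<open>corner_bound\<close>, so
  their lengths add up to within a constant.\<close>

lemma corner_length:
  assumes c: "c \<in> carrier G" "c \<notin> cent a"
  obtains K where "K \<ge> 0" "\<And>(i::nat) (j::nat). \<bar>real (len (a [^] i \<otimes> c \<otimes> a [^] j)) - \<tau> * (real i + real j)\<bar> \<le> K"
proof -
  obtain K0 where K0: "\<And>(i::nat) (j::nat). gp \<one> (inv (a [^] i)) (c \<otimes> a [^] j) \<le> K0"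
    using corner_bound[OF c] by blast
  define L where "L = real (len c)"
  have L0: "L \<ge> 0" by (simp add: L_def)
  have K00: "K0 \<ge> 0"
    using K0[of 0 0] gp_nonneg[of \<one> "inv (a [^] (0::nat))" "c \<otimes> a [^] (0::nat)"] a c by simp
  have "\<bar>real (len (a [^] i \<otimes> c \<otimes> a [^] j)) - \<tau> * (real i + real j)\<bar> \<le> 2 * K0 + 2 * C + L" for i j :: nat
  proof -
    have eq: "d (inv (a [^] i)) (c \<otimes> a [^] j) = len (a [^] i \<otimes> c \<otimes> a [^] j)"
      using a c by (simp add: d_def m_assoc)
    have "len (inv c \<otimes> (c \<otimes> a [^] j)) \<le> len c + len (c \<otimes> a [^] j)"
      using len_mult[of "inv c" "c \<otimes> a [^] j"] c a by simp
    then have "len (a [^] j) \<le> L + d \<one> (c \<otimes> a [^] j)" using c a by (simp add: L_def inv_cancel_left)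
    moreover have "d \<one> (inv (a [^] i)) = len (a [^] i)" using a by simp
    ultimately have low: "len (a [^] i \<otimes> c \<otimes> a [^] j) \<ge> \<tau> * i + \<tau> * j - L - 2 * K0"
      using K0[of i j] len_pow(1)[of i] len_pow(1)[of j] unfolding gp_def eq by (simp add: field_simps)
    have "len (a [^] i \<otimes> c \<otimes> a [^] j) \<le> len (a [^] i) + len c + len (a [^] j)"
      using len_mult[of "a [^] i \<otimes> c" "a [^] j"] len_mult[of "a [^] i" c] a c by simp
    then have "len (a [^] i \<otimes> c \<otimes> a [^] j) \<le> \<tau> * i + \<tau> * j + 2 * C + L"
      using len_pow(2)[of i] len_pow(2)[of j] unfolding L_def by linarith
    then show ?thesis using low K00 C L0 by (simp add: algebra_simps abs_le_iff)
  qed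
  then show ?thesis using that[of "2 * K0 + 2 * C + L"] K00 C L0 by auto
qed

text \<open>The points \<open>g\<^sup>k a\<^sup>j\<close>, \<open>0 \<le> j \<le> n\<close>, form a rough axis of \<open>g = a\<^sup>n c\<close>. If \<open>p\<close> is the point of this axis
  nearest to \<open>y\<close>, then \<open>g\<close> moves \<open>y\<close> by about \<open>2 d(y, p)\<close> more than it moves \<open>p\<close>.\<close>

lemma small_displacement_near_axis:
  assumes c: "c \<in> carrier G" "c \<notin> cent a"
  shows "\<exists>D n0. \<forall>n\<ge>n0. \<forall>y\<in>carrier G.
    d y (a [^] n \<otimes> c \<otimes> y) \<le> \<tau> * real n + C1 \<longrightarrow>
      (\<exists>k::int. \<exists>j\<le>n. d y ((a [^] n \<otimes> c) [^] k \<otimes> a [^] j) \<le> D)"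
proof -
  obtain K0 where K0: "\<And>(i::nat) (j::nat). \<bar>real (len (a [^] i \<otimes> c \<otimes> a [^] j)) - \<tau> * (real i + real j)\<bar> \<le> K0"
    using corner_length[OF c] by blast
  define K where "K = max K0 C"
  have K: "\<bar>real (len (a [^] i \<otimes> c \<otimes> a [^] j)) - \<tau> * (real i + real j)\<bar> \<le> K" "C \<le> K" for i j :: nat
    using K0[of i j] by (auto simp: K_def)
  have K0': "K \<ge> 0" using K(2) C by simp
  define K2 where "K2 = 4 * K + 2 * \<delta> + \<tau>"
  define D where "D = (C1 + K + 4 * K2 + 2 * \<delta>) / 2"
  obtain n0 :: nat where n0: "\<tau> * n0 > 4 * K + 2 * \<delta> + K + 2 * K2 + \<delta>"
    using reals_Archimedean3[OF \<tau>] by (auto simp: mult.commute)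
  show ?thesis
  proof (intro exI[of _ D] exI[of _ n0] allI impI ballI)
    fix n y assume n: "n0 \<le> n" and y: "y \<in> carrier G" and disp: "d y (a [^] n \<otimes> c \<otimes> y) \<le> \<tau> * real n + C1"
    have large: "\<tau> * n > 4 * K + 2 * \<delta> + K + 2 * K2 + \<delta>"
    proof -
      have "\<tau> * n0 \<le> \<tau> * n" using n \<tau> by simp
      then show ?thesis using n0 by linarith
    qed
    have K20: "K2 \<ge> 0" using K0' \<delta>_nonneg \<tau> by (simp add: K2_def)
    define g where "g = a [^] n \<otimes> c"
    have g: "g \<in> carrier G" using a c by (simp add: g_def)
    define \<Lambda> where "\<Lambda> = {g [^] k \<otimes> a [^] j |(k::int) (j::nat). j \<le> n}"
    have "g [^] (0::int) \<otimes> a [^] (0::nat) \<in> \<Lambda>" unfolding \<Lambda>_def by blast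
    \<comment> \<open>Distances are natural numbers, so the infinite set \<open>\<Lambda>\<close>
      has a point nearest to \<open>y\<close>.\<close>
    from ex_has_least_nat[where P = "\<lambda>x. x \<in> \<Lambda>" and m = "\<lambda>x. len (inv y \<otimes> x)", OF this]
    obtain p where p: "p \<in> \<Lambda>" "\<And>q. q \<in> \<Lambda> \<Longrightarrow> d y p \<le> d y q" by (auto simp: d_def)
    obtain k :: int and j where kj: "p = g [^] k \<otimes> a [^] j" "j \<le> n" using p(1) by (auto simp: \<Lambda>_def)
    define t where "t = g [^] k"
    have t: "t \<in> carrier G" using g by (simp add: t_def)
    have tg: "g \<otimes> t = g [^] (k + 1)" "t \<otimes> g = g [^] (k + 1)" "t \<otimes> g = g \<otimes> t"
      using g int_pow_mult[of g 1 k] int_pow_mult[of g k 1] by (simp_all add: t_def add.commute)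
    have pc: "p \<in> carrier G" using kj g a by simp
    \<comment> \<open>The stretch of \<open>\<Lambda>\<close> from \<open>p\<close> towards
      \<open>g \<otimes> p\<close>, moved back by \<open>t\<close>: it runs up to
      \<open>a [^] n\<close> and continues in the next translate, where \<open>g\<close> absorbs the
      corner \<open>c\<close>. For \<open>j = 0\<close> it stops at \<open>a [^] n\<close>, one
      corner short of \<open>g\<close>, which the error \<open>K\<close> covers.\<close>
    define Q0 where "Q0 = (\<lambda>m. if j + m \<le> n then a [^] (j + m) else g \<otimes> a [^] (j + m - n))"
    define Q where "Q = (\<lambda>m. t \<otimes> Q0 m)"
    have Q0c: "Q0 m \<in> carrier G" for m using a g by (simp add: Q0_def)
    then have Qc: "Q m \<in> carrier G" for m using t by (simp add: Q_def)
    have gp': "g \<otimes> p = t \<otimes> (g \<otimes> a [^] j)"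
      using tg(3) t g a unfolding kj(1) t_def[symmetric] by (simp flip: m_assoc)
    have dcorner: "d (a [^] i) (g \<otimes> a [^] l) = len (a [^] (n - i) \<otimes> c \<otimes> a [^] l)" if "i \<le> n" for i l :: nat
    proof -
      have "inv (a [^] i) \<otimes> (g \<otimes> a [^] l) = inv (a [^] i) \<otimes> a [^] n \<otimes> c \<otimes> a [^] l"
        using a c by (simp add: g_def m_assoc)
      then show ?thesis using nat_pow_diff[OF a that] by (simp add: d_def)
    qed
    have Q1: "\<bar>d p (Q m) - \<tau> * real m\<bar> \<le> K" if m: "m \<le> n" for m
    proof -
      have "d p (Q m) = d (a [^] j) (Q0 m)" using t a Q0c by (simp add: kj(1) t_def[symmetric] Q_def)
      then show ?thesis
        using dist_pow[of j "j + m"] K(2) dcorner[OF kj(2)] K(1)[of "n - j" "j + m - n"] kj(2) C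
        by (auto simp: Q0_def algebra_simps abs_le_iff)
    qed
    have Q2: "\<bar>d (Q m) (g \<otimes> p) - \<tau> * (real n - m)\<bar> \<le> K" if m: "m \<le> n" for m
    proof -
      have "d (Q m) (g \<otimes> p) = d (Q0 m) (g \<otimes> a [^] j)" using t a g Q0c by (simp add: gp' Q_def)
      moreover have "j + m - n \<le> j" using m by simp
      ultimately show ?thesis
        using dist_pow[of "j + m - n" j] K(2) dcorner[of "j + m" j] K(1)[of "n - (j + m)" j] C a g
        by (auto simp: Q0_def algebra_simps abs_le_iff)
    qed
    have Q\<Lambda>: "Q m \<in> \<Lambda>" if m: "m \<le> n" for m
    proof (cases "j + m \<le> n")
      case True
      then show ?thesis unfolding Q_def Q0_def t_def \<Lambda>_def by auto
    next
      case False
      then have "Q m = g [^] (k + 1) \<otimes> a [^] (j + m - n)"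
        using t g a by (simp add: Q_def Q0_def flip: tg(2) m_assoc)
      then show ?thesis using m kj(2) unfolding \<Lambda>_def by force
    qed
    have inv\<Lambda>: "inv g \<otimes> x \<in> \<Lambda>" if x\<Lambda>: "x \<in> \<Lambda>" for x
    proof -
      obtain k' :: int and j' where x: "x = g [^] k' \<otimes> a [^] j'" "j' \<le> n" using x\<Lambda> by (auto simp: \<Lambda>_def)
      have "inv g \<otimes> x = g [^] (- 1 + k') \<otimes> a [^] j'"
        using g a int_pow_neg[OF g, of 1] unfolding int_pow_mult[OF g] x(1) by (simp add: m_assoc)
      then show ?thesis using x(2) unfolding \<Lambda>_def by blast
    qed
    \<comment> \<open>Invariance of \<open>\<Lambda>\<close> under \<open>inv g\<close> makes
      \<open>g \<otimes> p\<close> nearest to \<open>g \<otimes> y\<close>, so the same estimate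
      applies at both ends.\<close>
    have near: "d (g \<otimes> y) (g \<otimes> p) \<le> d (g \<otimes> y) (Q m)" if "m \<le> n" for m
    proof -
      have "d (g \<otimes> y) (Q m) = d y (inv g \<otimes> Q m)"
        using d_translate[of g y "inv g \<otimes> Q m"] g y Qc by (simp add: inv_cancel_left)
      then show ?thesis using p(2)[OF inv\<Lambda>[OF Q\<Lambda>[OF that]]] g y pc by simp
    qed
    have pgp: "\<bar>d p (g \<otimes> p) - \<tau> * n\<bar> \<le> K"
    proof -
      have "d p (g \<otimes> p) = d (a [^] j) (g \<otimes> a [^] j)"
        unfolding gp' unfolding kj(1) t_def[symmetric] using t a g by simp
      then show ?thesis using dcorner[OF kj(2), of j] K(1)[of "n - j" j] kj(2) by (simp add: of_nat_diff)
    qed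
    have g1: "gp p y (g \<otimes> p) \<le> K2" unfolding K2_def
      by (rule nearest_point_gp[where Q = Q and n = n])
         (use pc y g \<tau> Qc Q1 Q2 pgp p(2) Q\<Lambda> large K20 K0' \<delta>_nonneg in auto)
    have g2: "gp (g \<otimes> p) (g \<otimes> y) p \<le> K2" unfolding K2_def
    proof (rule nearest_point_gp[where Q = "\<lambda>m. Q (n - m)" and n = n])
      fix m assume m: "m \<le> n"
      show "\<bar>d (g \<otimes> p) (Q (n - m)) - \<tau> * m\<bar> \<le> K"
        using Q2[of "n - m"] m pc g Qc by (simp add: d_commute[of "g \<otimes> p"] of_nat_diff)
      show "\<bar>d (Q (n - m)) p - \<tau> * (real n - m)\<bar> \<le> K"
        using Q1[of "n - m"] m pc g Qc by (simp add: d_commute[of _ p] of_nat_diff)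
    qed (use pc y g \<tau> Qc pgp near large K20 K0' \<delta>_nonneg d_commute[of "g \<otimes> p" p] in auto)
    define r where "r = d y p"
    have e1: "d y (g \<otimes> p) \<ge> r + d p (g \<otimes> p) - 2 * K2"
      using g1 y pc by (simp add: gp_def r_def d_commute[of y p])
    have e2: "d p (g \<otimes> y) \<ge> r + d p (g \<otimes> p) - 2 * K2"
      using g2 y pc g by (simp add: gp_def r_def d_commute[of "g \<otimes> p"] d_commute[of "g \<otimes> y"] d_commute[of y p])
    \<comment> \<open>Both distances on the left are at least
      \<open>r + d p (g \<otimes> p) - 2 * K2\<close>. As \<open>d p (g \<otimes> p)\<close> is
      large, the term \<open>2 * r\<close> of the maximum is impossible, and the other term bounds
      \<open>r\<close>.\<close>
    have "d y (g \<otimes> p) + d p (g \<otimes> y) \<le> max (d y p + d (g \<otimes> p) (g \<otimes> y)) (d y (g \<otimes> y) + d p (g \<otimes> p)) + 2 * \<delta>"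
      by (rule four_point) (use y pc g in auto)
    moreover have "d (g \<otimes> p) (g \<otimes> y) = r" using y pc g by (simp add: r_def d_commute[of p y])
    moreover have "d y p = r" by (simp add: r_def)
    moreover have "d p (g \<otimes> p) \<ge> \<tau> * n - K" using pgp by (simp add: abs_le_iff)
    ultimately have "2 * r \<le> C1 + K + 4 * K2 + 2 * \<delta>"
      using e1 e2 disp large K0' \<delta>_nonneg K20 unfolding g_def[symmetric]
      by (auto simp: max_def split: if_splits)
    then have "d y (g [^] k \<otimes> a [^] j) \<le> D" using kj(1) by (simp add: D_def r_def)
    then show "\<exists>k::int. \<exists>j\<le>n. d y ((a [^] n \<otimes> c) [^] k \<otimes> a [^] j) \<le> D"
      using kj(2) unfolding g_def by blast
  qed
qed

text \<open>Seen from the middle of the segment from \<open>\<one>\<close> to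
  \<open>a [^] n\<close>, \<open>g\<close> becomes its conjugate \<open>x\<close>, for which
  \<open>x\<close> and \<open>inv x\<close> set out along opposite halves of the axis. Hence
  \<open>x \<otimes> x\<close> has nearly twice the length of \<open>x\<close> and
  \<open>linear_growth\<close> applies. The subtracted term pays for moving the base point at both
  ends.\<close>

lemma axis_spacing:
  assumes c: "c \<in> carrier G" "c \<notin> cent a"
  shows "\<exists>n0. \<forall>n\<ge>n0. \<forall>(k::int) (l::int). \<forall>i\<le>n. \<forall>j\<le>n.
    \<tau> * real n / 2 * real_of_int \<bar>k - l\<bar> - 2 * (\<tau> * real n + C)
      \<le> d ((a [^] n \<otimes> c) [^] k \<otimes> a [^] i) ((a [^] n \<otimes> c) [^] l \<otimes> a [^] j)"
proof -
  obtain K where K0: "K \<ge> 0"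
    and K: "\<And>(i::nat) (j::nat). \<bar>real (len (a [^] i \<otimes> c \<otimes> a [^] j)) - \<tau> * (real i + real j)\<bar> \<le> K"
    using corner_length[OF c] by blast
  define L where "L = real (len c)"
  obtain n0 :: nat where n0: "\<tau> * n0 > \<tau> + 2 * K + L + 5 * C + 12 * \<delta>"
    using reals_Archimedean3[OF \<tau>] by (auto simp: mult.commute)
  show ?thesis
  proof (intro exI[of _ n0] allI impI)
    fix n and k l :: int and i j :: nat
    assume n: "n \<ge> n0" and ij: "i \<le> n" "j \<le> n"
    have L0: "L \<ge> 0" by (simp add: L_def)
    have "\<tau> * n0 \<le> \<tau> * n" using n \<tau> by simp
    then have large: "\<tau> * n > \<tau> + 2 * K + L + 5 * C + 12 * \<delta>" using n0 by linarith
    then have n1: "n \<ge> 1" using \<tau> K0 L0 C \<delta>_nonneg by (cases n) auto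
    define g where "g = a [^] n \<otimes> c"
    have g: "g \<in> carrier G" using a c by (simp add: g_def)
    define h where "h = n div 2"
    define h' where "h' = n - h"
    have hn: "h + h' = n" "h \<le> n" "h \<le> h'" "n \<le> 2 * h + 1" by (auto simp: h_def h'_def)
    have "real n \<le> 2 * real h + 1" using hn(4) by linarith
    then have "\<tau> * n \<le> \<tau> * (2 * real h + 1)" using \<tau> by (intro mult_left_mono) auto
    also have "\<dots> = 2 * (\<tau> * h) + \<tau>" by (simp add: algebra_simps)
    finally have th: "\<tau> * h > (K + L + C) / 2 + C + 2 * \<delta>"
      using large K0 L0 C \<delta>_nonneg by argo
    have "\<tau> * h \<le> \<tau> * h'" using hn \<tau> by simp
    then have th': "\<tau> * h' > (K + L + C) / 2 + C + 2 * \<delta>" using th by linarith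
    have tn: "\<tau> * n = \<tau> * h + \<tau> * h'" using hn(1) by (metis distrib_left of_nat_add)
    define p where "p = a [^] h"
    have p: "p \<in> carrier G" using a by (simp add: p_def)
    define x where "x = a [^] h' \<otimes> c \<otimes> a [^] h"
    have x: "x \<in> carrier G" using a c by (simp add: x_def)
    have xg: "x = inv p \<otimes> g \<otimes> inv (inv p)"
    proof -
      have "a [^] n = a [^] h \<otimes> a [^] h'" using hn(1) a by (simp add: nat_pow_mult)
      then show ?thesis using a c by (simp add: x_def p_def g_def group_normalize)
    qed
    have lx: "len x \<ge> \<tau> * n - K"
      using K[of h' h] hn(1) unfolding x_def tn by (simp add: abs_le_iff algebra_simps)
    have dl: "d \<one> (inv p) = len (a [^] h)" "d \<one> (inv x) = len x" "d \<one> (a [^] h') = len (a [^] h')" "d \<one> x = len x"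
      using a p x by (simp_all add: p_def)
    have g1: "gp \<one> (inv p) (inv x) > C + 2 * \<delta>"
    proof -
      have "p \<otimes> inv x = inv c \<otimes> inv (a [^] h')" using a c by (simp add: p_def x_def group_normalize)
      then have "d (inv p) (inv x) = len (inv c \<otimes> inv (a [^] h'))" using p by (simp add: d_def)
      also have "\<dots> \<le> real (len c) + real (len (a [^] h'))"
        using len_mult[of "inv c" "inv (a [^] h')"] a c by (simp flip: of_nat_add)
      finally show ?thesis
        using lx len_pow(1)[of h] len_pow(2)[of h'] th unfolding gp_def dl L_def tn by argo
    qed
    have g2: "gp \<one> (a [^] h') x > C + 2 * \<delta>"
    proof -
      have "d (a [^] h') x = len (c \<otimes> a [^] h)" using a c by (simp add: d_def x_def group_normalize)
      also have "\<dots> \<le> real (len c) + real (len (a [^] h))"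
        using len_mult[of c "a [^] h"] a c by (simp flip: of_nat_add)
      finally show ?thesis
        using lx len_pow(1)[of h'] len_pow(2)[of h] th' unfolding gp_def dl L_def tn by argo
    qed
    \<comment> \<open>\<open>inv p\<close> and \<open>a [^] h'\<close> lie on opposite sides of
      \<open>\<one>\<close> on the axis of \<open>a\<close>. By \<open>g1\<close> and
      \<open>g2\<close> they may be replaced by \<open>inv x\<close> and \<open>x\<close>.\<close>
    have g3: "gp \<one> (inv p) (a [^] h') \<le> C"
    proof -
      have "d (inv p) (a [^] h') = len (a [^] n)" using a p hn(1) by (simp add: d_def p_def nat_pow_mult)
      then show ?thesis
        using len_pow(1)[of n] len_pow(2)[of h] len_pow(2)[of h'] unfolding gp_def dl tn by argo
    qed
    have "gp \<one> (inv p) x \<le> C + \<delta>"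
      using gp_min[of \<one> "inv p" x "a [^] h'"] g2 g3 a p x \<delta>_nonneg
      by (simp add: gp_commute[of x] min_def split: if_splits)
    then have g4: "gp \<one> (inv x) x \<le> C + 2 * \<delta>"
      using gp_min[of \<one> "inv p" "inv x" x] g1 a p x \<delta>_nonneg by (simp add: min_def split: if_splits)
    have "d (inv x) x = len (x \<otimes> x)" using x by (simp add: d_def)
    then have "len (x \<otimes> x) \<ge> len x + 2 * \<delta> + \<tau> * n / 2"
      using g4 lx large \<tau> K0 L0 C \<delta>_nonneg unfolding gp_def dl by argo
    then have grow: "len (x [^] m) \<ge> \<tau> * n / 2 * real m" for m :: nat
      using n1 \<tau> by (intro linear_growth[OF x]) auto
    have "len (x [^] (l - k)) \<ge> \<tau> * n / 2 * real_of_int \<bar>k - l\<bar>"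
    proof -
      have "len (x [^] (l - k)) = len (x [^] nat \<bar>k - l\<bar>)"
      proof (cases "l \<ge> k")
        case True
        then have "x [^] (l - k) = x [^] nat \<bar>k - l\<bar>" by (simp flip: int_pow_int)
        then show ?thesis by simp
      next
        case False
        then have "x [^] (l - k) = inv (x [^] nat \<bar>k - l\<bar>)"
          using int_pow_neg[OF x, of "k - l"] by (simp flip: int_pow_int)
        then show ?thesis using x by simp
      qed
      then show ?thesis using grow[of "nat \<bar>k - l\<bar>"] by simp
    qed
    also have "len (x [^] (l - k)) = d (g [^] k \<otimes> p) (g [^] l \<otimes> p)"
    proof -
      have "x [^] (l - k) = inv p \<otimes> g [^] (l - k) \<otimes> p"
        using int_pow_conj[of "inv p" g "l - k"] p g unfolding xg by simp
      also have "g [^] (l - k) = inv (g [^] k) \<otimes> g [^] l"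
        using g int_pow_mult[OF g, of "- k" l] by (simp add: int_pow_neg)
      finally show ?thesis using p g by (simp add: d_def group_normalize)
    qed
    also have "\<dots> \<le> d (g [^] k \<otimes> p) (g [^] k \<otimes> a [^] i) + d (g [^] k \<otimes> a [^] i) (g [^] l \<otimes> a [^] j)
        + d (g [^] l \<otimes> a [^] j) (g [^] l \<otimes> p)"
      using d_triangle[of "g [^] k \<otimes> p" "g [^] k \<otimes> a [^] i" "g [^] l \<otimes> p"]
        d_triangle[of "g [^] k \<otimes> a [^] i" "g [^] l \<otimes> a [^] j" "g [^] l \<otimes> p"] g p a by simp
    finally have tri: "\<tau> * n / 2 * real_of_int \<bar>k - l\<bar> \<le> d (g [^] k \<otimes> p) (g [^] k \<otimes> a [^] i)
        + d (g [^] k \<otimes> a [^] i) (g [^] l \<otimes> a [^] j) + d (g [^] l \<otimes> a [^] j) (g [^] l \<otimes> p)" .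
    have "d (g [^] k \<otimes> p) (g [^] k \<otimes> a [^] i) \<le> \<tau> * n + C"
      using dist_pow_le[OF hn(2) ij(1)] g p a by (simp add: p_def)
    moreover have "d (g [^] l \<otimes> a [^] j) (g [^] l \<otimes> p) \<le> \<tau> * n + C"
      using dist_pow_le[OF ij(2) hn(2)] g p a by (simp add: p_def)
    ultimately show "\<tau> * real n / 2 * real_of_int \<bar>k - l\<bar> - 2 * (\<tau> * real n + C)
      \<le> d ((a [^] n \<otimes> c) [^] k \<otimes> a [^] i) ((a [^] n \<otimes> c) [^] l \<otimes> a [^] j)"
      using tri unfolding g_def by argo
  qed
qed

text \<open>The points \<open>h a\<^sup>i\<close>, \<open>i \<le> n\<close>, have small displacement under \<open>g = a\<^sup>n c'\<close>, so they are close to points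
  \<open>g\<^sup>k a\<^sup>j\<close>. By the spacing estimate boundedly many \<open>k\<close> occur, so for some \<open>k\<close> two of them differ from
  \<open>g\<^sup>k a\<^sup>j\<close> by the same element. This puts \<open>g\<^sup>-\<^sup>k h\<close> into the centralizer of \<open>a\<close>.\<close>

lemma conj_along_powers_axis:
  assumes c: "c \<in> carrier G" and c': "c' \<in> carrier G" "c' \<notin> cent a"
    and conj: "\<And>N::nat. \<exists>n\<ge>N. \<exists>h\<in>carrier G. a [^] n \<otimes> c' = h \<otimes> (a [^] n \<otimes> c) \<otimes> inv h"
  shows "\<exists>h\<in>cent a. c' = h \<otimes> c \<otimes> inv h"
proof -
  define L where "L = real (len c)"
  \<comment> \<open>Bounds the excess over \<open>\<tau> * n\<close> of the length of
    \<open>a [^] (n - i) \<otimes> c \<otimes> a [^] i\<close>, which is the displacement of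
    \<open>h \<otimes> a [^] i\<close> under \<open>g\<close>.\<close>
  define C1 where "C1 = 2 * C + L"
  obtain D n1 where D: "\<forall>n\<ge>n1. \<forall>y\<in>carrier G. d y (a [^] n \<otimes> c' \<otimes> y) \<le> \<tau> * real n + C1 \<longrightarrow>
      (\<exists>k::int. \<exists>j\<le>n. d y ((a [^] n \<otimes> c') [^] k \<otimes> a [^] j) \<le> D)"
    using small_displacement_near_axis[OF c', of C1] by (elim exE) (rule that)
  have disp: "\<exists>k::int. \<exists>j\<le>n. d y ((a [^] n \<otimes> c') [^] k \<otimes> a [^] j) \<le> D"
    if "n \<ge> n1" "y \<in> carrier G" "d y (a [^] n \<otimes> c' \<otimes> y) \<le> \<tau> * real n + C1" for n y
    using D[rule_format, OF that] .
  obtain n2 where n2: "\<forall>n\<ge>n2. \<forall>(k::int) (l::int). \<forall>i\<le>n. \<forall>j\<le>n.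
     \<tau> * real n / 2 * real_of_int \<bar>k - l\<bar> - 2 * (\<tau> * real n + C)
      \<le> d ((a [^] n \<otimes> c') [^] k \<otimes> a [^] i) ((a [^] n \<otimes> c') [^] l \<otimes> a [^] j)"
    using axis_spacing[OF c'] by (elim exE) (rule that)
  note spacing = n2[rule_format]
  define B where "B = {x \<in> carrier G. len x \<le> nat \<lfloor>D\<rfloor>}"
  have finB: "finite B" unfolding B_def by (rule finite_ball)
  \<comment> \<open>Points \<open>h \<otimes> a [^] i\<close> are at most
    \<open>\<tau> * n + C\<close> apart, so by the spacing estimate \<open>\<tau> * n / 2\<close>
    times the difference of two \<open>k\<close> is at most
    \<open>3 * \<tau> * n + 3 * C + 2 * D\<close>. This choice pushes that below
    \<open>4 * \<tau> * n\<close>, whence the bound 8.\<close>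
  obtain n3 :: nat where n3: "\<tau> * n3 > 3 * C + 2 * D"
    using reals_Archimedean3[OF \<tau>] by (auto simp: mult.commute)
  define n4 where "n4 = card ({-7..7::int} \<times> B)"
  obtain n h where nn: "n \<ge> max (max n1 n2) (max n3 n4)" and h: "h \<in> carrier G"
    and eq: "a [^] n \<otimes> c' = h \<otimes> (a [^] n \<otimes> c) \<otimes> inv h" using conj by blast
  then have n: "n \<ge> n1" "n \<ge> n2" "n \<ge> n3" "n \<ge> n4" by auto
  have "\<tau> * n3 \<le> \<tau> * n" using n \<tau> by simp
  then have large: "\<tau> * n > 3 * C + 2 * D" using n3 by linarith
  define g where "g = a [^] n \<otimes> c'"
  have g: "g \<in> carrier G" using a c' by (simp add: g_def)
  define y where "y = (\<lambda>i::nat. h \<otimes> a [^] i)"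
  have y: "y i \<in> carrier G" for i using h a by (simp add: y_def)
  have "\<exists>k::int. \<exists>j\<le>n. d (y i) (g [^] k \<otimes> a [^] j) \<le> D" if i: "i \<le> n" for i
  proof -
    have "d (y i) (g \<otimes> y i) = d (h \<otimes> a [^] i) (h \<otimes> (a [^] n \<otimes> c \<otimes> a [^] i))"
      using h a c unfolding g_def eq y_def by (simp add: group_normalize)
    also have "\<dots> = d (a [^] i) (a [^] n \<otimes> c \<otimes> a [^] i)" using h a c by simp
    also have "\<dots> = len (a [^] (n - i) \<otimes> c \<otimes> a [^] i)"
      using nat_pow_diff[OF a i] a c unfolding d_def by (simp flip: m_assoc)
    also have "\<dots> \<le> real (len (a [^] (n - i))) + real (len c) + real (len (a [^] i))"
      using len_mult[of "a [^] (n - i) \<otimes> c" "a [^] i"] len_mult[of "a [^] (n - i)" c] a c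
      by (simp flip: of_nat_add)
    also have "\<dots> \<le> \<tau> * real n + C1"
      using len_pow(2)[of "n - i"] len_pow(2)[of i] i by (simp add: C1_def L_def algebra_simps of_nat_diff)
    finally show ?thesis using disp[OF n(1) y] by (simp add: g_def)
  qed
  then obtain k :: "nat \<Rightarrow> int" and j :: "nat \<Rightarrow> nat"
    where kj: "\<And>i. i \<le> n \<Longrightarrow> j i \<le> n \<and> d (y i) (g [^] k i \<otimes> a [^] j i) \<le> D" by metis
  have near: "\<bar>k i - k 0\<bar> < 8" if i: "i \<le> n" for i
  proof -
    define z where "z = (\<lambda>i. g [^] k i \<otimes> a [^] j i)"
    have z: "z i \<in> carrier G" for i using g a by (simp add: z_def)
    have "d (y i) (y 0) \<le> \<tau> * real n + C" 
      using dist_pow_le[OF i, of 0] d_translate[OF h, of "a [^] i" "a [^] (0::nat)"] a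
      unfolding y_def by (simp only: nat_pow_closed le0)
    moreover have "d (z i) (y i) \<le> D" using kj[OF i] y z by (simp add: z_def d_commute[of "z i", unfolded z_def])
    moreover have "d (y 0) (z 0) \<le> D" using kj[of 0] by (simp add: z_def)
    moreover have "d (z i) (z 0) \<le> d (z i) (y i) + d (y i) (y 0) + d (y 0) (z 0)"
      using d_triangle[OF z[of i] y[of i] z[of 0]] d_triangle[OF y[of i] y[of 0] z[of 0]] by linarith
    moreover have "\<tau> * real n / 2 * real_of_int \<bar>k i - k 0\<bar> - 2 * (\<tau> * real n + C) \<le> d (z i) (z 0)"
      using spacing[OF n(2), of "j i" "j 0" "k i" "k 0"] kj[OF i] kj[of 0] by (simp add: z_def g_def)
    ultimately have "\<tau> * real n / 2 * real_of_int \<bar>k i - k 0\<bar> < \<tau> * real n / 2 * 8"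
      using large by argo
    moreover have "\<tau> * real n / 2 \<ge> 0" using \<tau> by simp
    ultimately have "real_of_int \<bar>k i - k 0\<bar> < 8" by (rule mult_left_less_imp_less)
    then show ?thesis by linarith
  qed
  define f where "f = (\<lambda>i. (k i - k 0, inv (g [^] k i \<otimes> a [^] j i) \<otimes> y i))"
  have fB: "f i \<in> {-7..7} \<times> B" if i: "i \<le> n" for i
  proof -
    have "d (g [^] k i \<otimes> a [^] j i) (y i) \<le> D" using kj[OF i] y g a by (simp add: d_commute[of _ "y i"])
    then have "len (inv (g [^] k i \<otimes> a [^] j i) \<otimes> y i) \<le> nat \<lfloor>D\<rfloor>" unfolding d_def by (rule le_nat_floor)
    then show ?thesis using near[OF i] y g a by (auto simp: f_def B_def)
  qed
  obtain i i' where i: "i < i'" "i' \<le> n" "f i = f i'"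
    by (rule finite_collision[where n = n, OF _ fB]) (use finB n(4) n4_def in auto)
  \<comment> \<open>Dividing out the power of \<open>g\<close> leaves an element for which
    \<open>f i = f i'\<close> says that it conjugates \<open>a [^] (int i' - int i)\<close> to a
    power of \<open>a\<close>.\<close>
  define x where "x = inv (g [^] k i) \<otimes> h"
  have x: "x \<in> carrier G" using g h by (simp add: x_def)
  have kk: "k i = k i'" using i(3) by (simp add: f_def)
  have "inv (a [^] j i) \<otimes> x \<otimes> a [^] i = inv (a [^] j i') \<otimes> x \<otimes> a [^] i'"
    using i(3) g h a kk by (simp add: f_def y_def x_def group_normalize)
  then have "x \<otimes> a [^] i' = a [^] j i' \<otimes> (inv (a [^] j i) \<otimes> x \<otimes> a [^] i)"
    using a x by (simp add: group_normalize)
  then have "x \<otimes> (a [^] i' \<otimes> inv (a [^] i)) \<otimes> inv x = a [^] j i' \<otimes> inv (a [^] j i)"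
    using a x by (simp add: group_normalize flip: m_assoc) (simp add: group_normalize)
  then have "x \<otimes> a [^] (int i' - int i) \<otimes> inv x = a [^] (int (j i') - int (j i))"
    using a by (simp add: int_pow_diff int_pow_int)
  then have xc: "x \<in> cent a" by (rule conj_power_imp_cent[OF a a1 x]) (use i in simp)
  then have comm: "x \<otimes> a [^] n = a [^] n \<otimes> x"
    using cent_pow[OF a xc, of "int n"] by (simp add: cent_def int_pow_int)
  have gk: "g \<otimes> g [^] k i = g [^] k i \<otimes> g"
    using cent_pow[OF g cent_self[OF g], of "k i"] by (simp add: cent_def)
  \<comment> \<open>As \<open>x\<close> commutes with \<open>a [^] n\<close>, and \<open>g\<close>
    with its own powers, conjugation by \<open>h\<close> turns into conjugation by \<open>x\<close>,
    and the factor \<open>a [^] n\<close> cancels.\<close>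
  have "a [^] n \<otimes> (x \<otimes> c \<otimes> inv x) = x \<otimes> (a [^] n \<otimes> c) \<otimes> inv x"
    using a c x by (simp add: comm flip: m_assoc)
  also have "\<dots> = inv (g [^] k i) \<otimes> (h \<otimes> (a [^] n \<otimes> c) \<otimes> inv h) \<otimes> g [^] k i"
    using a c h g by (simp add: x_def group_normalize)
  also have "\<dots> = inv (g [^] k i) \<otimes> (g \<otimes> g [^] k i)"
    unfolding eq[symmetric] g_def[symmetric] using g by (simp add: m_assoc)
  also have "\<dots> = a [^] n \<otimes> c'" unfolding gk using g by (simp add: inv_cancel_left) (simp add: g_def)
  finally have "x \<otimes> c \<otimes> inv x = c'" using a c c' x by simp
  then show ?thesis using xc by blast
qed

end

section \<open>Pointwise inner endomorphisms are inner\<close>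

context torsion_free_hyperbolic
begin

lemma conj_along_powers:
  assumes a: "a \<in> carrier G" "a \<noteq> \<one>" and c: "c \<in> carrier G" and c': "c' \<in> carrier G" "c' \<notin> cent a"
    and conj: "\<And>N::nat. \<exists>n\<ge>N. \<exists>h\<in>carrier G. a [^] n \<otimes> c' = h \<otimes> (a [^] n \<otimes> c) \<otimes> inv h"
  shows "\<exists>h\<in>cent a. c' = h \<otimes> c \<otimes> inv h"
proof -
  obtain \<tau> C where "rough_axis a \<tau> C" using ex_rough_axis[OF torsion_free a] by blast
  then interpret axis G len \<delta> a \<tau> C by unfold_locales (use a in auto)
  show ?thesis by (rule conj_along_powers_axis[OF c c' conj])
qed

lemma pow_in_cent_self:
  assumes "a \<in> carrier G"
  shows "a [^] (n::nat) \<in> cent a" "a [^] (i::int) \<in> cent a"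
  using pow_in_cent[OF assms cent_self[OF assms], of "int n"] pow_in_cent[OF assms cent_self[OF assms], of i]
  by (simp_all add: int_pow_int)

lemma cent_inv: "a \<in> carrier G \<Longrightarrow> cent (inv a) = cent a"
  using cent_pow[of a _ "- 1"] cent_pow[of "inv a" _ "- 1"]
  by (auto simp: int_pow_neg int_pow_inv)

text \<open>For an unbounded set of exponents, \<open>conj_along_powers\<close> applies to \<open>a\<close> or to its inverse, and its
  conclusion would force \<open>y\<close> into the centralizer.\<close>

lemma finite_conj_exponents:
  assumes a: "a \<in> carrier G" "a \<noteq> \<one>" and x: "x \<in> cent a" and y: "y \<in> carrier G" "y \<notin> cent a"
  shows "finite {i::int. \<exists>h\<in>carrier G. a [^] i \<otimes> y = h \<otimes> (a [^] i \<otimes> x) \<otimes> inv h}" (is "finite ?I")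
proof (rule ccontr)
  assume inf: "infinite ?I"
  have xc: "x \<in> carrier G" using x by (rule cent_carrier)
  have no: "\<not> (\<exists>h\<in>cent a. y = h \<otimes> x \<otimes> inv h)"
  proof
    interpret A: subgroup "cent a" G by (rule subgroup_cent[OF a(1)])
    assume "\<exists>h\<in>cent a. y = h \<otimes> x \<otimes> inv h"
    then show False using y x by auto
  qed
  have up: "\<exists>N::nat. \<forall>n\<ge>N. int n \<notin> ?I"
  proof (rule ccontr)
    assume "\<not> ?thesis"
    then have "\<exists>h\<in>cent a. y = h \<otimes> x \<otimes> inv h"
      by (intro conj_along_powers[OF a xc y]) (auto simp: int_pow_int)
    with no show False ..
  qed
  have down: "\<exists>N::nat. \<forall>n\<ge>N. - int n \<notin> ?I"
  proof (rule ccontr)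
    assume neg: "\<not> ?thesis"
    have "\<exists>h\<in>cent (inv a). y = h \<otimes> x \<otimes> inv h"
    proof (rule conj_along_powers)
      fix N :: nat
      obtain n where "n \<ge> N" "- int n \<in> ?I" using neg by blast
      moreover have "a [^] (- int n) = inv a [^] n" using a by (simp add: int_pow_neg int_pow_int nat_pow_inv)
      ultimately show "\<exists>n\<ge>N. \<exists>h\<in>carrier G. inv a [^] n \<otimes> y = h \<otimes> (inv a [^] n \<otimes> x) \<otimes> inv h" by auto
    qed (use a xc y cent_inv in auto)
    with no show False using cent_inv[OF a(1)] by simp
  qed
  obtain N M :: nat where NM: "\<And>n. n \<ge> N \<Longrightarrow> int n \<notin> ?I" "\<And>n. n \<ge> M \<Longrightarrow> - int n \<notin> ?I"
    using up down by blast
  have "?I \<subseteq> {- int M..int N}"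
  proof
    fix i assume i: "i \<in> ?I"
    show "i \<in> {- int M..int N}"
    proof (rule ccontr)
      assume "i \<notin> {- int M..int N}"
      then consider "i = int (nat i)" "nat i \<ge> N" | "i = - int (nat (- i))" "nat (- i) \<ge> M" by force
      then show False
      proof cases
        case 1
        from i NM(1)[OF 1(2)] show ?thesis unfolding 1(1)[symmetric] by contradiction
      next
        case 2
        from i NM(2)[OF 2(2)] show ?thesis unfolding 2(1)[symmetric] by contradiction
      qed
    qed
  qed
  then show False using inf finite_subset by blast
qed

text \<open>For \<open>k\<close> with \<open>c a\<^sup>k e \<notin> cent a\<close> the conjugator \<open>w\<close> of \<open>c a\<^sup>k e\<close> gives \<open>u\<^sub>k = w\<^sup>-\<^sup>1 s\<close> in the
  centralizer with \<open>u\<^sub>k c v a\<^sup>k e = c a\<^sup>k e u\<^sub>k v\<close>, where \<open>v = s\<^sup>-\<^sup>1 t\<close>. If \<open>v \<noteq> 1\<close>, a repeated value of \<open>u\<^sub>k\<close> contradicts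
  malnormality, and infinitely many values contradict \<open>finite_conj_exponents\<close>.\<close>

lemma conjugators_agree:
  assumes a: "a \<in> carrier G" "a \<noteq> \<one>"
    and \<phi>: "\<phi> \<in> hom G G" "\<And>x. x \<in> cent a \<Longrightarrow> \<phi> x = x"
    and conj: "\<And>x. \<lbrakk>x \<in> carrier G; x \<notin> cent a\<rbrakk> \<Longrightarrow> \<exists>h\<in>cent a. \<phi> x = h \<otimes> x \<otimes> inv h"
    and c: "c \<in> carrier G" "c \<notin> cent a" and s: "s \<in> cent a" "\<phi> c = s \<otimes> c \<otimes> inv s"
    and e: "e \<in> carrier G" "e \<notin> cent a" and t: "t \<in> cent a" "\<phi> e = t \<otimes> e \<otimes> inv t"
  shows "s = t"
proof (rule ccontr)
  assume "s \<noteq> t"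
  interpret A: subgroup "cent a" G by (rule subgroup_cent[OF a(1)])
  have AG: "x \<in> carrier G" if "x \<in> cent a" for x using that by (rule cent_carrier)
  have ab: "x \<otimes> y = y \<otimes> x" if "x \<in> cent a" "y \<in> cent a" for x y using cent_abelian[OF a] that by blast
  have apow: "a [^] k \<in> cent a" for k :: nat using pow_in_cent_self[OF a(1)] by simp
  have malnormal: "z \<otimes> x \<otimes> inv z \<notin> cent a" if "z \<in> carrier G" "z \<notin> cent a" "x \<in> cent a" "x \<noteq> \<one>" for x z
    using cent_malnormal[OF a] that by blast
  have notin_inv: "inv z \<notin> cent a" if "z \<in> carrier G" "z \<notin> cent a" for z
    using that A.m_inv_closed[of "inv z"] by auto
  define v where "v = inv s \<otimes> t"
  have vA: "v \<in> cent a" using s t by (simp add: v_def)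
  have tv: "t = s \<otimes> v" using s t AG by (simp add: v_def inv_cancel_left)
  have v1: "v \<noteq> \<one>" using tv \<open>s \<noteq> t\<close> s AG by auto
  define P where "P = {k::nat. c \<otimes> a [^] k \<otimes> e \<notin> cent a}"
  \<comment> \<open>Two exponents outside \<open>P\<close> would put the conjugate of a nontrivial
    power of \<open>a\<close> by \<open>inv e\<close> into the centralizer.\<close>
  have infP: "infinite P"
  proof
    assume "finite P"
    then have "infinite (- P)" by simp
    then obtain k l where kl: "k \<in> - P" "l \<in> - P" "k < l"
      by (metis ComplI finite_nat_set_iff_bounded_le linorder_not_le infinite_nat_iff_unbounded not_less_iff_gr_or_eq)
    then have "inv (c \<otimes> a [^] k \<otimes> e) \<otimes> (c \<otimes> a [^] l \<otimes> e) \<in> cent a" by (simp add: P_def)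
    also have "inv (c \<otimes> a [^] k \<otimes> e) \<otimes> (c \<otimes> a [^] l \<otimes> e) = inv e \<otimes> (inv (a [^] k) \<otimes> a [^] l) \<otimes> e"
      using a c e by (simp add: group_normalize)
    also have "inv (a [^] k) \<otimes> a [^] l = a [^] (l - k)" using kl(3) a by (simp add: nat_pow_diff)
    finally have "inv e \<otimes> a [^] (l - k) \<otimes> inv (inv e) \<in> cent a" using e by simp
    moreover have "a [^] (l - k) \<noteq> \<one>" using pow_eq_one[OF a(1), of "l - k"] kl(3) a by auto
    ultimately show False using malnormal[of "inv e" "a [^] (l - k)"] notin_inv[OF e] e apow by simp
  qed
  have "\<exists>u\<in>cent a. u \<otimes> c \<otimes> (v \<otimes> (a [^] k \<otimes> e)) = c \<otimes> (a [^] k \<otimes> e) \<otimes> (u \<otimes> v)" if k: "k \<in> P" for k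
  proof -
    have "c \<otimes> a [^] k \<otimes> e \<notin> cent a" using k by (simp add: P_def)
    then obtain w where w: "w \<in> cent a" "\<phi> (c \<otimes> a [^] k \<otimes> e) = w \<otimes> (c \<otimes> a [^] k \<otimes> e) \<otimes> inv w"
      using conj a c e by (meson m_closed nat_pow_closed)
    define u where "u = inv w \<otimes> s"
    have uA: "u \<in> cent a" using w s by (simp add: u_def)
    have "\<phi> (c \<otimes> a [^] k \<otimes> e) = \<phi> c \<otimes> \<phi> (a [^] k) \<otimes> \<phi> e"
      using \<phi>(1) a c e by (simp add: hom_mult)
    also have "\<dots> = s \<otimes> c \<otimes> inv s \<otimes> a [^] k \<otimes> (t \<otimes> e \<otimes> inv t)"
      using \<phi>(2)[OF apow] s(2) t(2) by simp
    also have "\<dots> = s \<otimes> c \<otimes> (inv s \<otimes> (a [^] k \<otimes> t)) \<otimes> e \<otimes> inv t"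
      using s t a c e AG by (simp add: m_assoc)
    also have "a [^] k \<otimes> t = t \<otimes> a [^] k" using ab apow t by blast
    finally have "w \<otimes> (c \<otimes> a [^] k \<otimes> e) \<otimes> inv w = s \<otimes> c \<otimes> (inv s \<otimes> (t \<otimes> a [^] k)) \<otimes> e \<otimes> inv t"
      unfolding w(2) .
    then have "inv w \<otimes> (w \<otimes> (c \<otimes> a [^] k \<otimes> e) \<otimes> inv w) \<otimes> t
        = inv w \<otimes> (s \<otimes> c \<otimes> (inv s \<otimes> (t \<otimes> a [^] k)) \<otimes> e \<otimes> inv t) \<otimes> t" by simp
    then have "c \<otimes> (a [^] k \<otimes> e) \<otimes> (inv w \<otimes> t) = u \<otimes> c \<otimes> (v \<otimes> (a [^] k \<otimes> e))"
      using w s t a c e AG by (simp add: u_def v_def group_normalize)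
    moreover have "inv w \<otimes> t = u \<otimes> v" using w s t AG by (simp add: u_def v_def group_normalize)
    ultimately show ?thesis using uA by metis
  qed
  then obtain u where u: "\<And>k. k \<in> P \<Longrightarrow> u k \<in> cent a"
    and E: "\<And>k. k \<in> P \<Longrightarrow> u k \<otimes> c \<otimes> (v \<otimes> (a [^] k \<otimes> e)) = c \<otimes> (a [^] k \<otimes> e) \<otimes> (u k \<otimes> v)" by metis
  have inj: "u k \<noteq> u l" if kl: "k \<in> P" "l \<in> P" "k < l" for k l
  proof
    assume eq: "u k = u l"
    define w where "w = inv c \<otimes> u k \<otimes> inv (inv c)"
    have uG: "u k \<in> carrier G" using u kl AG by blast
    have wG: "w \<in> carrier G" using uG c by (simp add: w_def)
    \<comment> \<open>The bracket on the right does not involve \<open>m\<close>, so two exponents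
      with the same \<open>u\<close> make \<open>w\<close> commute with
      \<open>a [^] (l - k)\<close>.\<close>
    have E': "w \<otimes> a [^] m = a [^] m \<otimes> (e \<otimes> u k \<otimes> v \<otimes> inv e \<otimes> inv v)" if m: "m \<in> P" "u m = u k" for m
    proof -
      have "v \<otimes> a [^] m = a [^] m \<otimes> v" using ab apow vA by blast
      then have "u k \<otimes> c \<otimes> (a [^] m \<otimes> v \<otimes> e) = c \<otimes> (a [^] m \<otimes> e) \<otimes> (u k \<otimes> v)"
        using E[OF m(1)] m(2) a e vA AG by (simp flip: m_assoc)
      then have "inv c \<otimes> (u k \<otimes> c \<otimes> (a [^] m \<otimes> v \<otimes> e)) \<otimes> inv e \<otimes> inv v
         = inv c \<otimes> (c \<otimes> (a [^] m \<otimes> e) \<otimes> (u k \<otimes> v)) \<otimes> inv e \<otimes> inv v" by simp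
      then show ?thesis using a c e uG vA AG by (simp add: w_def group_normalize)
    qed
    have "a [^] l = a [^] (l - k) \<otimes> a [^] k" "a [^] l = a [^] k \<otimes> a [^] (l - k)"
      using kl(3) a by (simp_all add: nat_pow_mult)
    then have "w \<otimes> a [^] (l - k) \<otimes> a [^] k = a [^] (l - k) \<otimes> w \<otimes> a [^] k"
      using E'[OF kl(2)] E'[OF kl(1)] eq a wG c e uG vA AG by (simp add: m_assoc)
    then have "w \<otimes> a [^] (l - k) = a [^] (l - k) \<otimes> w" using a wG by simp
    then have "w \<in> cent (a [^] int (l - k))" using wG unfolding cent_def int_pow_int by blast
    then have "w \<in> cent a" by (rule cent_of_pow[OF a(1)]) (use kl in simp)
    then have u1: "u k = \<one>"
      using malnormal[of "inv c" "u k"] notin_inv[OF c] c u[OF kl(1)] unfolding w_def by auto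
    have "v \<otimes> a [^] k = a [^] k \<otimes> v" using ab apow vA by blast
    then have "c \<otimes> (a [^] k \<otimes> (v \<otimes> e)) = c \<otimes> (a [^] k \<otimes> (e \<otimes> v))"
      using E[OF kl(1)] a c e vA AG unfolding u1 by (simp flip: m_assoc)
    then have "v \<otimes> e = e \<otimes> v" using a c e vA AG by simp
    then have "e \<otimes> v \<otimes> inv e = v" using e vA AG by (metis inv_solve_right' m_closed)
    then show False using malnormal[OF e vA v1] vA by simp
  qed
  then have inj_u: "inj_on u P" by (intro linorder_inj_onI) auto
  obtain F where F: "finite F" "F \<subseteq> cent a" "\<And>h. h \<in> cent a \<Longrightarrow> \<exists>i::int. h \<otimes> a [^] i \<in> F"
    using centralizer_finite_index[OF a] by blast
  have "\<exists>i::int. u k \<otimes> a [^] i \<in> F" if "k \<in> P" for k using F(3)[OF u[OF that]] .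
  then obtain i :: "nat \<Rightarrow> int" where i: "\<And>k. k \<in> P \<Longrightarrow> u k \<otimes> a [^] i k \<in> F" by metis
  have "finite ((\<lambda>k. u k \<otimes> a [^] i k) ` P)" by (rule finite_subset[OF _ F(1)]) (use i in auto)
  \<comment> \<open>The powers of \<open>a\<close> have finite index in the centralizer, so
    infinitely many \<open>u k\<close> lie in one coset and differ only by powers of
    \<open>a\<close>.\<close>
  then obtain k0 where k0: "k0 \<in> P" "infinite {k \<in> P. u k \<otimes> a [^] i k = u k0 \<otimes> a [^] i k0}"
    using pigeonhole_infinite[OF infP] by blast
  define f where "f = u k0 \<otimes> a [^] i k0"
  define P' where "P' = {k \<in> P. u k \<otimes> a [^] i k = f}"
  have fA: "f \<in> cent a" using i[OF k0(1)] F(2) by (auto simp: f_def)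
  have uf: "u k = a [^] (- i k) \<otimes> f" if "k \<in> P'" for k
  proof -
    have "f = u k \<otimes> a [^] i k" using that by (simp add: P'_def)
    moreover have "u k \<otimes> a [^] i k = a [^] i k \<otimes> u k"
      using ab u pow_in_cent_self[OF a(1)] that by (simp add: P'_def)
    ultimately show ?thesis using a u AG that by (simp add: P'_def int_pow_neg inv_cancel_left)
  qed
  have "inj_on (\<lambda>k. - i k) P'"
  proof (rule inj_onI)
    fix k l assume kl: "k \<in> P'" "l \<in> P'" "- i k = - i l"
    then have "u k = u l" using uf by simp
    then show "k = l" using inj_u kl by (auto simp: P'_def inj_on_def)
  qed
  then have "infinite ((\<lambda>k. - i k) ` P')"
    using k0(2) finite_imageD unfolding P'_def f_def by blast
  moreover have "(\<lambda>k. - i k) ` P' \<subseteq> {i::int. \<exists>h\<in>carrier G. a [^] i \<otimes> (f \<otimes> (c \<otimes> v \<otimes> inv c)) = h \<otimes> (a [^] i \<otimes> (f \<otimes> v)) \<otimes> inv h}"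
  proof clarify
    fix k assume k: "k \<in> P'"
    \<comment> \<open>Read this way, \<open>E\<close> says that \<open>h\<close> conjugates
      \<open>u k \<otimes> v\<close> to
      \<open>u k \<otimes> (c \<otimes> v \<otimes> inv c)\<close>. Only the exponent of
      \<open>a\<close> in \<open>u k\<close> varies with \<open>k\<close>.\<close>
    define h where "h = c \<otimes> (a [^] k \<otimes> e)"
    have h: "h \<in> carrier G" using a c e by (simp add: h_def)
    have kP: "k \<in> P" using k by (simp add: P'_def)
    have "u k \<otimes> (c \<otimes> v \<otimes> inv c) \<otimes> h = h \<otimes> (u k \<otimes> v)"
      using E[OF kP] a c e vA u[OF kP] AG by (simp add: h_def group_normalize)
    then have "u k \<otimes> (c \<otimes> v \<otimes> inv c) = h \<otimes> (u k \<otimes> v) \<otimes> inv h"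
      using h c vA u[OF kP] AG by (simp add: inv_solve_right)
    then show "\<exists>h\<in>carrier G. a [^] (- i k) \<otimes> (f \<otimes> (c \<otimes> v \<otimes> inv c)) = h \<otimes> (a [^] (- i k) \<otimes> (f \<otimes> v)) \<otimes> inv h"
      using h a c vA fA AG unfolding uf[OF k] by (intro bexI[of _ h]) (auto simp: m_assoc)
  qed
  moreover have "f \<otimes> (c \<otimes> v \<otimes> inv c) \<notin> cent a"
  proof
    assume "f \<otimes> (c \<otimes> v \<otimes> inv c) \<in> cent a"
    then have "inv f \<otimes> (f \<otimes> (c \<otimes> v \<otimes> inv c)) \<in> cent a" using fA by blast
    then have "c \<otimes> v \<otimes> inv c \<in> cent a" using fA vA c AG by (simp add: inv_cancel_left)
    then show False using malnormal[OF c vA v1] by simp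
  qed
  ultimately show False
    using finite_conj_exponents[OF a, of "f \<otimes> v" "f \<otimes> (c \<otimes> v \<otimes> inv c)"] fA vA c AG finite_subset
    by (metis (no_types, lifting) A.m_closed inv_closed m_closed)
qed

lemma pointwise_inner_imp_inner:
  assumes \<phi>: "\<phi> \<in> hom G G" and conj: "\<And>x. x \<in> carrier G \<Longrightarrow> conjugate_in G x (\<phi> x)"
  shows "\<exists>h\<in>carrier G. \<forall>x\<in>carrier G. \<phi> x = h \<otimes> x \<otimes> inv h"
proof (cases "carrier G = {\<one>}")
  case True
  then show ?thesis using hom_one[OF \<phi> is_group is_group] by simp
next
  case False
  then obtain a where a: "a \<in> carrier G" "a \<noteq> \<one>" using one_closed by blast
  obtain g where g: "g \<in> carrier G" "\<phi> a = g \<otimes> a \<otimes> inv g" using conj[OF a(1)] by (auto simp: conjugate_in_def)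
  define \<psi> where "\<psi> = (\<lambda>x. inv g \<otimes> \<phi> x \<otimes> g)"
  have \<phi>c: "\<phi> x \<in> carrier G" if "x \<in> carrier G" for x using \<phi> that by (rule hom_in_carrier)
  have \<psi>c: "\<psi> x \<in> carrier G" if "x \<in> carrier G" for x using \<phi>c[OF that] g by (simp add: \<psi>_def)
  have \<psi>: "\<psi> \<in> hom G G"
    using \<phi> \<phi>c g by (intro homI) (auto simp: \<psi>_def hom_mult group_normalize)
  have \<psi>a: "\<psi> a = a" using g a by (simp add: \<psi>_def group_normalize)
  have \<psi>conj: "\<exists>k\<in>carrier G. \<psi> x = k \<otimes> x \<otimes> inv k" if x: "x \<in> carrier G" for x
  proof -
    obtain k where k: "k \<in> carrier G" "\<phi> x = k \<otimes> x \<otimes> inv k" using conj[OF x] by (auto simp: conjugate_in_def)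
    then have "\<psi> x = (inv g \<otimes> k) \<otimes> x \<otimes> inv (inv g \<otimes> k)" using g x by (simp add: \<psi>_def group_normalize)
    then show ?thesis using g k by blast
  qed
  \<comment> \<open>Some power of \<open>x\<close> is a power of \<open>a\<close>, hence fixed, so
    \<open>\<psi> x\<close> and \<open>x\<close> are roots of the same element.\<close>
  have \<psi>A: "\<psi> x = x" if x: "x \<in> cent a" for x
  proof -
    have xG: "x \<in> carrier G" using x by (rule cent_carrier)
    obtain p :: nat and q :: int where pq: "p \<noteq> 0" "x [^] p = a [^] q"
      using cent_power_in_powers[OF a x] by blast
    have "\<psi> x [^] p = \<psi> (x [^] p)" using hom_nat_pow[OF \<psi> xG is_group is_group] by simp
    also have "\<dots> = x [^] p" unfolding pq using hom_int_pow[OF \<psi> a(1) is_group is_group] \<psi>a by simp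
    finally show ?thesis using unique_roots[OF \<psi>c[OF xG] xG _ pq(1)] by blast
  qed
  \<comment> \<open>A homomorphism that maps each element to a conjugate is injective. If
    \<open>\<psi> x\<close> commuted with \<open>a = \<psi> a\<close>, the commutator of
    \<open>x\<close> and \<open>a\<close> would lie in the trivial kernel.\<close>
  have \<psi>notA: "\<psi> x \<notin> cent a" if x: "x \<in> carrier G" "x \<notin> cent a" for x
  proof
    assume "\<psi> x \<in> cent a"
    interpret \<psi>: group_hom G G \<psi> by unfold_locales (rule \<psi>)
    define z where "z = x \<otimes> a \<otimes> inv (a \<otimes> x)"
    have z: "z \<in> carrier G" using a x by (simp add: z_def)
    have "\<psi> x \<otimes> a = a \<otimes> \<psi> x" using \<open>\<psi> x \<in> cent a\<close> by (simp add: cent_def)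
    then have "\<psi> (x \<otimes> a) = \<psi> (a \<otimes> x)" using a x \<psi>a by simp
    then have "\<psi> z = \<one>" using a x unfolding z_def by (simp del: \<psi>.hom_mult add: \<psi>.hom_mult[of "x \<otimes> a"])
    moreover obtain k where k: "k \<in> carrier G" "\<psi> z = k \<otimes> z \<otimes> inv k" using \<psi>conj[OF z] by blast
    ultimately have "inv k \<otimes> (k \<otimes> z \<otimes> inv k) \<otimes> k = \<one>" by simp
    then have "z = \<one>" using k z by (simp add: group_normalize)
    then have "x \<otimes> a = a \<otimes> x"
      using a x unfolding z_def by (metis inv_inv inv_unique' inv_closed m_closed inv_equality)
    then show False using x by (simp add: cent_def)
  qed
  have conjA: "\<exists>h\<in>cent a. \<psi> x = h \<otimes> x \<otimes> inv h" if x: "x \<in> carrier G" "x \<notin> cent a" for x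
  proof (rule conj_along_powers[OF a x(1) \<psi>c[OF x(1)] \<psi>notA[OF x]])
    fix N :: nat
    \<comment> \<open>Since \<open>\<psi>\<close> fixes the powers of \<open>a\<close>, pointwise
      conjugacy at \<open>a [^] N \<otimes> x\<close> provides every exponent
      \<open>N\<close>.\<close>
    have "\<psi> (a [^] N \<otimes> x) = a [^] N \<otimes> \<psi> x"
      using \<psi> x a \<psi>A[OF pow_in_cent_self(1)[OF a(1)]] by (simp add: hom_mult)
    then show "\<exists>n\<ge>N. \<exists>h\<in>carrier G. a [^] n \<otimes> \<psi> x = h \<otimes> (a [^] n \<otimes> x) \<otimes> inv h"
      using \<psi>conj[of "a [^] N \<otimes> x"] a x by auto
  qed
  have "\<exists>s\<in>cent a. \<forall>x\<in>carrier G. \<psi> x = s \<otimes> x \<otimes> inv s"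
  proof (cases "carrier G \<subseteq> cent a")
    case True
    then have "\<psi> x = \<one> \<otimes> x \<otimes> inv \<one>" if "x \<in> carrier G" for x using \<psi>A[of x] that by auto
    moreover have "\<one> \<in> cent a" using a by (simp add: cent_def)
    ultimately show ?thesis by blast
  next
    case False
    then obtain c where c: "c \<in> carrier G" "c \<notin> cent a" by blast
    obtain s where s: "s \<in> cent a" "\<psi> c = s \<otimes> c \<otimes> inv s" using conjA[OF c] by blast
    have sG: "s \<in> carrier G" using s(1) by (rule cent_carrier)
    have "\<psi> x = s \<otimes> x \<otimes> inv s" if x: "x \<in> carrier G" for x
    proof (cases "x \<in> cent a")
      case True
      then have "s \<otimes> x = x \<otimes> s" using cent_abelian[OF a s(1)] by blast
      then show ?thesis using \<psi>A[OF True] x sG by (simp add: m_assoc)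
    next
      case False
      then obtain t where t: "t \<in> cent a" "\<psi> x = t \<otimes> x \<otimes> inv t" using conjA[OF x] by blast
      have "s = t" by (rule conjugators_agree[OF a \<psi> \<psi>A conjA c s x False t])
      then show ?thesis using t by simp
    qed
    then show ?thesis using s(1) by blast
  qed
  then obtain s where s: "s \<in> cent a" "\<And>x. x \<in> carrier G \<Longrightarrow> \<psi> x = s \<otimes> x \<otimes> inv s" by blast
  have sG: "s \<in> carrier G" using s(1) by (rule cent_carrier)
  have "\<phi> x = (g \<otimes> s) \<otimes> x \<otimes> inv (g \<otimes> s)" if x: "x \<in> carrier G" for x
  proof -
    have "\<phi> x = g \<otimes> \<psi> x \<otimes> inv g" using \<phi>c[OF x] g by (simp add: \<psi>_def group_normalize)
    then show ?thesis using s(2)[OF x] g x sG by (simp add: group_normalize)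
  qed
  then show ?thesis using g sG by blast
qed

end

section \<open>Word length\<close>

context group
begin

definition word_value :: "'a list \<Rightarrow> 'a" where
  "word_value ws = foldr (\<lambda>a b. a \<otimes> b) ws \<one>"

lemma word_value_simps [simp]:
  "word_value [] = \<one>" "word_value (w # ws) = w \<otimes> word_value ws"
  by (simp_all add: word_value_def)

lemma word_value_closed [simp]: "set ws \<subseteq> carrier G \<Longrightarrow> word_value ws \<in> carrier G"
  by (induction ws) auto

lemma word_value_append:
  "\<lbrakk>set ws \<subseteq> carrier G; set vs \<subseteq> carrier G\<rbrakk> \<Longrightarrow> word_value (ws @ vs) = word_value ws \<otimes> word_value vs"
  by (induction ws) (auto simp: m_assoc)

lemma word_value_inv:
  "set ws \<subseteq> carrier G \<Longrightarrow> inv (word_value ws) = word_value (rev (map (\<lambda>s. inv s) ws))"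
proof (induction ws)
  case (Cons w ws)
  then have "set (rev (map (\<lambda>s. inv s) ws)) \<subseteq> carrier G" by auto
  then show ?case using Cons word_value_append[of "rev (map (\<lambda>s. inv s) ws)" "[inv w]"]
    by (simp add: inv_mult_group)
qed simp

context
  fixes S
  assumes S: "S \<subseteq> carrier G" and gen: "generate G S = carrier G"
begin

abbreviation letters where "letters \<equiv> S \<union> (\<lambda>s. inv s) ` S"

lemma letters_carrier: "letters \<subseteq> carrier G"
  using S by auto

lemma ex_word:
  assumes "g \<in> carrier G"
  shows "\<exists>ws. set ws \<subseteq> letters \<and> word_value ws = g"
proof -
  have "g \<in> generate G S" using assms gen by simp
  then show ?thesis
  proof induction
    case one then show ?case by (intro exI[of _ "[]"]) simp
  next
    case (incl h) then show ?case using S by (intro exI[of _ "[h]"]) auto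
  next
    case (inv h) then show ?case using S by (intro exI[of _ "[inv h]"]) auto
  next
    case (eng h1 h2)
    then obtain ws vs where "set ws \<subseteq> letters" "word_value ws = h1" "set vs \<subseteq> letters" "word_value vs = h2"
      by blast
    then show ?case using word_value_append[of ws vs] letters_carrier by (intro exI[of _ "ws @ vs"]) auto
  qed
qed

lemma word_length_le: "set ws \<subseteq> letters \<Longrightarrow> word_length G S (word_value ws) \<le> length ws"
  unfolding word_length_def word_value_def by (rule Least_le) blast

lemma word_length_attained:
  assumes "g \<in> carrier G"
  obtains ws where "length ws = word_length G S g" "set ws \<subseteq> letters" "word_value ws = g"
proof -
  obtain ws where "set ws \<subseteq> letters" "word_value ws = g" using ex_word[OF assms] by blast
  then have "\<exists>n ws. length ws = n \<and> set ws \<subseteq> letters \<and> word_value ws = g" by blast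
  from LeastI_ex[OF this] show ?thesis using that unfolding word_length_def word_value_def by blast
qed

lemma word_length_one: "word_length G S \<one> = 0"
  using word_length_le[of "[]"] by simp

lemma word_length_inv_le:
  assumes g: "g \<in> carrier G"
  shows "word_length G S (inv g) \<le> word_length G S g"
proof -
  obtain ws where ws: "length ws = word_length G S g" "set ws \<subseteq> letters" "word_value ws = g"
    using word_length_attained[OF g] by blast
  have "inv s \<in> letters" if "s \<in> letters" for s using that S by auto
  then have "set (rev (map (\<lambda>s. inv s) ws)) \<subseteq> letters" unfolding set_rev set_map using ws(2) by blast
  from word_length_le[OF this] show ?thesis using ws word_value_inv[OF subset_trans[OF ws(2) letters_carrier]] by simp
qed

lemma word_length_inv: "g \<in> carrier G \<Longrightarrow> word_length G S (inv g) = word_length G S g"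
  using word_length_inv_le[of g] word_length_inv_le[of "inv g"] by simp

lemma word_length_mult:
  assumes "g \<in> carrier G" "h \<in> carrier G"
  shows "word_length G S (g \<otimes> h) \<le> word_length G S g + word_length G S h"
proof -
  obtain ws vs where ws: "length ws = word_length G S g" "set ws \<subseteq> letters" "word_value ws = g"
    and vs: "length vs = word_length G S h" "set vs \<subseteq> letters" "word_value vs = h"
    using word_length_attained assms by metis
  then show ?thesis
    using word_length_le[of "ws @ vs"] word_value_append[of ws vs] letters_carrier by auto
qed

lemma finite_word_ball:
  assumes "finite S"
  shows "finite {x \<in> carrier G. word_length G S x \<le> r}"
proof (rule finite_subset)
  show "finite (word_value ` {ws. set ws \<subseteq> letters \<and> length ws \<le> r})"
    using assms by (intro finite_imageI finite_lists_length_le) auto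
  show "{x \<in> carrier G. word_length G S x \<le> r} \<subseteq> word_value ` {ws. set ws \<subseteq> letters \<and> length ws \<le> r}"
  proof clarify
    fix x assume x: "x \<in> carrier G" "word_length G S x \<le> r"
    obtain ws where "length ws = word_length G S x" "set ws \<subseteq> letters" "word_value ws = x"
      using word_length_attained[OF x(1)] by blast
    then show "x \<in> word_value ` {ws. set ws \<subseteq> letters \<and> length ws \<le> r}" using x(2) by force
  qed
qed

text \<open>A shortest word is cut after \<open>k\<close> letters; subadditivity forces both pieces
  to be shortest as well.\<close>

lemma word_length_geodesic:
  assumes x: "x \<in> carrier G" and k: "k \<le> word_length G S x"
  shows "\<exists>y\<in>carrier G. word_length G S y = k \<and> word_length G S (inv y \<otimes> x) = word_length G S x - k"
proof -
  obtain ws where ws: "length ws = word_length G S x" "set ws \<subseteq> letters" "word_value ws = x"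
    using word_length_attained[OF x] by blast
  define y z where "y = word_value (take k ws)" and "z = word_value (drop k ws)"
  have sets: "set (take k ws) \<subseteq> letters" "set (drop k ws) \<subseteq> letters"
    using ws(2) set_take_subset[of k ws] set_drop_subset[of k ws] by blast+
  then have yz: "y \<in> carrier G" "z \<in> carrier G"
    using letters_carrier unfolding y_def z_def by (meson word_value_closed subset_trans)+
  have "x = y \<otimes> z"
    using word_value_append[of "take k ws" "drop k ws"] sets letters_carrier ws(3)
    by (simp add: y_def z_def subset_trans)
  then have "inv y \<otimes> x = z" using yz by (simp add: inv_cancel_left)
  moreover have "word_length G S y \<le> k" "word_length G S z \<le> word_length G S x - k"
    using word_length_le[OF sets(1)] word_length_le[OF sets(2)] ws(1) k by (simp_all add: y_def z_def)
  moreover have "word_length G S x \<le> word_length G S y + word_length G S z"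
    using word_length_mult[OF yz] \<open>x = y \<otimes> z\<close> by simp
  ultimately show ?thesis using yz k by (intro bexI[of _ y]) auto
qed

text \<open>Writing out the Gromov products and clearing the factor \<open>1 / 2\<close> turns
  Gromov's inequality into the four-point form, with \<open>2 * \<delta>\<close> in place of
  \<open>\<delta>\<close>.\<close>

lemma hyperbolic_length_word_length:
  assumes "finite S" and hyp: "gromov_hyperbolic_on (carrier G) (word_dist G S)"
  shows "\<exists>\<delta>. hyperbolic_length G (word_length G S) \<delta>"
proof -
  define D where "D = word_dist G S"
  obtain \<delta> where \<delta>: "\<forall>w\<in>carrier G. \<forall>x\<in>carrier G. \<forall>y\<in>carrier G. \<forall>z\<in>carrier G.
        gromov_product D w x z \<ge> min (gromov_product D w x y) (gromov_product D w y z) - \<delta>"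
    using hyp unfolding gromov_hyperbolic_on_def D_def by blast
  have sym: "D x y = D y x" if "x \<in> carrier G" "y \<in> carrier G" for x y
    using word_length_inv[of "inv x \<otimes> y"] that by (simp add: D_def word_dist_def inv_mult_group)
  have "hyperbolic_length G (word_length G S) \<delta>"
  proof (unfold_locales)
    fix w x y z assume *: "w \<in> carrier G" "x \<in> carrier G" "y \<in> carrier G" "z \<in> carrier G"
    have "min (gromov_product D w x y) (gromov_product D w y z) - \<delta> \<le> gromov_product D w x z"
      using \<delta> * by blast
    then have "D w y + D x z \<le> max (D w x + D y z) (D w z + D x y) + 2 * \<delta>"
      using sym[OF *(1,2)] sym[OF *(1,3)] sym[OF *(1,4)]
      by (auto simp: gromov_product_def field_simps max_def min_def split: if_splits)
    then show "real (word_length G S (inv w \<otimes> y)) + real (word_length G S (inv x \<otimes> z))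
       \<le> max (real (word_length G S (inv w \<otimes> x)) + real (word_length G S (inv y \<otimes> z)))
           (real (word_length G S (inv w \<otimes> z)) + real (word_length G S (inv x \<otimes> y))) + 2 * \<delta>"
      by (simp add: D_def word_dist_def)
  qed (simp_all add: word_length_one word_length_inv word_length_mult finite_word_ball word_length_geodesic assms(1))
  then show ?thesis ..
qed

section \<open>Homomorphisms from a finitely generated group to a finite group\<close>

lemma hom_eq_on_generators:
  assumes F: "group F" and \<rho>: "\<rho> \<in> hom G F" "\<rho>' \<in> hom G F"
    and eq: "\<And>s. s \<in> S \<Longrightarrow> \<rho> s = \<rho>' s" and x: "x \<in> carrier G"
  shows "\<rho> x = \<rho>' x"
proof -
  interpret F: group F by (rule F)
  interpret \<rho>: group_hom G F \<rho> by unfold_locales (rule \<rho>)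
  interpret \<rho>': group_hom G F \<rho>' by unfold_locales (rule \<rho>)
  have "x \<in> generate G S" using x gen by simp
  then show ?thesis
  proof induction
    case (inv h) then show ?case using eq S by auto
  next
    case (eng h1 h2) then show ?case using gen by simp
  qed (use eq in auto)
qed

text \<open>Extensionality removes the arbitrary values off the carrier, so that restriction to the
  finite set \<open>S\<close> is injective.\<close>

lemma finite_homs:
  assumes "finite S" and F: "group F" "finite (carrier F)"
  shows "finite (hom G F \<inter> extensional (carrier G))"
proof (rule inj_on_finite)
  show "inj_on (\<lambda>\<rho>. restrict \<rho> S) (hom G F \<inter> extensional (carrier G))"
  proof (rule inj_onI)
    fix \<rho> \<rho>' assume \<rho>: "\<rho> \<in> hom G F \<inter> extensional (carrier G)" "\<rho>' \<in> hom G F \<inter> extensional (carrier G)"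
      and eq: "restrict \<rho> S = restrict \<rho>' S"
    have "\<rho> s = \<rho>' s" if "s \<in> S" for s using fun_cong[OF eq, of s] that by simp
    then show "\<rho> = \<rho>'" using hom_eq_on_generators[OF F(1)] \<rho> by (intro extensionalityI[of _ "carrier G"]) auto
  qed
  show "(\<lambda>\<rho>. restrict \<rho> S) ` (hom G F \<inter> extensional (carrier G)) \<subseteq> S \<rightarrow>\<^sub>E carrier F"
    using S by (auto simp: hom_def)
  show "finite (S \<rightarrow>\<^sub>E carrier F)" using assms by (intro finite_PiE)
qed

end

end

section \<open>Outer automorphisms\<close>

text \<open>\<open>Aut G\<close> acts by precomposition on the set of homomorphisms from \<open>G\<close> to \<open>F\<close> up to conjugacy in \<open>F\<close>. This is
  the kernel of that action.\<close>

definition hom_stabilizer :: "('a, 'b) monoid_scheme \<Rightarrow> ('c, 'd) monoid_scheme \<Rightarrow> ('a \<Rightarrow> 'a) set" where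
  "hom_stabilizer G F = {\<phi> \<in> carrier (AutoGroup G).
     \<forall>\<rho>\<in>hom G F. \<exists>f\<in>carrier F. \<forall>x\<in>carrier G. \<rho> (\<phi> x) = f \<otimes>\<^bsub>F\<^esub> \<rho> x \<otimes>\<^bsub>F\<^esub> inv\<^bsub>F\<^esub> f}"

context group
begin

lemma AutoGroup_facts:
  assumes "\<phi> \<in> carrier (AutoGroup G)"
  shows "\<phi> \<in> hom G G" "\<phi> \<in> carrier G \<rightarrow> carrier G"
    "\<And>\<psi> x. \<lbrakk>\<psi> \<in> carrier (AutoGroup G); x \<in> carrier G\<rbrakk> \<Longrightarrow> (\<phi> \<otimes>\<^bsub>AutoGroup G\<^esub> \<psi>) x = \<phi> (\<psi> x)"
    "\<And>x. x \<in> carrier G \<Longrightarrow> \<phi> ((inv\<^bsub>AutoGroup G\<^esub> \<phi>) x) = x"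
proof -
  interpret A: group "AutoGroup G" by (rule AutoGroup)
  show "\<phi> \<in> hom G G" using assms by (simp add: AutoGroup_def auto_def)
  then show "\<phi> \<in> carrier G \<rightarrow> carrier G" by (auto simp: hom_def)
  show mult: "(\<phi> \<otimes>\<^bsub>AutoGroup G\<^esub> \<psi>) x = \<phi> (\<psi> x)" if "\<psi> \<in> carrier (AutoGroup G)" "x \<in> carrier G" for \<psi> x
    using assms that by (simp add: AutoGroup_def BijGroup_def auto_def compose_eq)
  show "\<phi> ((inv\<^bsub>AutoGroup G\<^esub> \<phi>) x) = x" if "x \<in> carrier G" for x
  proof -
    have "\<phi> ((inv\<^bsub>AutoGroup G\<^esub> \<phi>) x) = (\<phi> \<otimes>\<^bsub>AutoGroup G\<^esub> inv\<^bsub>AutoGroup G\<^esub> \<phi>) x"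
      using mult[of "inv\<^bsub>AutoGroup G\<^esub> \<phi>"] assms that by simp
    also have "\<dots> = \<one>\<^bsub>AutoGroup G\<^esub> x" using A.r_inv[OF assms] by simp
    also have "\<dots> = x" using that by (simp add: AutoGroup_def BijGroup_def)
    finally show ?thesis .
  qed
qed

text \<open>The defining condition ranges over all \<open>\<rho>\<close>, so it may be used for
  \<open>\<rho>\<close> composed with an automorphism; this yields closure under inverses and under
  conjugation.\<close>

lemma hom_stabilizer_normal:
  assumes F: "group F"
  shows "hom_stabilizer G F \<lhd> AutoGroup G"
proof -
  interpret A: group "AutoGroup G" by (rule AutoGroup)
  interpret F: group F by (rule F)
  have comp: "\<rho> \<circ> \<phi> \<in> hom G F" if "\<rho> \<in> hom G F" "\<phi> \<in> carrier (AutoGroup G)" for \<rho> \<phi>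
    using AutoGroup_facts(1)[OF that(2)] that(1) by (rule Group.hom_compose)
  have cl: "\<rho> x \<in> carrier F" if "\<rho> \<in> hom G F" "x \<in> carrier G" for \<rho> x using that by (rule hom_in_carrier)
  have Acl: "\<phi> x \<in> carrier G" if "\<phi> \<in> carrier (AutoGroup G)" "x \<in> carrier G" for \<phi> x
    using AutoGroup_facts(2)[OF that(1)] that(2) by auto
  show ?thesis unfolding A.normal_inv_iff
  proof (intro conjI ballI)
    show "subgroup (hom_stabilizer G F) (AutoGroup G)"
    proof (rule A.subgroupI)
      show "hom_stabilizer G F \<subseteq> carrier (AutoGroup G)" by (auto simp: hom_stabilizer_def)
      have "\<one>\<^bsub>AutoGroup G\<^esub> \<in> hom_stabilizer G F"
        unfolding hom_stabilizer_def
      proof (intro CollectI conjI ballI)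
        fix \<rho> assume "\<rho> \<in> hom G F"
        then show "\<exists>f\<in>carrier F. \<forall>x\<in>carrier G. \<rho> (\<one>\<^bsub>AutoGroup G\<^esub> x) = f \<otimes>\<^bsub>F\<^esub> \<rho> x \<otimes>\<^bsub>F\<^esub> inv\<^bsub>F\<^esub> f"
          using cl by (intro bexI[of _ "\<one>\<^bsub>F\<^esub>"]) (auto simp: AutoGroup_def BijGroup_def)
      qed simp
      then show "hom_stabilizer G F \<noteq> {}" by blast
    next
      fix \<phi> assume *: "\<phi> \<in> hom_stabilizer G F"
      then have \<phi>: "\<phi> \<in> carrier (AutoGroup G)" by (simp add: hom_stabilizer_def)
      let ?\<psi> = "inv\<^bsub>AutoGroup G\<^esub> \<phi>"
      have \<psi>: "?\<psi> \<in> carrier (AutoGroup G)" using \<phi> by simp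
      show "?\<psi> \<in> hom_stabilizer G F" unfolding hom_stabilizer_def
      proof (intro CollectI conjI ballI)
        fix \<rho> assume \<rho>: "\<rho> \<in> hom G F"
        obtain f where f: "f \<in> carrier F"
          and eq: "\<And>x. x \<in> carrier G \<Longrightarrow> (\<rho> \<circ> ?\<psi>) (\<phi> x) = f \<otimes>\<^bsub>F\<^esub> (\<rho> \<circ> ?\<psi>) x \<otimes>\<^bsub>F\<^esub> inv\<^bsub>F\<^esub> f"
          using * comp[OF \<rho> \<psi>] unfolding hom_stabilizer_def by blast
        have "\<rho> (?\<psi> x) = inv\<^bsub>F\<^esub> f \<otimes>\<^bsub>F\<^esub> \<rho> x \<otimes>\<^bsub>F\<^esub> inv\<^bsub>F\<^esub> (inv\<^bsub>F\<^esub> f)" if x: "x \<in> carrier G" for x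
        proof -
          have "?\<psi> (\<phi> x) = x" using AutoGroup_facts(4)[OF \<psi> x] \<phi> by simp
          then have "\<rho> x = f \<otimes>\<^bsub>F\<^esub> \<rho> (?\<psi> x) \<otimes>\<^bsub>F\<^esub> inv\<^bsub>F\<^esub> f" using eq[OF x] by simp
          then show ?thesis using f cl[OF \<rho>] Acl[OF \<psi> x] by (simp add: F.group_normalize)
        qed
        then show "\<exists>f\<in>carrier F. \<forall>x\<in>carrier G. \<rho> (?\<psi> x) = f \<otimes>\<^bsub>F\<^esub> \<rho> x \<otimes>\<^bsub>F\<^esub> inv\<^bsub>F\<^esub> f"
          using f by blast
      qed (rule \<psi>)
    next
      fix \<phi> \<psi> assume *: "\<phi> \<in> hom_stabilizer G F" "\<psi> \<in> hom_stabilizer G F"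
      then have A: "\<phi> \<in> carrier (AutoGroup G)" "\<psi> \<in> carrier (AutoGroup G)" by (simp_all add: hom_stabilizer_def)
      show "\<phi> \<otimes>\<^bsub>AutoGroup G\<^esub> \<psi> \<in> hom_stabilizer G F" unfolding hom_stabilizer_def
      proof (intro CollectI conjI ballI)
        fix \<rho> assume \<rho>: "\<rho> \<in> hom G F"
        obtain f where f: "f \<in> carrier F"
          and eq: "\<And>x. x \<in> carrier G \<Longrightarrow> \<rho> (\<phi> x) = f \<otimes>\<^bsub>F\<^esub> \<rho> x \<otimes>\<^bsub>F\<^esub> inv\<^bsub>F\<^esub> f"
          using *(1) \<rho> unfolding hom_stabilizer_def by blast
        obtain f' where f': "f' \<in> carrier F"
          and eq': "\<And>x. x \<in> carrier G \<Longrightarrow> \<rho> (\<psi> x) = f' \<otimes>\<^bsub>F\<^esub> \<rho> x \<otimes>\<^bsub>F\<^esub> inv\<^bsub>F\<^esub> f'"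
          using *(2) \<rho> unfolding hom_stabilizer_def by blast
        have "\<rho> ((\<phi> \<otimes>\<^bsub>AutoGroup G\<^esub> \<psi>) x) = (f \<otimes>\<^bsub>F\<^esub> f') \<otimes>\<^bsub>F\<^esub> \<rho> x \<otimes>\<^bsub>F\<^esub> inv\<^bsub>F\<^esub> (f \<otimes>\<^bsub>F\<^esub> f')"
          if x: "x \<in> carrier G" for x
          using AutoGroup_facts(3)[OF A(1,2) x] eq[OF Acl[OF A(2) x]] eq'[OF x] f f' cl[OF \<rho> x]
          by (simp add: F.group_normalize)
        then show "\<exists>f\<in>carrier F. \<forall>x\<in>carrier G. \<rho> ((\<phi> \<otimes>\<^bsub>AutoGroup G\<^esub> \<psi>) x) = f \<otimes>\<^bsub>F\<^esub> \<rho> x \<otimes>\<^bsub>F\<^esub> inv\<^bsub>F\<^esub> f"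
          using f f' by blast
      qed (use A in simp)
    qed
  next
    fix \<sigma> \<phi> assume \<sigma>: "\<sigma> \<in> carrier (AutoGroup G)" and *: "\<phi> \<in> hom_stabilizer G F"
    then have \<phi>: "\<phi> \<in> carrier (AutoGroup G)" by (simp add: hom_stabilizer_def)
    let ?\<tau> = "inv\<^bsub>AutoGroup G\<^esub> \<sigma>"
    have \<tau>: "?\<tau> \<in> carrier (AutoGroup G)" using \<sigma> by simp
    show "\<sigma> \<otimes>\<^bsub>AutoGroup G\<^esub> \<phi> \<otimes>\<^bsub>AutoGroup G\<^esub> ?\<tau> \<in> hom_stabilizer G F" unfolding hom_stabilizer_def
    proof (intro CollectI conjI ballI)
      fix \<rho> assume \<rho>: "\<rho> \<in> hom G F"
      obtain f where f: "f \<in> carrier F"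
        and eq: "\<And>x. x \<in> carrier G \<Longrightarrow> (\<rho> \<circ> \<sigma>) (\<phi> x) = f \<otimes>\<^bsub>F\<^esub> (\<rho> \<circ> \<sigma>) x \<otimes>\<^bsub>F\<^esub> inv\<^bsub>F\<^esub> f"
        using * comp[OF \<rho> \<sigma>] unfolding hom_stabilizer_def by blast
      have "\<rho> ((\<sigma> \<otimes>\<^bsub>AutoGroup G\<^esub> \<phi> \<otimes>\<^bsub>AutoGroup G\<^esub> ?\<tau>) x) = f \<otimes>\<^bsub>F\<^esub> \<rho> x \<otimes>\<^bsub>F\<^esub> inv\<^bsub>F\<^esub> f" if x: "x \<in> carrier G" for x
        using eq[OF Acl[OF \<tau> x]] AutoGroup_facts(3)[OF _ \<tau> x, of "\<sigma> \<otimes>\<^bsub>AutoGroup G\<^esub> \<phi>"]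
          AutoGroup_facts(3)[OF \<sigma> \<phi> Acl[OF \<tau> x]] AutoGroup_facts(4)[OF \<sigma> x] \<sigma> \<phi> by simp
      then show "\<exists>f\<in>carrier F. \<forall>x\<in>carrier G.
          \<rho> ((\<sigma> \<otimes>\<^bsub>AutoGroup G\<^esub> \<phi> \<otimes>\<^bsub>AutoGroup G\<^esub> ?\<tau>) x) = f \<otimes>\<^bsub>F\<^esub> \<rho> x \<otimes>\<^bsub>F\<^esub> inv\<^bsub>F\<^esub> f" using f by blast
    qed (use \<sigma> \<phi> in simp)
  qed
qed

lemma inner_auts_subset_hom_stabilizer:
  assumes F: "group F"
  shows "inner_auts G \<subseteq> hom_stabilizer G F"
proof
  fix \<phi> assume \<phi>: "\<phi> \<in> inner_auts G"
  interpret F: group F by (rule F)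
  obtain g where g: "g \<in> carrier G" "\<phi> = conj_aut G g" using \<phi> by (auto simp: inner_auts_def)
  show "\<phi> \<in> hom_stabilizer G F" unfolding hom_stabilizer_def
  proof (intro CollectI conjI ballI)
    show "\<phi> \<in> carrier (AutoGroup G)" using g conj_aut_hom by (auto simp: hom_def)
    fix \<rho> assume \<rho>: "\<rho> \<in> hom G F"
    interpret \<rho>: group_hom G F \<rho> by unfold_locales (rule \<rho>)
    show "\<exists>f\<in>carrier F. \<forall>x\<in>carrier G. \<rho> (\<phi> x) = f \<otimes>\<^bsub>F\<^esub> \<rho> x \<otimes>\<^bsub>F\<^esub> inv\<^bsub>F\<^esub> f"
      using g by (intro bexI[of _ "\<rho> g"]) (auto simp: conj_aut_def)
  qed
qed

lemma hom_stabilizer_finite_index: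
  assumes S: "finite S" "S \<subseteq> carrier G" "generate G S = carrier G"
    and F: "group F" "finite (carrier F)"
  shows "finite (carrier (AutoGroup G Mod hom_stabilizer G F))"
proof -
  interpret A: group "AutoGroup G" by (rule AutoGroup)
  interpret F: group F by (rule F)
  interpret M: normal "hom_stabilizer G F" "AutoGroup G" by (rule hom_stabilizer_normal[OF F(1)])
  define homs where "homs = hom G F \<inter> extensional (carrier G)"
  have homs: "finite homs" unfolding homs_def by (rule finite_homs[OF S(2,3,1) F])
  \<comment> \<open>The action of \<open>\<phi>\<close> on \<open>homs\<close>, a point of a finite
    function space. Automorphisms with equal keys differ by one that fixes every homomorphism
    outright, so the index is finite even before passing to conjugacy classes.\<close>
  define key where "key = (\<lambda>\<phi>. \<lambda>\<rho>\<in>homs. compose (carrier G) \<rho> \<phi>)"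
  have comp: "\<rho> \<circ> \<phi> \<in> hom G F" if "\<rho> \<in> hom G F" "\<phi> \<in> carrier (AutoGroup G)" for \<rho> \<phi>
    using AutoGroup_facts(1)[OF that(2)] that(1) by (rule Group.hom_compose)
  have "key ` carrier (AutoGroup G) \<subseteq> homs \<rightarrow>\<^sub>E homs"
  proof -
    have "compose (carrier G) \<rho> \<phi> \<in> homs" if "\<rho> \<in> homs" "\<phi> \<in> carrier (AutoGroup G)" for \<rho> \<phi>
    proof -
      have "\<rho> \<circ> \<phi> \<in> hom G F" using comp that by (simp add: homs_def)
      then have "compose (carrier G) \<rho> \<phi> \<in> hom G F" by (auto simp: hom_def compose_def)
      then show ?thesis by (simp add: homs_def)
    qed
    then show ?thesis by (auto simp: key_def)
  qed
  then have fin: "finite (key ` carrier (AutoGroup G))"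
    using finite_subset[OF _ finite_PiE[OF homs, of "\<lambda>_. homs"]] homs by blast
  show ?thesis unfolding carrier_FactGroup
  proof (rule finite_image_if_determined[OF fin])
    fix \<phi> \<psi> assume \<phi>: "\<phi> \<in> carrier (AutoGroup G)" and \<psi>: "\<psi> \<in> carrier (AutoGroup G)" and eq: "key \<phi> = key \<psi>"
    let ?\<psi>' = "inv\<^bsub>AutoGroup G\<^esub> \<psi>"
    have \<psi>': "?\<psi>' \<in> carrier (AutoGroup G)" using \<psi> by simp
    have same: "\<rho> (\<phi> x) = \<rho> (\<psi> x)" if \<rho>: "\<rho> \<in> hom G F" and x: "x \<in> carrier G" for \<rho> x
    proof -
      have rX: "restrict \<rho> (carrier G) \<in> homs" using \<rho> by (auto simp: homs_def hom_def)
      have "compose (carrier G) (restrict \<rho> (carrier G)) \<phi> x = compose (carrier G) (restrict \<rho> (carrier G)) \<psi> x"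
        using fun_cong[OF eq, of "restrict \<rho> (carrier G)"] rX by (simp add: key_def)
      then show ?thesis
        using x AutoGroup_facts(2)[OF \<phi>] AutoGroup_facts(2)[OF \<psi>] by (auto simp: compose_def Pi_iff)
    qed
    have "\<phi> \<otimes>\<^bsub>AutoGroup G\<^esub> ?\<psi>' \<in> hom_stabilizer G F" unfolding hom_stabilizer_def
    proof (intro CollectI conjI ballI)
      fix \<rho> assume \<rho>: "\<rho> \<in> hom G F"
      have "\<rho> ((\<phi> \<otimes>\<^bsub>AutoGroup G\<^esub> ?\<psi>') x) = \<rho> x" if x: "x \<in> carrier G" for x
        using same[OF \<rho>, of "?\<psi>' x"] AutoGroup_facts(2)[OF \<psi>'] x
          AutoGroup_facts(3)[OF \<phi> \<psi>' x] AutoGroup_facts(4)[OF \<psi> x] by auto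
      then show "\<exists>f\<in>carrier F. \<forall>x\<in>carrier G. \<rho> ((\<phi> \<otimes>\<^bsub>AutoGroup G\<^esub> ?\<psi>') x) = f \<otimes>\<^bsub>F\<^esub> \<rho> x \<otimes>\<^bsub>F\<^esub> inv\<^bsub>F\<^esub> f"
        using hom_in_carrier[OF \<rho>] by (intro bexI[of _ "\<one>\<^bsub>F\<^esub>"]) auto
    qed (use \<phi> \<psi> in simp)
    moreover have "\<phi> = (\<phi> \<otimes>\<^bsub>AutoGroup G\<^esub> ?\<psi>') \<otimes>\<^bsub>AutoGroup G\<^esub> \<psi>" using \<phi> \<psi> by (simp add: A.m_assoc)
    ultimately have "\<phi> \<in> hom_stabilizer G F #>\<^bsub>AutoGroup G\<^esub> \<psi>" by (auto simp: r_coset_def)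
    then show "hom_stabilizer G F #>\<^bsub>AutoGroup G\<^esub> \<phi> = hom_stabilizer G F #>\<^bsub>AutoGroup G\<^esub> \<psi>"
      using A.repr_independence[OF _ \<psi> M.subgroup_axioms] by simp
  qed
qed

text \<open>Dividing \<open>G Mod I\<close> by the image of \<open>M\<close> gives back
  \<open>G Mod M\<close>, which is finite; as \<open>M\<close> contains \<open>I\<close>, the coset
  of \<open>x\<close> stays outside that image.\<close>

lemma separate_in_quotient:
  assumes I: "I \<lhd> G" and M: "M \<lhd> G" "I \<subseteq> M" "finite (carrier (G Mod M))"
    and x: "x \<in> carrier G" "x \<notin> M"
  shows "\<exists>N. finite_quotient_kernel N (G Mod I) \<and> N #>\<^bsub>G Mod I\<^esub> (I #> x) \<noteq> \<one>\<^bsub>G Mod I Mod N\<^esub>"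
proof -
  interpret I: normal I G by (rule I)
  interpret M: normal M G by (rule M)
  interpret Q: group "G Mod I" by (rule I.factorgroup_is_group)
  define N where "N = (\<lambda>m. I #> m) ` M"
  have NI: "N \<lhd> G Mod I"
    unfolding N_def by (rule M.surj_hom_normal_subgroup)
      (use I.r_coset_hom_Mod in \<open>auto simp: group_hom_def group_hom_axioms_def carrier_FactGroup\<close>)
  interpret N: normal N "G Mod I" by (rule NI)
  have "finite (carrier (G Mod I Mod N))"
  proof -
    have "finite ((\<lambda>a. N #>\<^bsub>G Mod I\<^esub> (I #> a)) ` carrier G)"
    proof (rule finite_image_if_determined)
      show "finite ((\<lambda>a. M #> a) ` carrier G)" using M(3) by (simp add: carrier_FactGroup)
      fix a b assume ab: "a \<in> carrier G" "b \<in> carrier G" "M #> a = M #> b"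
      then obtain m where m: "m \<in> M" "a = m \<otimes> b"
        using rcos_self[OF ab(1) M.subgroup_axioms] by (auto simp: r_coset_def)
      then have "I #> a = (I #> m) \<otimes>\<^bsub>G Mod I\<^esub> (I #> b)" using ab by (simp add: I.rcos_sum)
      then have "I #> a \<in> N #>\<^bsub>G Mod I\<^esub> (I #> b)" using m by (auto simp: r_coset_def N_def)
      then show "N #>\<^bsub>G Mod I\<^esub> (I #> a) = N #>\<^bsub>G Mod I\<^esub> (I #> b)"
        using Q.repr_independence[OF _ _ N.subgroup_axioms] ab by (simp add: carrier_FactGroup)
    qed
    then show ?thesis by (simp add: carrier_FactGroup image_image)
  qed
  moreover have "N #>\<^bsub>G Mod I\<^esub> (I #> x) \<noteq> N"
  proof
    assume "N #>\<^bsub>G Mod I\<^esub> (I #> x) = N"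
    then have "I #> x \<in> N" using Q.coset_join1[OF _ _ N.subgroup_axioms] x by (simp add: carrier_FactGroup)
    then obtain m where m: "m \<in> M" "I #> x = I #> m" by (auto simp: N_def)
    then obtain i where "i \<in> I" "x = i \<otimes> m"
      using rcos_self[OF x(1) I.subgroup_axioms] by (auto simp: r_coset_def)
    then show False using m M(2) x(2) by auto
  qed
  ultimately show ?thesis using NI unfolding finite_quotient_kernel_def by auto
qed

text \<open>Grossman's criterion.\<close>

lemma residually_finite_OutGroup:
  assumes S: "finite S" "S \<subseteq> carrier G" "generate G S = carrier G"
    and cs: "conjugacy_separable G"
    and inner: "\<And>\<phi>. \<lbrakk>\<phi> \<in> hom G G; \<And>x. x \<in> carrier G \<Longrightarrow> conjugate_in G x (\<phi> x)\<rbrakk>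
      \<Longrightarrow> \<exists>h\<in>carrier G. \<forall>x\<in>carrier G. \<phi> x = h \<otimes> x \<otimes> inv h"
  shows "residually_finite (OutGroup G)"
  unfolding residually_finite_def
proof (intro ballI impI)
  interpret A: group "AutoGroup G" by (rule AutoGroup)
  interpret I: normal "inner_auts G" "AutoGroup G" by (rule inner_auts_normal)
  fix Y assume Y: "Y \<in> carrier (OutGroup G)" "Y \<noteq> \<one>\<^bsub>OutGroup G\<^esub>"
  obtain \<phi> where \<phi>: "\<phi> \<in> carrier (AutoGroup G)" "Y = inner_auts G #>\<^bsub>AutoGroup G\<^esub> \<phi>"
    using Y(1) by (auto simp: OutGroup_def carrier_FactGroup)
  have notin: "\<phi> \<notin> inner_auts G"
    using Y(2) \<phi> A.coset_join2[OF \<phi>(1) I.subgroup_axioms] by (auto simp: OutGroup_def)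
  have "\<exists>x\<in>carrier G. \<not> conjugate_in G x (\<phi> x)"
  proof (rule ccontr)
    assume "\<not> ?thesis"
    then obtain h where h: "h \<in> carrier G" "\<And>x. x \<in> carrier G \<Longrightarrow> \<phi> x = h \<otimes> x \<otimes> inv h"
      using inner[OF AutoGroup_facts(1)[OF \<phi>(1)]] by blast
    \<comment> \<open>Members of \<open>AutoGroup\<close> carry no information off the carrier, so
      agreement on it gives equality with \<open>conj_aut G h\<close>.\<close>
    have "\<phi> \<in> extensional (carrier G)" using \<phi>(1) by (simp add: AutoGroup_def auto_def Bij_def)
    then have "\<phi> = conj_aut G h"
      using h by (intro extensionalityI[of _ "carrier G"]) (auto simp: conj_aut_def)
    then show False using notin h by (auto simp: inner_auts_def)
  qed
  then obtain x where x: "x \<in> carrier G" "\<not> conjugate_in G x (\<phi> x)" by blast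
  have \<phi>x: "\<phi> x \<in> carrier G" using AutoGroup_facts(2)[OF \<phi>(1)] x by auto
  obtain N where N: "finite_quotient_kernel N G" "\<not> conjugate_in (G Mod N) (N #> x) (N #> \<phi> x)"
    using cs x \<phi>x unfolding conjugacy_separable_def by blast
  then interpret N: normal N G by (simp add: finite_quotient_kernel_def)
  have F: "group (G Mod N)" "finite (carrier (G Mod N))"
    using N.factorgroup_is_group N(1) by (auto simp: finite_quotient_kernel_def)
  \<comment> \<open>Tested on the quotient map itself, membership would make the images of
    \<open>x\<close> and \<open>\<phi> x\<close> conjugate.\<close>
  have "\<phi> \<notin> hom_stabilizer G (G Mod N)"
  proof
    assume "\<phi> \<in> hom_stabilizer G (G Mod N)"
    then have "\<forall>\<rho>\<in>hom G (G Mod N). \<exists>f\<in>carrier (G Mod N). \<forall>x\<in>carrier G.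
        \<rho> (\<phi> x) = f \<otimes>\<^bsub>G Mod N\<^esub> \<rho> x \<otimes>\<^bsub>G Mod N\<^esub> inv\<^bsub>G Mod N\<^esub> f"
      unfolding hom_stabilizer_def by blast
    from bspec[OF this N.r_coset_hom_Mod] x(1) N(2) show False unfolding conjugate_in_def by auto
  qed
  then show "\<exists>N. finite_quotient_kernel N (OutGroup G) \<and> N #>\<^bsub>OutGroup G\<^esub> Y \<noteq> \<one>\<^bsub>OutGroup G Mod N\<^esub>"
    unfolding OutGroup_def \<phi>(2)
    using A.separate_in_quotient[OF inner_auts_normal hom_stabilizer_normal[OF F(1)]
        inner_auts_subset_hom_stabilizer[OF F(1)] hom_stabilizer_finite_index[OF S F] \<phi>(1)] by blast
qed

end

theorem corollary1p3:
  fixes H :: "('a, 'b) monoid_scheme"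
  assumes "hyperbolic_group H"
    and "torsion_free H"
    and "conjugacy_separable H"
  shows "residually_finite (OutGroup H)"
proof -
  interpret group H using assms(1) by (simp add: hyperbolic_group_def)
  obtain S where S: "finite S" "S \<subseteq> carrier H" "generate H S = carrier H"
    and hyp: "gromov_hyperbolic_on (carrier H) (word_dist H S)"
    using assms(1) by (auto simp: hyperbolic_group_def)
  obtain \<delta> where "hyperbolic_length H (word_length H S) \<delta>"
    using hyperbolic_length_word_length[OF S(2,3,1) hyp] by blast
  then interpret torsion_free_hyperbolic H "word_length H S" \<delta>
    by (intro torsion_free_hyperbolic.intro torsion_free_hyperbolic_axioms.intro assms(2))
  show ?thesis
    by (rule residually_finite_OutGroup[OF S assms(3)]) (rule pointwise_inner_imp_inner)
qed

end
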